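(* Let $\Pi_f\subseteq Gr(k,n)$ be a positroid variety containing the $T$-fixed point $\lambda\in\binom{[n]}{k}$. Then $\Pi_f$ is singular at $\lambda$ if and only if the pair $(\Pi_f,\lambda)$ can be brought to an atomic positroid pair by a (possibly empty) finite sequence of deletions and contractions.
   Context: $Gr(k,n)$ is the Grassmannian of $k$-planes in $\mathbb{C}^n$, a point being the row span of a full-rank complex $k\times n$ matrix $M$. The $T$-fixed point $\lambda\in\binom{[n]}{k}$ ($T$ the diagonal torus acting by right multiplication) is the coordinate plane spanned by $e_i$, $i\in\lambda$. A bounded affine permutation for $(k,n)$ is a bijection $f:\mathbb{Z}\to\mathbb{Z}$ with $f(i+n)=f(i)+n$, $i\le f(i)\le i+n$, and $\frac1n\sum_{i=1}^n (f(i)-i)=k$. Extending the columns of $M$ periodically modulo $n$, the positroid variety $\Pi_f$ is the set of row spans of those $M$ such that for all $i\le j\le i+n$ the rank of columns $i,\dots,j$ is at most $(j-i+1)-\#\{a\ge i: f(a)\le j\}$. $\Pi_{del,i}=\{V\in Gr(k,n): V\subseteq\{x_i=0\}\}\cong Gr(k,n-1)$ (forget the $i$-th coordinate) and $\Pi_{contr,i}=\{V\in Gr(k,n): e_i\in V\}\cong Gr(k-1,n-1)$ (project along $e_i$). A positroid pair is a pair $(\Pi_f,\lambda)$ with $\lambda\in\Pi_f$. For $i\notin\lambda$, the deletion of the $i$-th column of $(\Pi_f,\lambda)$ is the pair consisting of the image of $\Pi_f\cap\Pi_{del,i}$ in $Gr(k,n-1)$ (a positroid variety) and the image of $\lambda$;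 for $i\in\lambda$, the contraction of the $i$-th column is the pair consisting of the image of $\Pi_f\cap\Pi_{contr,i}$ in $Gr(k-1,n-1)$ (a positroid variety) and the image of $\lambda$. (For $i\in\lambda$ the deletion, and for $i\notin\lambda$ the contraction, does not contain the point.) The pair $(\Pi_f,\lambda)$ is atomic if $\Pi_f$ is singular at $\lambda$ but every deletion and every contraction, of any column, is smooth (or empty) at the point. *)

theory Defs
  imports "HOL-Analysis.Analysis" "Jordan_Normal_Form.DL_Rank"
begin

text \<open>Columns of a matrix with \<open>n\<close> columns are numbered \<open>0, \<dots>, n - 1\<close>, and a column number in
  the integers is read modulo \<open>n\<close>.  This is the usual numbering \<open>1, \<dots>, n\<close> shifted by one; all
  notions below are compatible with that shift (which conjugates \<open>f\<close> by a translation).\<close>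

section \<open>Positroid varieties\<close>

definition bounded_affine_permutation :: "nat \<Rightarrow> nat \<Rightarrow> (int \<Rightarrow> int) \<Rightarrow> bool" where
  "bounded_affine_permutation k n f \<longleftrightarrow>
     0 < n \<and> bij f \<and>
     (\<forall>i. f (i + int n) = f i + int n) \<and>
     (\<forall>i. i \<le> f i \<and> f i \<le> i + int n) \<and>
     (\<Sum>i = 0..<int n. f i - i) = int k * int n"

definition full_rank_mats :: "nat \<Rightarrow> nat \<Rightarrow> complex mat set" where
  "full_rank_mats k n = {M \<in> carrier_mat k n. vec_space.rank k M = k}"

definition row_span :: "nat \<Rightarrow> complex mat \<Rightarrow> complex vec set" where
  "row_span n M = vec_space.row_space n M"

definition grassmannian :: "nat \<Rightarrow> nat \<Rightarrow> complex vec set set" where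
  "grassmannian k n = row_span n ` full_rank_mats k n"

definition periodic_columns :: "nat \<Rightarrow> nat \<Rightarrow> complex mat \<Rightarrow> int \<Rightarrow> int \<Rightarrow> complex mat" where
  "periodic_columns k n M i j =
     mat_of_cols k (map (\<lambda>a. col M (nat (a mod int n))) [i..j])"

definition positroid_variety :: "nat \<Rightarrow> nat \<Rightarrow> (int \<Rightarrow> int) \<Rightarrow> complex vec set set" where
  "positroid_variety k n f =
     row_span n ` {M \<in> full_rank_mats k n.
       \<forall>i j. i \<le> j \<and> j \<le> i + int n \<longrightarrow>
         int (vec_space.rank k (periodic_columns k n M i j))
           \<le> (j - i + 1) - int (card {a. i \<le> a \<and> f a \<le> j})}"

definition coordinate_plane :: "nat \<Rightarrow> nat set \<Rightarrow> complex vec set" where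
  "coordinate_plane n L =
     row_span n (mat_of_rows n (map (unit_vec n) (sorted_list_of_set L)))"

section \<open>Smooth and singular points\<close>

text \<open>Points of affine space with coordinates indexed by a finite set \<open>I\<close> are given by functions
  \<open>'i \<Rightarrow> complex\<close>, whose values outside \<open>I\<close> are irrelevant.  The complex numbers being infinite,
  polynomial functions are the same as polynomials.\<close>

inductive_set polynomial_functions :: "'i set \<Rightarrow> (('i \<Rightarrow> complex) \<Rightarrow> complex) set" for I where
  const: "(\<lambda>z. c) \<in> polynomial_functions I"
| coord: "i \<in> I \<Longrightarrow> (\<lambda>z. z i) \<in> polynomial_functions I"
| add: "p \<in> polynomial_functions I \<Longrightarrow> q \<in> polynomial_functions I \<Longrightarrow>
          (\<lambda>z. p z + q z) \<in> polynomial_functions I"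
| mult: "p \<in> polynomial_functions I \<Longrightarrow> q \<in> polynomial_functions I \<Longrightarrow>
          (\<lambda>z. p z * q z) \<in> polynomial_functions I"

definition vanishing_ideal ::
  "'i set \<Rightarrow> ('i \<Rightarrow> complex) set \<Rightarrow> (('i \<Rightarrow> complex) \<Rightarrow> complex) set" where
  "vanishing_ideal I S = {p \<in> polynomial_functions I. \<forall>z \<in> S. p z = 0}"

definition partial_deriv ::
  "'i \<Rightarrow> (('i \<Rightarrow> complex) \<Rightarrow> complex) \<Rightarrow> ('i \<Rightarrow> complex) \<Rightarrow> complex" where
  "partial_deriv i p z = deriv (\<lambda>t. p (z(i := t))) (z i)"

text \<open>Smoothness of a closed subvariety \<open>S\<close> of affine space at a point \<open>z\<close> of \<open>S\<close>: the ideal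
  of \<open>S\<close> is generated, in the local ring of the affine space at \<open>z\<close>, by finitely many functions
  whose differentials at \<open>z\<close> are linearly independent (Bosch--Luetkebohmert--Raynaud,
  Neron Models, Section 2.2, Definition 3).  The factor \<open>h\<close> is the denominator in the local ring.\<close>

definition smooth_point :: "'i set \<Rightarrow> ('i \<Rightarrow> complex) set \<Rightarrow> ('i \<Rightarrow> complex) \<Rightarrow> bool" where
  "smooth_point I S z \<longleftrightarrow>
     (\<exists>(c::nat) g.
        (\<forall>a<c. g a \<in> vanishing_ideal I S) \<and>
        (\<forall>u. (\<forall>i\<in>I. (\<Sum>a<c. u a * partial_deriv i (g a) z) = 0) \<longrightarrow> (\<forall>a<c. u a = 0)) \<and>
        (\<forall>q \<in> vanishing_ideal I S. \<exists>h \<in> polynomial_functions I. \<exists>r.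
           h z \<noteq> 0 \<and> (\<forall>a<c. r a \<in> polynomial_functions I) \<and>
           (\<forall>w. h w * q w = (\<Sum>a<c. r a w * g a w))))"

text \<open>The standard affine chart of the Grassmannian around \<open>coordinate_plane n L\<close>: row spans of
  matrices whose columns in \<open>L\<close> form an identity matrix.  The free entries are indexed by
  \<open>chart_coords n L\<close>, and the fixed point has all of them zero.\<close>

definition chart_coords :: "nat \<Rightarrow> nat set \<Rightarrow> (nat \<times> nat) set" where
  "chart_coords n L = L \<times> ({..<n} - L)"

definition chart_point :: "nat \<Rightarrow> nat set \<Rightarrow> (nat \<times> nat \<Rightarrow> complex) \<Rightarrow> complex vec set" where
  "chart_point n L z = row_span n (mat_of_rows n
     (map (\<lambda>i. vec n (\<lambda>j. if j \<in> L then (if j = i then 1 else 0) else z (i, j)))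
        (sorted_list_of_set L)))"

definition smooth_at :: "nat \<Rightarrow> nat set \<Rightarrow> complex vec set set \<Rightarrow> bool" where
  "smooth_at n L X \<longleftrightarrow> smooth_point (chart_coords n L) {z. chart_point n L z \<in> X} (\<lambda>_. 0)"

section \<open>Deletion, contraction and atomic pairs\<close>

text \<open>\<open>(k, n, X, L)\<close> stands for the pair of a subset \<open>X\<close> of the Grassmannian of \<open>k\<close>-planes in
  \<open>n\<close>-space and the fixed point \<open>coordinate_plane n L\<close>.\<close>

type_synonym pointed_variety = "nat \<times> nat \<times> complex vec set set \<times> nat set"

fun positroid_pair :: "pointed_variety \<Rightarrow> bool" where
  "positroid_pair (k, n, X, L) \<longleftrightarrow>
     (\<exists>f. bounded_affine_permutation k n f \<and> X = positroid_variety k n f) \<and>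
     L \<subseteq> {..<n} \<and> card L = k \<and> coordinate_plane n L \<in> X"

text \<open>A pair whose point does not lie on the variety is not singular.\<close>

fun singular_pair :: "pointed_variety \<Rightarrow> bool" where
  "singular_pair (k, n, X, L) \<longleftrightarrow> coordinate_plane n L \<in> X \<and> \<not> smooth_at n L X"

definition forget_coord :: "nat \<Rightarrow> nat \<Rightarrow> complex vec \<Rightarrow> complex vec" where
  "forget_coord n i v = vec (n - 1) (\<lambda>j. v $ insert_index i j)"

text \<open>Deletion is the operation of the same name when \<open>i \<notin> L\<close>, contraction when \<open>i \<in> L\<close>.  In
  the other case the new point does not lie on the new variety: the index set has the wrong
  cardinality, or (contraction with \<open>k = 0\<close>) the new variety is empty.\<close>

fun deletion :: "nat \<Rightarrow> pointed_variety \<Rightarrow> pointed_variety" where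
  "deletion i (k, n, X, L) =
     (k, n - 1,
      (\<lambda>V. forget_coord n i ` V) ` {V \<in> X. \<forall>v \<in> V. v $ i = 0},
      delete_index i ` (L - {i}))"

fun contraction :: "nat \<Rightarrow> pointed_variety \<Rightarrow> pointed_variety" where
  "contraction i (k, n, X, L) =
     (k - 1, n - 1,
      (\<lambda>V. forget_coord n i ` V) ` {V \<in> X. unit_vec n i \<in> V},
      delete_index i ` (L - {i}))"

inductive reduction_step :: "pointed_variety \<Rightarrow> pointed_variety \<Rightarrow> bool" where
  delete: "i < n \<Longrightarrow> i \<notin> L \<Longrightarrow> reduction_step (k, n, X, L) (deletion i (k, n, X, L))"
| contract: "i < n \<Longrightarrow> i \<in> L \<Longrightarrow> reduction_step (k, n, X, L) (contraction i (k, n, X, L))"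

fun atomic_pair :: "pointed_variety \<Rightarrow> bool" where
  "atomic_pair (k, n, X, L) \<longleftrightarrow>
     positroid_pair (k, n, X, L) \<and> singular_pair (k, n, X, L) \<and>
     (\<forall>i<n. \<not> singular_pair (deletion i (k, n, X, L)) \<and>
            \<not> singular_pair (contraction i (k, n, X, L)))"

end

theory Submission
  imports Defs "HOL-Library.Function_Algebras"
begin

text \<open>A reduction by column \<open>i\<close> intersects the variety with a component of the fixed locus of the
one-parameter group that scales the \<open>i\<close>-th coordinate, the one that contains the coordinate plane.
Two facts about reductions give the theorem: a reduction of a positroid pair with at least two
columns is again a positroid pair (\<open>reduction_positroid_pair\<close>), and a reduction of a smooth pair
is smooth (\<open>reduction_singular\<close>).  Starting from a singular pair, reduce as long as some reduction
is singular.  Each reduction has one column fewer and a pair without columns is not singular, so this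
stops, necessarily at an atomic pair.  Conversely an atomic pair is singular, and singularity is
inherited by every pair above it in a chain of reductions.

Smoothness passes to the reduction because the reduction is a retract of the variety, inside the
standard chart: setting to zero all chart coordinates that involve \<open>i\<close> does not increase any rank of
consecutive columns, so it maps the variety to itself, and its image is the reduced variety.  For a
subvariety \<open>S\<close> of affine space with a coordinate retraction onto \<open>S'\<close>, restriction maps the ideal of
\<open>S\<close> onto the ideal of \<open>S'\<close> and pulling back along the retraction splits this map.  Restricted
generators generate, and by the splitting an element of the ideal of \<open>S'\<close> with vanishing differential
has coefficients in the maximal ideal; a Nakayama argument then discards generators until the
differentials are independent (\<open>smooth_point_retract\<close>).

For the first fact let \<open>i \<notin> L\<close>.  If \<open>f i = i\<close>, the \<open>i\<close>-th column is zero on all of the variety and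
removing it conjugates \<open>f\<close> by the order isomorphism from the integers to the integers not
congruent to \<open>i\<close>.  The value \<open>i + n\<close> is excluded, since the coordinate plane has rank \<open>k\<close> without
column \<open>i\<close>.  If \<open>f i \<noteq> i\<close>, let \<open>x < i\<close> be the largest integer with \<open>i \<le> f x < f i\<close> and
exchange the values at \<open>x\<close> and \<open>i\<close>, periodically.  On subspaces in the hyperplane of vanishing
\<open>i\<close>-th coordinate the new rank conditions follow from the old ones by subadditivity of the rank,
so the intersection with this hyperplane does not change, while \<open>f i\<close> decreases.  After finitely
many exchanges \<open>f i = i\<close> (\<open>deletion_swap\<close>).  For \<open>i \<in> L\<close> the situation is dual, \<open>f i\<close> increases
to \<open>i + n\<close>, and submodularity takes the place of subadditivity (\<open>contraction_swap\<close>).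

Ranks are studied through the row space \<open>W\<close>, viewed as a space of functions: the rank of a set \<open>S\<close> of
columns is the dimension of \<open>W\<close> minus the dimension of the functions in \<open>W\<close> that vanish on \<open>S\<close>.\<close>

section \<open>Bounded affine permutations\<close>

text \<open>Bounded affine permutations with unspecified \<open>k\<close>.  The sum condition, which determines \<open>k\<close>, is
traded for a count of points of the graph in \<open>affine_permutation_iff_window_count\<close>.\<close>

definition bounded_periodic :: "nat \<Rightarrow> (int \<Rightarrow> int) \<Rightarrow> bool" where
  "bounded_periodic n f \<longleftrightarrow> 0 < n \<and> bij f \<and> (\<forall>u. f (u + int n) = f u + int n) \<and>
     (\<forall>u. u \<le> f u \<and> f u \<le> u + int n)"

text \<open>The points of the graph of \<open>f\<close> that a rank condition counts.  They form a finite set because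
\<open>u \<le> f u\<close>.\<close>

definition dots :: "(int \<Rightarrow> int) \<Rightarrow> int \<Rightarrow> int \<Rightarrow> int set" where
  "dots f a b = {u. a \<le> u \<and> f u \<le> b}"

lemma bounded_periodic_shift:
  assumes "bounded_periodic n f"
  shows "f (u + m * int n) = f u + m * int n"
proof (induction m rule: int_induct[where k = 0])
  case base
  then show ?case by simp
next
  case (step1 m)
  have "f (u + (m + 1) * int n) = f ((u + m * int n) + int n)" by (simp add: algebra_simps)
  also have "\<dots> = f (u + m * int n) + int n"
    using assms unfolding bounded_periodic_def by blast
  finally show ?case using step1 by (simp add: algebra_simps)
next
  case (step2 m)
  have "f ((u + (m - 1) * int n) + int n) = f (u + (m - 1) * int n) + int n"
    using assms unfolding bounded_periodic_def by blast
  then show ?case using step2 by (simp add: algebra_simps)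
qed

lemma finite_dots:
  assumes "bounded_periodic n f"
  shows "finite (dots f a b)"
proof (rule finite_subset)
  show "dots f a b \<subseteq> {a..b}"
  proof
    fix u assume "u \<in> dots f a b"
    moreover have "u \<le> f u" using assms unfolding bounded_periodic_def by blast
    ultimately show "u \<in> {a..b}" unfolding dots_def by simp
  qed
qed simp

lemma dots_empty:
  assumes "bounded_periodic n f" and "b < a"
  shows "dots f a b = {}"
proof -
  have "u \<le> f u" for u using assms(1) unfolding bounded_periodic_def by blast
  then show ?thesis
    using assms(2) unfolding dots_def by (metis (mono_tags, lifting) Collect_empty_eq
        dual_order.trans not_le)
qed

text \<open>Both sides are one less than the number of points for the window from \<open>a\<close> to \<open>a + n\<close>, which has
exactly one point with argument \<open>a\<close> and exactly one with value \<open>a + n\<close>.\<close>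

lemma window_count_step:
  assumes "bounded_periodic n f"
  shows "card (dots f (a + 1) (a + int n)) = card (dots f a (a + int n - 1))"
proof -
  define v where "v = inv_into UNIV f (a + int n)"
  have bij: "bij f" and bd: "\<And>u. u \<le> f u" "\<And>u. f u \<le> u + int n"
    using assms unfolding bounded_periodic_def by auto
  have fv: "f v = a + int n" unfolding v_def using bij by (simp add: bij_is_surj surj_f_inv_f)
  have uni: "f u = a + int n \<Longrightarrow> u = v" for u using bij fv by (metis bij_is_inj injD)
  have "a \<le> v" using bd(2)[of v] fv by simp
  have e1: "dots f a (a + int n) = insert a (dots f (a + 1) (a + int n))"
    using bd(2)[of a] unfolding dots_def by auto
  have e2: "dots f a (a + int n) = insert v (dots f a (a + int n - 1))"
  proof (rule Set.set_eqI)
    fix u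
    show "u \<in> dots f a (a + int n) \<longleftrightarrow> u \<in> insert v (dots f a (a + int n - 1))"
    proof (cases "u = v")
      case False
      then have "f u \<noteq> a + int n" using uni by blast
      then show ?thesis using False unfolding dots_def by auto
    qed (use fv \<open>a \<le> v\<close> in \<open>simp add: dots_def\<close>)
  qed
  have n1: "a \<notin> dots f (a + 1) (a + int n)" unfolding dots_def by simp
  have n2: "v \<notin> dots f a (a + int n - 1)" unfolding dots_def using fv by simp
  have "Suc (card (dots f (a + 1) (a + int n))) = Suc (card (dots f a (a + int n - 1)))"
    using e1 e2 n1 n2 finite_dots[OF assms] by (metis card_insert_disjoint)
  then show ?thesis by simp
qed

lemma window_count_indep:
  assumes "bounded_periodic n f"
  shows "card (dots f a (a + int n - 1)) = card (dots f 0 (int n - 1))"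
proof (induction a rule: int_induct[where k = 0])
  case base
  then show ?case by simp
next
  case (step1 a)
  then show ?case using window_count_step[OF assms, of a] by (simp add: algebra_simps)
next
  case (step2 a)
  then show ?case using window_count_step[OF assms, of "a - 1"] by (simp add: algebra_simps)
qed

text \<open>Modulo \<open>n\<close> the function \<open>f\<close> permutes \<open>{0..<n}\<close>, so only the quotients contribute to the sum, and
boundedness makes them \<open>0\<close> or \<open>1\<close>.\<close>

lemma window_count_sum:
  assumes "bounded_periodic n f"
  shows "(\<Sum>u = 0..<int n. f u - u) = int n * (int n - int (card (dots f 0 (int n - 1))))"
proof -
  have bij: "bij f" and bd: "\<And>u. u \<le> f u" "\<And>u. f u \<le> u + int n" and n0: "0 < n"
    using assms unfolding bounded_periodic_def by auto
  let ?I = "{0..<int n}"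
  have inj: "inj_on (\<lambda>u. f u mod int n) ?I"
  proof (rule inj_onI)
    fix u v assume uv: "u \<in> ?I" "v \<in> ?I" and eq: "f u mod int n = f v mod int n"
    obtain m where "f u = f v + m * int n"
      using eq by (metis mod_eqE mult.commute)
    then have "f u = f (v + m * int n)" by (simp add: bounded_periodic_shift[OF assms])
    then have u: "u = v + m * int n" using bij by (metis bij_is_inj injD)
    then have "u mod int n = v mod int n" by simp
    then show "u = v" using uv by simp
  qed
  have img: "(\<lambda>u. f u mod int n) ` ?I = ?I"
    by (rule endo_inj_surj[OF _ _ inj]) (use n0 in auto)
  have s1: "(\<Sum>u\<in>?I. f u mod int n) = (\<Sum>u\<in>?I. u)"
    using sum.reindex[OF inj, of "\<lambda>x. x"] img by simp
  have dv: "f u div int n = (if f u \<le> int n - 1 then 0 else 1)" if "u \<in> ?I" for u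
  proof (cases "f u \<le> int n - 1")
    case True
    then show ?thesis using that bd(1)[of u] by (auto intro!: div_pos_pos_trivial)
  next
    case False
    have "f u div int n = 1"
      by (rule int_div_pos_eq[of _ _ _ "f u - int n"]) (use that bd(2)[of u] False in auto)
    then show ?thesis using False by simp
  qed
  have s2: "(\<Sum>u\<in>?I. f u div int n) = int n - int (card (dots f 0 (int n - 1)))"
  proof -
    have "(\<Sum>u\<in>?I. f u div int n) = (\<Sum>u\<in>?I. if f u \<le> int n - 1 then 0 else 1)"
      by (rule sum.cong) (use dv in auto)
    also have "\<dots> = (\<Sum>u\<in>?I. 1 - (if f u \<le> int n - 1 then 1 else 0))"
      by (rule sum.cong) auto
    also have "\<dots> = int n - (\<Sum>u\<in>?I. if f u \<le> int n - 1 then 1 else 0)"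
      by (simp add: sum_subtractf)
    also have "(\<Sum>u\<in>?I. if f u \<le> int n - 1 then 1 else 0) = int (card {u\<in>?I. f u \<le> int n - 1})"
      by (simp add: sum.If_cases Int_def)
    also have "{u\<in>?I. f u \<le> int n - 1} = dots f 0 (int n - 1)"
    proof (rule Set.set_eqI)
      fix u
      show "u \<in> {u\<in>?I. f u \<le> int n - 1} \<longleftrightarrow> u \<in> dots f 0 (int n - 1)"
        unfolding dots_def using bd(1)[of u] by auto
    qed
    finally show ?thesis .
  qed
  have "(\<Sum>u\<in>?I. f u) = (\<Sum>u\<in>?I. f u mod int n + int n * (f u div int n))"
    by (rule sum.cong) auto
  also have "\<dots> = (\<Sum>u\<in>?I. f u mod int n) + int n * (\<Sum>u\<in>?I. f u div int n)"
    by (simp only: sum.distrib sum_distrib_left)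
  finally have "(\<Sum>u\<in>?I. f u) = (\<Sum>u\<in>?I. u) + int n * (\<Sum>u\<in>?I. f u div int n)" using s1 by simp
  then show ?thesis using s2 by (simp add: sum_subtractf)
qed

text \<open>The rank condition for a full window of columns is vacuous: it bounds the rank by \<open>k\<close>.  In this
form the dependence on \<open>k\<close> survives exchanges and removals of columns, for which the sum of the
displacements is awkward.\<close>

lemma affine_permutation_iff_window_count:
  "bounded_affine_permutation k n f \<longleftrightarrow> bounded_periodic n f \<and> int (card (dots f a (a + int n - 1)))
      = int n - int k"
proof (cases "bounded_periodic n f")
  case True
  have n0: "0 < n" using True unfolding bounded_periodic_def by simp
  have "bounded_affine_permutation k n f \<longleftrightarrow> (\<Sum>u = 0..<int n. f u - u) = int k * int n"
    using True unfolding bounded_affine_permutation_def bounded_periodic_def by blast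
  also have "\<dots> \<longleftrightarrow> int n * (int n - int (card (dots f 0 (int n - 1)))) = int n * int k"
    by (simp add: window_count_sum[OF True] mult.commute)
  also have "\<dots> \<longleftrightarrow> int (card (dots f a (a + int n - 1))) = int n - int k"
    using n0 by (simp add: window_count_indep[OF True] mult_cancel_left) linarith
  finally show ?thesis using True by simp
next
  case False
  then show ?thesis unfolding bounded_affine_permutation_def bounded_periodic_def by blast
qed

definition periodic_swap :: "nat \<Rightarrow> int \<Rightarrow> int \<Rightarrow> int \<Rightarrow> int" where
  "periodic_swap n p q u =
     (if int n dvd u - p then u + (q - p) else if int n dvd u - q then u - (q - p) else u)"

context
  fixes n :: nat and p q :: int
  assumes n0: "0 < n" and pq: "p < q" "q < p + int n"
begin

lemma not_dvd_swap: "\<not> int n dvd q - p"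
  using pq by (simp add: zdvd_not_zless)

lemma periodic_swap_fst: "periodic_swap n p q (p + m * int n) = q + m * int n"
  unfolding periodic_swap_def by simp

lemma periodic_swap_snd: "periodic_swap n p q (q + m * int n) = p + m * int n"
proof -
  have "\<not> int n dvd q + m * int n - p"
  proof -
    have "q + m * int n - p = m * int n + (q - p)" by simp
    then show ?thesis using not_dvd_swap by (metis dvd_add_right_iff dvd_triv_right)
  qed
  then show ?thesis unfolding periodic_swap_def by simp
qed

lemma periodic_swap_other:
  assumes "\<And>m. u \<noteq> p + m * int n" and "\<And>m. u \<noteq> q + m * int n"
  shows "periodic_swap n p q u = u"
proof -
  have "\<not> int n dvd u - r" if "\<And>m. u \<noteq> r + m * int n" for r
    using that by (metis add.commute diff_add_cancel dvd_def mult.commute)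
  then show ?thesis unfolding periodic_swap_def using assms by simp
qed

lemma periodic_swap_cases:
  obtains (first) m where "u = p + m * int n" | (second) m where "u = q + m * int n"
  | (other) "\<And>m. u \<noteq> p + m * int n" "\<And>m. u \<noteq> q + m * int n"
  by blast

lemma periodic_swap_invol: "periodic_swap n p q (periodic_swap n p q u) = u"
  by (cases u rule: periodic_swap_cases)
     (simp_all add: periodic_swap_fst periodic_swap_snd periodic_swap_other)

lemma bij_periodic_swap: "bij (periodic_swap n p q)"
  by (rule bijI') (metis periodic_swap_invol)+

lemma periodic_swap_shift: "periodic_swap n p q (u + int n) = periodic_swap n p q u + int n"
proof -
  have "int n dvd u + int n - r \<longleftrightarrow> int n dvd u - r" for r
    by (metis add.commute add_diff_eq dvd_add_triv_left_iff)
  then show ?thesis unfolding periodic_swap_def by simp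
qed

end

text \<open>The last two hypotheses say that the new points \<open>(p, f q)\<close> and \<open>(q, f p)\<close> are bounded.\<close>

lemma bounded_periodic_swap:
  assumes bp: "bounded_periodic n f" and pq: "p < q" "q < p + int n"
    and "f p < f q" "f q \<le> p + int n" "q \<le> f p"
  shows "bounded_periodic n (f \<circ> periodic_swap n p q)"
proof -
  have n0: "0 < n" and bij: "bij f" and bd: "\<And>u. u \<le> f u" "\<And>u. f u \<le> u + int n"
      and per: "\<And>u. f (u + int n) = f u + int n"
    using bp unfolding bounded_periodic_def by auto
  note sh = bounded_periodic_shift[OF bp]
  have "u \<le> f (periodic_swap n p q u) \<and> f (periodic_swap n p q u) \<le> u + int n" for u
    by (cases rule: periodic_swap_cases[where u=u and n=n and p=p and q=q])
       (use assms bd in \<open>simp_all add: sh n0 periodic_swap_fst periodic_swap_snd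
           periodic_swap_other\<close>)
  then show ?thesis
    unfolding bounded_periodic_def
    using n0 bij bij_periodic_swap[OF n0 pq] periodic_swap_shift[OF n0 pq] per
    by (auto simp: bij_comp)
qed

text \<open>An exchange \<open>p < q\<close>, \<open>f p < f q\<close> moves the lower left and upper right corners of a rectangle to the
other two corners.  It adds a point exactly to the quadrants whose corner lies in one of the
translates of this rectangle.\<close>

lemma card_dots_swap:
  assumes bp: "bounded_periodic n f" and pq: "p < q" "q < p + int n" and fpq: "f p < f q"
  shows "card (dots (f \<circ> periodic_swap n p q) a b) = card (dots f a b) +
    (if \<exists>m. p + m * int n < a \<and> a \<le> q + m * int n \<and> f p + m * int n \<le> b \<and> b < f q + m * int n
     then 1 else 0)"
proof -
  have n0: "0 < n" using bp unfolding bounded_periodic_def by auto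
  note sh = bounded_periodic_shift[OF bp]
  let ?t = "periodic_swap n p q"
  let ?B = "{v. a \<le> ?t v \<and> f v \<le> b}"
  have "bij_betw ?t (dots (f \<circ> ?t) a b) ?B"
    by (rule bij_betw_byWitness[where f' = ?t])
       (auto simp: dots_def periodic_swap_invol[OF n0 pq])
  then have cB: "card (dots (f \<circ> ?t) a b) = card ?B" by (rule bij_betw_same_card)
  show ?thesis
  proof (cases "\<exists>m. p + m * int n < a \<and> a \<le> q + m * int n")
    case False
    have "a \<le> ?t v \<longleftrightarrow> a \<le> v" for v
    proof -
      consider (first) m where "v = p + m * int n" | (second) m where "v = q + m * int n"
        | (other) "\<And>m. v \<noteq> p + m * int n" "\<And>m. v \<noteq> q + m * int n"
        by blast
      then show ?thesis
      proof cases
      case (first m)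
      have "\<not> (p + m * int n < a \<and> a \<le> q + m * int n)" using False by blast
      moreover have "p + m * int n < q + m * int n" using pq by simp
      ultimately show ?thesis
        unfolding first periodic_swap_fst[OF n0 pq] by linarith
    next
      case (second m)
      have "\<not> (p + m * int n < a \<and> a \<le> q + m * int n)" using False by blast
      moreover have "p + m * int n < q + m * int n" using pq by simp
      ultimately show ?thesis
        unfolding second periodic_swap_snd[OF n0 pq] by linarith
    next
      case other
      then show ?thesis by (simp add: periodic_swap_other[OF n0 pq])
      qed
    qed
    then have "?B = dots f a b" unfolding dots_def by simp
    then show ?thesis using False cB by auto
  next
    case True
    then obtain m where m: "p + m * int n < a" "a \<le> q + m * int n" by blast
    \<comment> \<open>The translates of the interval from \<open>p\<close> to \<open>q\<close> are disjoint, as it is shorter than \<open>n\<close>.\<close>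
    have uniq: "m' = m" if "p + m' * int n < a" "a \<le> q + m' * int n" for m'
    proof -
      have "m' * int n < (m + 1) * int n" "m * int n < (m' + 1) * int n"
        using that m pq by (simp_all add: algebra_simps)
      then have "m' < m + 1" "m < m' + 1" using n0 by (simp_all only: mult_less_cancel_right_pos
          of_nat_0_less_iff)
      then show ?thesis by simp
    qed
    let ?P = "p + m * int n" and ?Q = "q + m * int n"
    have other: "a \<le> ?t v \<longleftrightarrow> a \<le> v" if "v \<noteq> ?P" "v \<noteq> ?Q" for v
    proof -
      consider (first) m where "v = p + m * int n" | (second) m where "v = q + m * int n"
        | (other) "\<And>m. v \<noteq> p + m * int n" "\<And>m. v \<noteq> q + m * int n"
        by blast
      then show ?thesis
      proof cases
      case (first m')
      then have "m' \<noteq> m" using that by blast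
      then have "\<not> (p + m' * int n < a \<and> a \<le> q + m' * int n)" using uniq by blast
      moreover have "p + m' * int n < q + m' * int n" using pq by simp
      ultimately show ?thesis
        unfolding first periodic_swap_fst[OF n0 pq] by linarith
    next
      case (second m')
      then have "m' \<noteq> m" using that by blast
      then have "\<not> (p + m' * int n < a \<and> a \<le> q + m' * int n)" using uniq by blast
      moreover have "p + m' * int n < q + m' * int n" using pq by simp
      ultimately show ?thesis
        unfolding second periodic_swap_snd[OF n0 pq] by linarith
    next
      case other
      then show ?thesis by (simp add: periodic_swap_other[OF n0 pq])
      qed
    qed
    have B: "?B = (dots f a b - {?Q}) \<union> (if f ?P \<le> b then {?P} else {})"
    proof (rule Set.set_eqI)
      fix v
      show "v \<in> ?B \<longleftrightarrow> v \<in> (dots f a b - {?Q}) \<union> (if f ?P \<le> b then {?P} else {})"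
      proof (cases "v = ?P \<or> v = ?Q")
        case False
        then show ?thesis using other[of v] unfolding dots_def by auto
      next
        case True
        have "?t ?P = ?Q" "?t ?Q = ?P"
          by (rule periodic_swap_fst[OF n0 pq], rule periodic_swap_snd[OF n0 pq])
        then show ?thesis using m True pq by (elim disjE) (simp_all add: dots_def)
      qed
    qed
    have fin: "finite (dots f a b)" by (rule finite_dots[OF bp])
    have nP: "?P \<notin> dots f a b" unfolding dots_def using m by simp
    have PQ: "f ?P < f ?Q" using fpq by (simp add: sh)
    have iQ: "?Q \<in> dots f a b \<longleftrightarrow> f ?Q \<le> b" unfolding dots_def using m by simp
    have ex: "(\<exists>m. p + m * int n < a \<and> a \<le> q + m * int n \<and> f p + m * int n \<le> b \<and> b < f q + m * int n)
      \<longleftrightarrow> f ?P \<le> b \<and> b < f ?Q"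
      unfolding sh using uniq m by blast
    have "card ?B = card (dots f a b) + (if f ?P \<le> b \<and> b < f ?Q then 1 else 0)"
    proof (cases "f ?Q \<le> b")
      case True
      then have "?Q \<in> dots f a b" using iQ by simp
      then have "card (insert ?P (dots f a b - {?Q})) = card (dots f a b)"
        using nP fin by (metis Diff_iff card_Suc_Diff1 card_insert_disjoint finite_Diff)
      then show ?thesis using True PQ B by auto
    next
      case False
      then have "dots f a b - {?Q} = dots f a b" using iQ by simp
      then show ?thesis using False PQ B nP fin by auto
    qed
    then show ?thesis using cB ex by simp
  qed
qed

text \<open>The window that starts at \<open>p\<close> meets no translate of the exchanged rectangle, so its count, and with
it \<open>k\<close>, is unchanged.\<close>

lemma affine_permutation_swap:
  assumes f: "bounded_affine_permutation k n f" and pq: "p < q" "q < p + int n"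
    and fpq: "f p < f q" "f q \<le> p + int n" "q \<le> f p"
  shows "bounded_affine_permutation k n (f \<circ> periodic_swap n p q)"
proof -
  have bp: "bounded_periodic n f" and w: "int (card (dots f p (p + int n - 1))) = int n - int k"
    using f affine_permutation_iff_window_count by blast+
  have n0: "0 < n" using bp unfolding bounded_periodic_def by auto
  have "\<not> (p + m * int n < p \<and> p \<le> q + m * int n)" for m
  proof
    assume A: "p + m * int n < p \<and> p \<le> q + m * int n"
    then have "m * int n < 0" by simp
    then have "m \<le> -1" using n0 by (simp add: mult_less_0_iff)
    then have "m * int n \<le> -1 * int n" by (rule mult_right_mono) simp
    then show False using A pq by simp
  qed
  then have "card (dots (f \<circ> periodic_swap n p q) p (p + int n - 1))
      = card (dots f p (p + int n - 1))"
    using card_dots_swap[OF bp pq fpq(1), of p "p + int n - 1"] by auto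
  then show ?thesis
    using affine_permutation_iff_window_count[of k n _ p] bounded_periodic_swap[OF bp pq fpq] w by
        simp
qed

text \<open>The exchange that lowers \<open>f i\<close>.  The preimage of \<open>i\<close> is a candidate for \<open>x\<close>; taking \<open>x\<close> largest
leaves no point of the graph in the rectangle between the exchanged points, which is what makes the
new rank conditions consequences of the old ones.  The new function is bounded only if
\<open>f i \<le> x + n\<close>.  If this failed, \<open>f\<close> modulo \<open>n\<close> would permute the integers strictly between \<open>x\<close> and
\<open>i\<close>; one of these is \<open>f i - n\<close>, but neither \<open>i\<close> nor \<open>i - n\<close> is among them.\<close>

lemma deletion_swap_exists:
  assumes bp: "bounded_periodic n f" and i: "f i \<noteq> i" "f i \<noteq> i + int n"
  obtains x where "x < i" "i < x + int n" "i \<le> f x" "f x < f i" "f i \<le> x + int n"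
    "\<And>u. x < u \<Longrightarrow> u < i \<Longrightarrow> i \<le> f u \<Longrightarrow> f i \<le> f u"
proof -
  have n0: "0 < n" and bij: "bij f" and bd: "\<And>u. u \<le> f u" "\<And>u. f u \<le> u + int n"
      and per: "\<And>u. f (u + int n) = f u + int n"
    using bp unfolding bounded_periodic_def by auto
  have inj: "f u = f v \<Longrightarrow> u = v" for u v using bij by (metis bij_is_inj injD)
  define H where "H = {u. i - int n < u \<and> u < i \<and> i \<le> f u \<and> f u < f i}"
  define h where "h = inv_into UNIV f i"
  have fh: "f h = i" unfolding h_def using bij by (simp add: bij_is_surj surj_f_inv_f)
  have "h \<noteq> i" using fh i by auto
  moreover have "i - int n \<noteq> h" using fh per[of h] i by (metis diff_add_cancel)
  ultimately have "h \<in> H" unfolding H_def using bd[of h] fh bd(1)[of i] i by auto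
  have finH: "finite H" by (rule finite_subset[of _ "{i - int n..i}"]) (auto simp: H_def)
  define x where "x = Max H"
  have xH: "x \<in> H" unfolding x_def using finH \<open>h \<in> H\<close> Max_in by blast
  have xmax: "u \<le> x" if "u \<in> H" for u unfolding x_def using finH that by simp
  have gap: "f i \<le> f u" if "x < u" "u < i" "i \<le> f u" for u
    using xmax[of u] that xH unfolding H_def by force
  have "f i \<le> x + int n"
  proof (rule ccontr)
    assume c: "\<not> f i \<le> x + int n"
    \<comment> \<open>\<open>phi\<close> is \<open>f\<close> modulo \<open>n\<close>, with representatives next to \<open>i\<close>.\<close>
    define phi where "phi u = (if f u < i then f u else f u - int n)" for u
    let ?J = "{x<..<i}"
    have "phi ` ?J \<subseteq> ?J"
    proof
      fix y assume "y \<in> phi ` ?J"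
      then obtain u where u: "x < u" "u < i" "y = phi u" by auto
      show "y \<in> ?J"
      proof (cases "f u < i")
        case True
        then show ?thesis using u bd(1)[of u] by (auto simp: phi_def)
      next
        case False
        then show ?thesis using u gap[of u] c bd(2)[of u] by (auto simp: phi_def)
      qed
    qed
    moreover have "inj_on phi ?J"
    proof (rule inj_onI)
      fix u v assume uv: "u \<in> ?J" "v \<in> ?J" "phi u = phi v"
      have D: "u = v \<or> u = v + int n \<or> v = u + int n"
      proof -
        have "f u = f v \<or> f u = f (v + int n) \<or> f v = f (u + int n)"
          using uv(3) unfolding per phi_def by (simp split: if_splits)
        then show ?thesis using inj by blast
      qed
      then show "u = v" using uv xH unfolding H_def by auto
    qed
    ultimately have "phi ` ?J = ?J" by (simp add: endo_inj_surj)
    moreover have "f i - int n \<in> ?J" using c i bd(2)[of i] by auto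
    ultimately obtain u where u: "u \<in> ?J" "phi u = f i - int n" by (metis imageE)
    have "u = i - int n \<or> u = i"
    proof -
      have "f (u + int n) = f i \<or> f u = f i"
        using u(2) unfolding per phi_def by (simp split: if_splits)
      then show ?thesis using inj[of "u + int n" i] inj[of u i] by auto
    qed
    then show False using u(1) xH unfolding H_def by auto
  qed
  then show ?thesis using that[of x] xH gap unfolding H_def by auto
qed

text \<open>Reversing the order of the columns and dualizing: the function \<open>u \<mapsto> n - f (- u)\<close> interchanges loops
(fixed points) and coloops (\<open>f u = u + n\<close>), hence deletion and contraction.\<close>

lemma bounded_periodic_reflect:
  assumes "bounded_periodic n f"
  shows "bounded_periodic n (\<lambda>u. int n - f (- u))"
proof -
  have n0: "0 < n" and bij: "bij f" and bd: "\<And>u. u \<le> f u" "\<And>u. f u \<le> u + int n"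
    using assms unfolding bounded_periodic_def by auto
  have "bij ((\<lambda>u. int n - u) \<circ> f \<circ> uminus)"
    by (intro bij_comp bij bij_uminus bijI' exI[of _ "int n - y" for y]) auto
  moreover have "int n - f (- (u + int n)) = int n - f (- u) + int n" for u
    using bounded_periodic_shift[OF assms, of "- u" "- 1"] by simp
  moreover have "u \<le> int n - f (- u) \<and> int n - f (- u) \<le> u + int n" for u
    using bd[of "- u"] by simp
  ultimately show ?thesis unfolding bounded_periodic_def using n0 by (simp add: comp_def)
qed

text \<open>The dual of the exchange for a deletion.\<close>

lemma contraction_swap_exists:
  assumes bp: "bounded_periodic n f" and i: "f i \<noteq> i" "f i \<noteq> i + int n"
  obtains x where "i < x" "x < i + int n" "f i < f x" "f x \<le> i + int n" "x \<le> f i"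
    "\<And>u. i < u \<Longrightarrow> u < x \<Longrightarrow> f u \<le> i + int n \<Longrightarrow> f u \<le> f i"
proof -
  have "int n - f (- (- i)) \<noteq> - i" "int n - f (- (- i)) \<noteq> - i + int n" using i by simp_all
  from deletion_swap_exists[OF bounded_periodic_reflect[OF bp] this]
  obtain x where x: "x < - i" "- i < x + int n" "- i \<le> int n - f (- x)"
      "int n - f (- x) < int n - f (- (- i))"
      "int n - f (- (- i)) \<le> x + int n"
    and gap: "\<And>u. x < u \<Longrightarrow> u < - i \<Longrightarrow> - i \<le> int n - f (- u) \<Longrightarrow> int n - f (- (- i)) \<le> int n - f (- u)"
    by blast
  show ?thesis
  proof (rule that[of "- x"])
    show "f u \<le> f i" if "i < u" "u < - x" "f u \<le> i + int n" for u
      using gap[of "- u"] that by simp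
  qed (use x in simp_all)
qed

section \<open>Removing a column from a bounded affine permutation\<close>

text \<open>The increasing enumeration of the integers that are not congruent to \<open>i\<close> modulo \<open>n\<close>, normalized so
that it is the identity between \<open>i - n + 1\<close> and \<open>i - 1\<close>.\<close>

definition skip :: "nat \<Rightarrow> int \<Rightarrow> int \<Rightarrow> int" where
  "skip n i v = v + (v - i) div (int n - 1) + 1"

lemma dvd_diffE:
  assumes "(d::int) dvd u - i"
  obtains m where "u = i + m * d"
proof -
  obtain m where "u - i = d * m" using assms by (rule dvdE)
  then have "u = i + m * d" by (simp add: algebra_simps)
  then show ?thesis by (rule that)
qed

context
  fixes n :: nat and i :: int
  assumes n2: "2 \<le> n"
begin

lemma skip_strict_mono: "u < v \<Longrightarrow> skip n i u < skip n i v"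
  using zdiv_mono1[of "u - i" "v - i" "int n - 1"] n2 unfolding skip_def by simp

lemma skip_less_iff: "skip n i u < skip n i v \<longleftrightarrow> u < v"
  using skip_strict_mono[of u v] skip_strict_mono[of v u] by (cases u v rule: linorder_cases) auto

lemma skip_le_iff: "skip n i u \<le> skip n i v \<longleftrightarrow> u \<le> v"
  using skip_less_iff[of v u] by linarith

lemma inj_skip: "inj (skip n i)"
  by (rule injI) (metis skip_le_iff order_antisym order_refl)

lemma skip_decomp:
  obtains q s where "v = i + q * (int n - 1) + s" "0 \<le> s" "s < int n - 1"
      "skip n i v = i + q * int n + s + 1"
proof -
  let ?q = "(v - i) div (int n - 1)" and ?s = "(v - i) mod (int n - 1)"
  have v: "v = i + ?q * (int n - 1) + ?s"
    using div_mult_mod_eq[of "v - i" "int n - 1"] by linarith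
  have "0 \<le> ?s" "?s < int n - 1" using n2 by simp_all
  moreover have "skip n i v = i + ?q * int n + ?s + 1"
    unfolding skip_def using v by (simp add: algebra_simps)
  ultimately show ?thesis using that v by blast
qed

lemma skip_period: "skip n i (v + (int n - 1)) = skip n i v + int n"
proof -
  have "(v + (int n - 1) - i) div (int n - 1) = ((v - i) + (int n - 1)) div (int n - 1)"
    by (simp add: algebra_simps)
  also have "\<dots> = (v - i) div (int n - 1) + 1" using n2 by (intro div_add_self2) auto
  finally show ?thesis unfolding skip_def by simp
qed

lemma skip_start: "skip n i i = i + 1"
  unfolding skip_def by simp

lemma skip_end: "skip n i (i + int n - 2) = i + int n - 1"
  unfolding skip_def using n2 by simp

lemma skip_avoids: "\<not> int n dvd skip n i v - i"
proof -
  obtain q s where s: "0 \<le> s" "s < int n - 1" "skip n i v = i + q * int n + s + 1"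
    using skip_decomp by metis
  have "skip n i v - i = int n * q + (s + 1)" using s by simp
  moreover have "\<not> int n dvd s + 1" using s by (simp add: zdvd_not_zless)
  ultimately show ?thesis by (metis dvd_add_right_iff dvd_triv_left)
qed

lemma skip_surj:
  assumes "\<not> int n dvd u - i"
  obtains v where "skip n i v = u"
proof -
  let ?q = "(u - i) div int n" and ?r = "(u - i) mod int n"
  have u: "u - i = ?q * int n + ?r" by simp
  have "?r \<noteq> 0" using assms by (simp add: dvd_eq_mod_eq_0)
  moreover have "0 \<le> ?r" "?r < int n" using n2 by simp_all
  ultimately have r: "1 \<le> ?r" "?r < int n" by linarith+
  have "skip n i (i + ?q * (int n - 1) + (?r - 1)) = u"
  proof -
    have "(?q * (int n - 1) + (?r - 1)) div (int n - 1) = ?q"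
      by (rule int_div_pos_eq[of _ _ _ "?r - 1"]) (use r in \<open>simp_all add: mult.commute\<close>)
    then have "skip n i (i + ?q * (int n - 1) + (?r - 1))
        = i + ?q * (int n - 1) + (?r - 1) + ?q + 1"
      unfolding skip_def by simp
    also have "\<dots> = i + (?q * int n + ?r)" by (simp add: algebra_simps)
    also have "\<dots> = u" using u by linarith
    finally show ?thesis .
  qed
  then show ?thesis by (rule that)
qed

lemma range_skip: "u \<in> range (skip n i) \<longleftrightarrow> \<not> int n dvd u - i"
  using skip_avoids skip_surj by (metis rangeE rangeI)

lemma skip_interval:
  "{skip n i a..skip n i b} = skip n i ` {a..b} \<union> {u \<in> {skip n i a..skip n i b}. int n dvd u - i}"
proof
  show "{skip n i a..skip n i b} \<subseteq> skip n i
      ` {a..b} \<union> {u \<in> {skip n i a..skip n i b}. int n dvd u - i}"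
  proof
    fix u assume u: "u \<in> {skip n i a..skip n i b}"
    show "u \<in> skip n i ` {a..b} \<union> {u \<in> {skip n i a..skip n i b}. int n dvd u - i}"
    proof (cases "int n dvd u - i")
      case False
      then obtain v where "skip n i v = u" by (rule skip_surj)
      then show ?thesis using u by (auto simp: skip_le_iff)
    qed (use u in simp)
  qed
qed (auto simp: skip_le_iff)

text \<open>The left side is the size of an interval of columns before the removal, and the last term counts the
removed columns in it.\<close>

lemma skip_interval_card:
  assumes "a \<le> b"
  shows "skip n i b - skip n i a + 1 =
    (b - a + 1) + int (card {u \<in> {skip n i a..skip n i b}. int n dvd u - i})"
proof -
  have "card {skip n i a..skip n i b} =
      card (skip n i ` {a..b}) + card {u \<in> {skip n i a..skip n i b}. int n dvd u - i}"
  proof -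
    have "finite {u \<in> {skip n i a..skip n i b}. int n dvd u - i}"
      by (rule finite_subset[of _ "{skip n i a..skip n i b}"]) auto
    then show ?thesis
      by (subst skip_interval, intro card_Un_disjoint) (use skip_avoids in auto)
  qed
  moreover have "card (skip n i ` {a..b}) = card {a..b}"
    by (rule card_image) (rule inj_on_subset[OF inj_skip subset_UNIV])
  moreover have "skip n i a \<le> skip n i b" using assms by (simp add: skip_le_iff)
  ultimately show ?thesis using assms by simp
qed

text \<open>Meaningful if \<open>f\<close> preserves the residue class of \<open>i\<close>, that is, if \<open>i\<close> is a loop or a coloop.\<close>

definition remove_column :: "(int \<Rightarrow> int) \<Rightarrow> int \<Rightarrow> int" where
  "remove_column f v = inv_into UNIV (skip n i) (f (skip n i v))"

context
  fixes f
  assumes bp: "bounded_periodic n f" and fi: "int n dvd f i - i"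
begin

lemma dvd_iff_of_fixed: "int n dvd f u - i \<longleftrightarrow> int n dvd u - i"
proof -
  have bij: "bij f" using bp unfolding bounded_periodic_def by simp
  obtain c where c: "f i = i + c * int n" using fi by (rule dvd_diffE)
  have fw: "int n dvd f u - i" if "int n dvd u - i" for u
  proof -
    obtain m where m: "u = i + m * int n" using \<open>int n dvd u - i\<close> by (rule dvd_diffE)
    have "f u - i = (c + m) * int n"
      unfolding m bounded_periodic_shift[OF bp] c by (simp add: distrib_right)
    then show ?thesis by (metis dvd_triv_right)
  qed
  have bw: "int n dvd u - i" if "int n dvd f u - i" for u
  proof -
    obtain m where m: "f u = i + m * int n" using \<open>int n dvd f u - i\<close> by (rule dvd_diffE)
    have "f (i + (m - c) * int n) = f u"
      unfolding bounded_periodic_shift[OF bp] c m by (simp add: left_diff_distrib)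
    then have "i + (m - c) * int n = u" by (rule injD[OF bij_is_inj[OF bij]])
    then show ?thesis by (metis add_diff_cancel_left' dvd_triv_right)
  qed
  show ?thesis using fw bw by blast
qed

lemma skip_remove_column: "skip n i (remove_column f v) = f (skip n i v)"
  unfolding remove_column_def
proof (rule f_inv_into_f)
  show "f (skip n i v) \<in> range (skip n i)"
    unfolding range_skip dvd_iff_of_fixed by (rule skip_avoids)
qed

lemma bounded_periodic_remove_column: "bounded_periodic (n - 1) (remove_column f)"
proof -
  have n0: "0 < n" and bij: "bij f" and bd: "\<And>u. u \<le> f u" "\<And>u. f u \<le> u + int n"
      and per: "\<And>u. f (u + int n) = f u + int n"
    using bp unfolding bounded_periodic_def by auto
  have n1: "int (n - 1) = int n - 1" using n2 by simp
  let ?g = "remove_column f"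
  have "bij ?g"
  proof (rule bijI)
    show "inj ?g"
    proof (rule injI)
      fix u v assume "?g u = ?g v"
      then have "f (skip n i u) = f (skip n i v)" using skip_remove_column by metis
      then show "u = v" using bij inj_skip by (metis bij_is_inj injD)
    qed
    show "surj ?g"
    proof (rule surjI)
      fix v
      define u where "u = inv_into UNIV f (skip n i v)"
      have fu: "f u = skip n i v" unfolding u_def using bij by (simp add: bij_is_surj surj_f_inv_f)
      have "\<not> int n dvd u - i" using dvd_iff_of_fixed[of u] fu skip_avoids[of v] by simp
      then have "skip n i (inv_into UNIV (skip n i) u) = u"
        by (intro f_inv_into_f) (simp add: range_skip)
      then have "skip n i (?g (inv_into UNIV (skip n i) u))
          = skip n i v" using skip_remove_column fu by simp
      then show "?g (inv_into UNIV (skip n i) (inv_into UNIV f (skip n i v))) = v"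
        using inj_skip unfolding u_def by (metis injD)
    qed
  qed
  moreover have "?g (v + int (n - 1)) = ?g v + int (n - 1)" for v
  proof -
    have "skip n i (?g (v + int (n - 1))) = skip n i (?g v + int (n - 1))"
      by (simp only: skip_remove_column n1 skip_period per)
    then show ?thesis using inj_skip by (metis injD)
  qed
  moreover have "v \<le> ?g v \<and> ?g v \<le> v + int (n - 1)" for v
  proof -
    have "skip n i v \<le> skip n i (?g v)" "skip n i (?g v) \<le> skip n i (v + int (n - 1))"
      unfolding skip_remove_column n1 skip_period using bd by blast+
    then show ?thesis by (simp add: skip_le_iff)
  qed
  ultimately show ?thesis unfolding bounded_periodic_def using n2 by simp
qed

text \<open>The enumeration is monotone, so it identifies the points of the new graph with the points of the old
graph outside the removed residue class.\<close>

lemma card_dots_remove_column: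
  "card (dots f (skip n i a) (skip n i b)) = card (dots (remove_column f) a b) +
     card {u \<in> dots f (skip n i a) (skip n i b). int n dvd u - i}"
proof -
  let ?D = "dots f (skip n i a) (skip n i b)"
  have D: "?D = skip n i ` dots (remove_column f) a b \<union> {u \<in> ?D. int n dvd u - i}"
  proof
    show "?D \<subseteq> skip n i ` dots (remove_column f) a b \<union> {u \<in> ?D. int n dvd u - i}"
    proof
      fix u assume u: "u \<in> ?D"
      show "u \<in> skip n i ` dots (remove_column f) a b \<union> {u \<in> ?D. int n dvd u - i}"
      proof (cases "int n dvd u - i")
        case False
        then obtain v where v: "skip n i v = u" by (rule skip_surj)
        then have "v \<in> dots (remove_column f) a b"
          using u skip_remove_column[of v] skip_le_iff[of a v] skip_le_iff[of "remove_column f v" b]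
          unfolding dots_def by simp
        then show ?thesis using v by blast
      qed (use u in simp)
    qed
    show "skip n i ` dots (remove_column f) a b \<union> {u \<in> ?D. int n dvd u - i} \<subseteq> ?D"
    proof
      fix u assume "u \<in> skip n i ` dots (remove_column f) a b \<union> {u \<in> ?D. int n dvd u - i}"
      then consider v where "u = skip n i v" "v \<in> dots (remove_column f) a b" | "u \<in> ?D" by blast
      then show "u \<in> ?D"
      proof cases
        case (1 v)
        then show ?thesis using skip_remove_column[of v] skip_le_iff[of a v]
            skip_le_iff[of "remove_column f v" b] unfolding dots_def by simp
      qed
    qed
  qed
  have "finite ?D" by (rule finite_dots[OF bp])
  then have "finite (skip n i ` dots (remove_column f) a b)" "finite {u \<in> ?D. int n dvd u - i}"
    using D by (metis finite_Un)+
  then have "card ?D = card (skip n i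
      ` dots (remove_column f) a b) + card {u \<in> ?D. int n dvd u - i}"
    by (subst D, intro card_Un_disjoint) (use skip_avoids in auto)
  moreover have "card (skip n i ` dots (remove_column f) a b) = card (dots (remove_column f) a b)"
    by (rule card_image) (rule inj_on_subset[OF inj_skip subset_UNIV])
  ultimately show ?thesis by simp
qed

text \<open>The window from \<open>i + 1\<close> to \<open>i + n - 1\<close> avoids the removed residue class.\<close>

lemma window_remove_column:
  "card (dots (remove_column f) i (i + int (n - 1) - 1)) = card (dots f (i + 1) (i + int n - 1))"
proof -
  have bd: "\<And>u. u \<le> f u" using bp unfolding bounded_periodic_def by auto
  have "\<not> int n dvd u - i" if "u \<in> dots f (i + 1) (i + int n - 1)" for u
    using that bd[of u] unfolding dots_def by (simp add: zdvd_not_zless)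
  then have "{u \<in> dots f (i + 1) (i + int n - 1). int n dvd u - i} = {}" by blast
  moreover have "i + int (n - 1) - 1 = i + int n - 2" using n2 by simp
  ultimately show ?thesis using card_dots_remove_column[of i "i + int n - 2"]
    by (simp only: skip_start skip_end card.empty add_0_right)
qed

end

lemma affine_permutation_remove_loop:
  assumes f: "bounded_affine_permutation k n f" and fi: "f i = i"
  shows "bounded_affine_permutation k (n - 1) (remove_column f)"
proof -
  have bp: "bounded_periodic n f" and w: "int (card (dots f i (i + int n - 1))) = int n - int k"
    using f affine_permutation_iff_window_count by blast+
  have "dots f i (i + int n - 1) = insert i (dots f (i + 1) (i + int n - 1))"
    using fi n2 unfolding dots_def by auto
  moreover have "i \<notin> dots f (i + 1) (i + int n - 1)" unfolding dots_def by simp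
  ultimately have "card (dots f i (i + int n - 1)) = Suc (card (dots f (i + 1) (i + int n - 1)))"
    using finite_dots[OF bp] by simp
  then show ?thesis
    using w n2 affine_permutation_iff_window_count[of k "n - 1" "remove_column f" i]
      bounded_periodic_remove_column[OF bp] window_remove_column[OF bp] fi by simp
qed

text \<open>The point of the graph at a coloop \<open>i\<close> is outside the window from \<open>i\<close> to \<open>i + n - 1\<close>: the count stays
\<open>n - k\<close> while \<open>n\<close> drops by one, so \<open>k\<close> drops as well.\<close>

lemma affine_permutation_remove_coloop:
  assumes f: "bounded_affine_permutation k n f" and fi: "f i = i + int n"
  shows "bounded_affine_permutation (k - 1) (n - 1) (remove_column f)" and "0 < k"
proof -
  have bp: "bounded_periodic n f" and w: "int (card (dots f i (i + int n - 1))) = int n - int k"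
    using f affine_permutation_iff_window_count by blast+
  have bd: "\<And>u. u \<le> f u" using bp unfolding bounded_periodic_def by auto
  have D: "dots f i (i + int n - 1) = dots f (i + 1) (i + int n - 1)"
  proof (rule Set.set_eqI)
    fix u
    show "u \<in> dots f i (i + int n - 1) \<longleftrightarrow> u \<in> dots f (i + 1) (i + int n - 1)"
      using fi unfolding dots_def by (cases "u = i") auto
  qed
  have "dots f (i + 1) (i + int n - 1) \<subseteq> {i + 1..i + int n - 1}"
  proof
    fix u assume "u \<in> dots f (i + 1) (i + int n - 1)"
    then show "u \<in> {i + 1..i + int n - 1}" using bd[of u] unfolding dots_def by simp
  qed
  then have "card (dots f (i + 1) (i + int n - 1)) \<le> card {i + 1..i + int n - 1}"
    by (intro card_mono) auto
  then show k: "0 < k" using w D n2 by simp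
  show "bounded_affine_permutation (k - 1) (n - 1) (remove_column f)"
    using w n2 k D affine_permutation_iff_window_count[of "k - 1" "n - 1" "remove_column f" i]
      bounded_periodic_remove_column[OF bp] window_remove_column[OF bp] fi by simp
qed

end

section \<open>Finitely spanned spaces of functions and ranks of coordinate sets\<close>

text \<open>Row vectors are functions on all natural numbers that vanish from \<open>n\<close> on.  So spaces with different
numbers of columns live in one vector space, which is not finite-dimensional; this is why the
dimension facts below carry the hypothesis \<open>finitely_spanned\<close>.\<close>

definition fscale :: "complex \<Rightarrow> (nat \<Rightarrow> complex) \<Rightarrow> nat \<Rightarrow> complex" where
  "fscale c x = (\<lambda>i. c * x i)"

lemma fscale_eq_0: "x i = 0 \<Longrightarrow> fscale c x i = 0"
  by (simp add: fscale_def)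

interpretation cfun: vector_space fscale
  by unfold_locales (auto simp: fscale_def fun_eq_iff algebra_simps)

definition linear_functional :: "((nat \<Rightarrow> complex) \<Rightarrow> complex) \<Rightarrow> bool" where
  "linear_functional \<phi> \<longleftrightarrow> (\<forall>x y. \<phi> (x + y) = \<phi> x + \<phi> y) \<and> (\<forall>c x. \<phi> (fscale c x) = c * \<phi> x)"

definition finitely_spanned :: "(nat \<Rightarrow> complex) set \<Rightarrow> bool" where
  "finitely_spanned W \<longleftrightarrow> (\<exists>B. finite B \<and> W \<subseteq> cfun.span B)"

lemma finitely_spanned_mono: "finitely_spanned V \<Longrightarrow> W \<subseteq> V \<Longrightarrow> finitely_spanned W"
  unfolding finitely_spanned_def by blast

lemma finite_basis:
  assumes "finitely_spanned W"
  obtains B where "finite B" "B \<subseteq> W" "cfun.independent B" "W \<subseteq> cfun.span B" "card B = cfun.dim W"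
proof -
  obtain C where C: "finite C" "W \<subseteq> cfun.span C" using assms unfolding finitely_spanned_def by blast
  obtain B where B: "B \<subseteq> W" "cfun.independent B" "W \<subseteq> cfun.span B" "card B = cfun.dim W"
    using cfun.basis_exists by blast
  have "finite B" using cfun.independent_span_bound[OF C(1) B(2)] B(1) C(2) by blast
  then show ?thesis using that B by blast
qed

lemma dim_mono_finitely_spanned:
  assumes "finitely_spanned V" "W \<subseteq> V"
  shows "cfun.dim W \<le> cfun.dim V"
proof -
  obtain B where B: "finite B" "V \<subseteq> cfun.span B" "card B = cfun.dim V"
    using finite_basis[OF assms(1)] by metis
  then show ?thesis using cfun.dim_le_card[of W B] assms(2) by auto
qed

lemma dim_insert_finitely_spanned:
  assumes "finitely_spanned V"
  shows "cfun.dim (insert x V) = cfun.dim V + (if x \<in> cfun.span V then 0 else 1)"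
proof (cases "x \<in> cfun.span V")
  case True
  then show ?thesis using cfun.span_redundant[OF True] cfun.dim_span by (metis add_0_right)
next
  case False
  obtain B where B: "finite B" "B \<subseteq> V" "cfun.independent B" "V \<subseteq> cfun.span B" "card B = cfun.dim V"
    using finite_basis[OF assms(1)] by metis
  have "cfun.span B = cfun.span V"
    using B by (metis cfun.span_mono cfun.span_span subset_antisym)
  then have xB: "x \<notin> cfun.span B" using False by simp
  have "cfun.dim (insert x V) = Suc (card B)"
  proof (rule cfun.dim_unique)
    show "insert x B \<subseteq> insert x V" using B by blast
    show "insert x V \<subseteq> cfun.span (insert x B)"
      using B(4) cfun.span_mono[of B "insert x B"] cfun.span_superset by blast
    show "cfun.independent (insert x B)" using B(3) xB by (rule cfun.independent_insertI[rotated])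
    show "card (insert x B) = Suc (card B)" using B(1) xB cfun.span_superset by (subst
        card_insert_disjoint) auto
  qed
  then show ?thesis using False B by simp
qed

text \<open>Most dimension counts below repeat this one: imposing one linear equation lowers the
dimension by one, or by zero if the equation holds already.\<close>

lemma dim_kernel_functional:
  assumes W: "cfun.subspace W" "finitely_spanned W" and \<phi>: "linear_functional \<phi>"
  shows "cfun.dim W = cfun.dim {x \<in> W. \<phi> x = 0} + (if \<exists>x\<in>W. \<phi> x \<noteq> 0 then 1 else 0)"
proof (cases "\<exists>x\<in>W. \<phi> x \<noteq> 0")
  case False
  then have "{x \<in> W. \<phi> x = 0} = W" by blast
  then show ?thesis using False by simp
next
  case True
  then obtain w where w: "w \<in> W" "\<phi> w \<noteq> 0" by blast
  let ?K = "{x \<in> W. \<phi> x = 0}"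
  have add: "\<phi> (x + y) = \<phi> x + \<phi> y" and scale: "\<phi> (fscale c x) = c * \<phi> x" for x y c
    using \<phi> unfolding linear_functional_def by auto
  have K: "cfun.subspace ?K"
  proof (rule cfun.subspaceI)
    have "\<phi> 0 = 0" using scale[of 0 0] by (simp add: cfun.scale_zero_right)
    then show "0 \<in> ?K" using cfun.subspace_0[OF W(1)] by simp
  qed (use W(1) in \<open>auto simp: add scale cfun.subspace_add cfun.subspace_scale\<close>)
  have fK: "finitely_spanned ?K" by (rule finitely_spanned_mono[OF W(2)]) auto
  have "w \<notin> cfun.span ?K" using w K by (simp add: cfun.span_eq_iff[THEN iffD2])
  then have "cfun.dim (insert w ?K)
      = cfun.dim ?K + 1" using dim_insert_finitely_spanned[OF fK] by simp
  moreover have "cfun.span (insert w ?K) = W"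
  proof
    show "cfun.span (insert w ?K) \<subseteq> W"
      using W(1) w by (intro cfun.span_minimal) auto
    show "W \<subseteq> cfun.span (insert w ?K)"
    proof
      fix x assume x: "x \<in> W"
      let ?c = "\<phi> x / \<phi> w"
      have eq: "\<phi> (x - fscale ?c w) + \<phi> (fscale ?c w) = \<phi> x"
        by (simp add: add[symmetric])
      have "x - fscale ?c w \<in> ?K"
        using x w W(1) eq by (auto simp: scale intro: cfun.subspace_diff cfun.subspace_scale)
      then have "x - fscale ?c w \<in> cfun.span (insert w ?K)" by (intro cfun.span_base) blast
      moreover have "fscale ?c w \<in> cfun.span (insert w ?K)"
        by (intro cfun.span_scale cfun.span_base) blast
      ultimately have "(x - fscale ?c w) + fscale ?c w \<in> cfun.span (insert w ?K)"
        by (rule cfun.span_add)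
      then show "x \<in> cfun.span (insert w ?K)" by simp
    qed
  qed
  ultimately show ?thesis using True cfun.dim_span[of "insert w ?K"] by simp
qed

lemma linear_functional_coord: "linear_functional (\<lambda>x. x t)"
  unfolding linear_functional_def by (simp add: fscale_def)

lemma linear_functional_dot: "linear_functional (\<lambda>x. \<Sum>j<k. x j * c j)"
  unfolding linear_functional_def
  by (simp add: fscale_def sum.distrib sum_distrib_left algebra_simps)

definition coord_space :: "nat \<Rightarrow> (nat \<Rightarrow> complex) set" where
  "coord_space n = {x. \<forall>j\<ge>n. x j = 0}"

definition unit_fun :: "nat \<Rightarrow> nat \<Rightarrow> complex" where
  "unit_fun i = (\<lambda>j. if j = i then 1 else 0)"

lemma sum_fun_apply: "(\<Sum>a\<in>A. F a) t = (\<Sum>a\<in>A. (F a t :: complex))" for F :: "'a \<Rightarrow> nat \<Rightarrow> complex"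
  by (induction A rule: infinite_finite_induct) auto

lemma coord_space_expansion:
  assumes "x \<in> coord_space n"
  shows "x = (\<Sum>i<n. fscale (x i) (unit_fun i))"
proof (rule ext)
  fix t
  have "(\<Sum>i<n. fscale (x i) (unit_fun i)) t = (\<Sum>i<n. if i = t then x i else 0)"
    unfolding sum_fun_apply by (rule sum.cong) (auto simp: fscale_def unit_fun_def)
  also have "\<dots> = x t" using assms by (auto simp: coord_space_def)
  finally show "x t = (\<Sum>i<n. fscale (x i) (unit_fun i)) t" by simp
qed

lemma finitely_spanned_coord_space: "finitely_spanned (coord_space n)"
  unfolding finitely_spanned_def
proof (intro exI conjI subsetI)
  show "finite (unit_fun ` {..<n})" by simp
  fix x assume "x \<in> coord_space n"
  then have "x = (\<Sum>i<n. fscale (x i) (unit_fun i))" by (rule coord_space_expansion)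
  also have "\<dots> \<in> cfun.span (unit_fun ` {..<n})"
    by (intro cfun.span_sum cfun.span_scale cfun.span_base) auto
  finally show "x \<in> cfun.span (unit_fun ` {..<n})" .
qed

lemma subspace_coord_space: "cfun.subspace (coord_space n)"
  by (rule cfun.subspaceI) (auto simp: coord_space_def fscale_def)

lemma dim_zero_space: "cfun.dim {0} = 0"
  by (metis cfun.span_empty cfun.dim_span cfun.dim_eq_card_independent cfun.independent_empty
      card.empty)

lemma dim_coord_space: "cfun.dim (coord_space n) = n"
proof (induction n)
  case 0
  have "coord_space 0 = {0}" by (auto simp: coord_space_def)
  then show ?case using dim_zero_space by simp
next
  case (Suc n)
  have "{x \<in> coord_space (Suc n). x n = 0} = coord_space n"
    by (auto simp: coord_space_def Suc_le_eq) (metis le_neq_implies_less)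
  moreover have "unit_fun n \<in> coord_space (Suc n)" "unit_fun n n \<noteq> 0"
    by (auto simp: coord_space_def unit_fun_def)
  ultimately show ?case
    using dim_kernel_functional[OF subspace_coord_space finitely_spanned_coord_space
        linear_functional_coord, of "Suc n" n] Suc by auto
qed

definition coord_subspace :: "nat \<Rightarrow> (nat \<Rightarrow> complex) set \<Rightarrow> bool" where
  "coord_subspace n W \<longleftrightarrow> cfun.subspace W \<and> W \<subseteq> coord_space n"

lemma coord_subspace_finitely_spanned: "coord_subspace n W \<Longrightarrow> finitely_spanned W"
  using finitely_spanned_mono finitely_spanned_coord_space unfolding coord_subspace_def by blast

definition zeros_on :: "(nat \<Rightarrow> complex) set \<Rightarrow> nat set \<Rightarrow> (nat \<Rightarrow> complex) set" where
  "zeros_on W S = {x \<in> W. \<forall>i\<in>S. x i = 0}"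

lemma coord_subspace_zeros_on:
  assumes "coord_subspace n W" shows "coord_subspace n (zeros_on W S)"
  using assms unfolding coord_subspace_def zeros_on_def
  by (auto intro!: cfun.subspaceI simp: cfun.subspace_0 cfun.subspace_add cfun.subspace_scale
      fscale_eq_0)

lemma dim_zeros_on_insert:
  assumes "coord_subspace n W"
  shows "cfun.dim (zeros_on W S) = cfun.dim (zeros_on W (insert t S)) +
    (if \<exists>x\<in>zeros_on W S. x t \<noteq> 0 then 1 else 0)"
proof -
  have Z: "coord_subspace n (zeros_on W S)" by (rule coord_subspace_zeros_on[OF assms])
  have "{x \<in> zeros_on W S. x t = 0} = zeros_on W (insert t S)"
    unfolding zeros_on_def by auto
  then show ?thesis
    using dim_kernel_functional[OF _ coord_subspace_finitely_spanned[OF Z]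
        linear_functional_coord, of t] Z
    unfolding coord_subspace_def by simp
qed

lemma zeros_on_antimono: "S \<subseteq> T \<Longrightarrow> zeros_on W T \<subseteq> zeros_on W S"
  unfolding zeros_on_def by blast

lemma dim_zeros_on_antimono:
  assumes "coord_subspace n W" "S \<subseteq> T"
  shows "cfun.dim (zeros_on W T) \<le> cfun.dim (zeros_on W S)"
  by (rule dim_mono_finitely_spanned[OF coord_subspace_finitely_spanned zeros_on_antimono])
     (use assms coord_subspace_zeros_on in blast)+

text \<open>If \<open>W\<close> is the row space of a matrix, this is the rank of the set \<open>S\<close> of its columns
(\<open>column_rank_row_space_fun\<close>).  It depends on the row space only.\<close>

definition column_rank :: "(nat \<Rightarrow> complex) set \<Rightarrow> nat set \<Rightarrow> nat" where
  "column_rank W S = cfun.dim W - cfun.dim (zeros_on W S)"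

lemma zeros_on_empty [simp]: "zeros_on W {} = W" unfolding zeros_on_def by simp

lemma column_rank_plus_dim:
  assumes "coord_subspace n W"
  shows "column_rank W S + cfun.dim (zeros_on W S) = cfun.dim W"
  using dim_zeros_on_antimono[OF assms, of "{}" S] unfolding column_rank_def by simp

lemma column_rank_empty [simp]: "column_rank W {} = 0" unfolding column_rank_def by simp

lemma column_rank_insert:
  assumes "coord_subspace n W"
  shows "column_rank W (insert t S) = column_rank W S + (if \<exists>x\<in>zeros_on W S. x t \<noteq> 0 then 1 else 0)"
  using column_rank_plus_dim[OF assms, of S] column_rank_plus_dim[OF assms, of "insert t S"]
    dim_zeros_on_insert[OF assms, of S t] by simp

lemma column_rank_mono:
  assumes "coord_subspace n W" "S \<subseteq> T"
  shows "column_rank W S \<le> column_rank W T"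
  using column_rank_plus_dim[OF assms(1), of S] column_rank_plus_dim[OF assms(1), of T]
    dim_zeros_on_antimono[OF assms] by simp

lemma column_rank_le_dim: "column_rank W S \<le> cfun.dim W"
  unfolding column_rank_def by simp

text \<open>A column that increases the rank of a large set increases the rank of each of its subsets, since fewer
functions vanish on the larger set.\<close>

lemma column_rank_diminishing:
  assumes W: "coord_subspace n W" and AB: "A \<subseteq> B" and fin: "finite D"
  shows "column_rank W (B \<union> D) + column_rank W A \<le> column_rank W B + column_rank W (A \<union> D)"
  using fin
proof induction
  case (insert t D)
  have "zeros_on W (B \<union> D) \<subseteq> zeros_on W (A \<union> D)" using AB by (intro zeros_on_antimono) auto
  then show ?case
    using insert.IH column_rank_insert[OF W, of t "B \<union> D"] column_rank_insert[OF W, of t "A \<union> D"]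
    by (auto split: if_splits)
qed simp

lemma column_rank_submodular:
  assumes "coord_subspace n W" "finite T"
  shows "column_rank W (S \<union> T) + column_rank W (S \<inter> T) \<le> column_rank W S + column_rank W T"
proof -
  have "S \<inter> T \<union> T = T" by blast
  then show ?thesis
    using column_rank_diminishing[OF assms(1) _ assms(2), of "S \<inter> T" S] by simp
qed

lemma column_rank_Un_le:
  assumes "coord_subspace n W" "finite T"
  shows "column_rank W (S \<union> T) \<le> column_rank W S + column_rank W T"
  using column_rank_submodular[OF assms, of S] by simp

lemma zeros_on_all:
  assumes "coord_subspace n W"
  shows "zeros_on W {..<n} = {0}"
proof
  show "zeros_on W {..<n} \<subseteq> {0}"
  proof
    fix x assume x: "x \<in> zeros_on W {..<n}"
    have "x i = 0" for i
      using x assms unfolding zeros_on_def coord_subspace_def coord_space_def by (cases "i < n")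
          auto
    then show "x \<in> {0}" by (simp add: fun_eq_iff)
  qed
  show "{0} \<subseteq> zeros_on W {..<n}"
    using assms cfun.subspace_0 unfolding zeros_on_def coord_subspace_def by simp
qed

lemma column_rank_all: "coord_subspace n W \<Longrightarrow> column_rank W {..<n} = cfun.dim W"
  unfolding column_rank_def by (simp add: zeros_on_all dim_zero_space)

lemma dim_image_inj_on:
  assumes lin: "\<And>x y. F (x + y) = F x + F y" "\<And>c x. F (fscale c x) = fscale c (F x)"
    and W: "cfun.subspace W" "finitely_spanned W" and inj: "inj_on F W"
  shows "cfun.dim (F ` W) = cfun.dim W"
proof -
  have F: "Modules.module_hom fscale fscale F"
    unfolding Modules.module_hom_def Modules.module_hom_axioms_def using cfun.module_axioms lin by
        blast
  obtain B where B: "finite B" "B \<subseteq> W" "cfun.independent B" "W \<subseteq> cfun.span B" "card B = cfun.dim W"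
    using finite_basis[OF W(2)] by metis
  have sp: "cfun.span B = W" using B W(1) by (metis cfun.span_minimal subset_antisym)
  show ?thesis
  proof (rule cfun.dim_unique)
    show "F ` B \<subseteq> F ` W" using B by blast
    show "F ` W \<subseteq> cfun.span (F ` B)" using Modules.module_hom.span_image[OF F, of B] sp by simp
    show "cfun.independent (F ` B)"
      by (rule Modules.module_hom.independent_injective_image[OF F]) (use B inj sp in auto)
    show "card (F ` B) = cfun.dim W"
      using B inj by (metis card_image inj_on_subset)
  qed
qed

text \<open>The linear relations between the rows of a matrix with set of columns \<open>C\<close>.\<close>

definition left_kernel :: "nat \<Rightarrow> (nat \<Rightarrow> complex) set \<Rightarrow> (nat \<Rightarrow> complex) set" where
  "left_kernel k C = {y \<in> coord_space k. \<forall>c\<in>C. (\<Sum>j<k. y j * c j) = 0}"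

lemma coord_subspace_left_kernel: "coord_subspace k (left_kernel k C)"
proof -
  have "cfun.subspace (left_kernel k C)"
  proof (rule cfun.subspaceI)
    show "0 \<in> left_kernel k C"
      unfolding left_kernel_def using cfun.subspace_0[OF subspace_coord_space] by simp
  next
    fix x y assume "x \<in> left_kernel k C" "y \<in> left_kernel k C"
    moreover have "(\<Sum>j<k. (x + y) j * c j) = (\<Sum>j<k. x j * c j) + (\<Sum>j<k. y j * c j)" for c
      using linear_functional_dot[where k=k and c=c] unfolding linear_functional_def by blast
    ultimately show "x + y \<in> left_kernel k C"
      unfolding left_kernel_def using cfun.subspace_add[OF subspace_coord_space, of x k y] by simp
  next
    fix x r assume "x \<in> left_kernel k C"
    moreover have "(\<Sum>j<k. fscale r x j * c j) = r * (\<Sum>j<k. x j * c j)" for c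
      using linear_functional_dot[where k=k and c=c] unfolding linear_functional_def by blast
    ultimately show "fscale r x \<in> left_kernel k C"
      unfolding left_kernel_def using cfun.subspace_scale[OF subspace_coord_space, of x k r] by simp
  qed
  then show ?thesis unfolding coord_subspace_def left_kernel_def by blast
qed

lemma dim_left_kernel_insert:
  "cfun.dim (left_kernel k C) = cfun.dim (left_kernel k (insert c C)) +
    (if \<exists>y\<in>left_kernel k C. (\<Sum>j<k. y j * c j) \<noteq> 0 then 1 else 0)"
proof -
  have "{y \<in> left_kernel k C. (\<Sum>j<k. y j * c j) = 0} = left_kernel k (insert c C)"
    unfolding left_kernel_def by auto
  then show ?thesis
    using dim_kernel_functional[OF _ coord_subspace_finitely_spanned[OF coord_subspace_left_kernel]
        linear_functional_dot[of c k]] coord_subspace_left_kernel[of k C]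
    unfolding coord_subspace_def by simp
qed

lemma left_kernel_span: "x \<in> cfun.span C \<Longrightarrow> y \<in> left_kernel k C \<Longrightarrow> (\<Sum>j<k. y j * x j) = 0"
proof (induction rule: cfun.span_induct_alt)
  case base
  then show ?case by simp
next
  case (step c x z)
  then have "(\<Sum>j<k. y j * x j) = 0" unfolding left_kernel_def by blast
  then have "(\<Sum>j<k. c * (y j * x j)) = 0" by (simp add: sum_distrib_left[symmetric])
  then show ?case using step by (simp add: fscale_def algebra_simps sum.distrib)
qed

text \<open>A new column in the span of the old ones does not change the left kernel, and any other column raises
the rank by one and lowers the dimension of the left kernel by at most one.  So the sum can only
grow when columns are added.  It is \<open>k\<close> without columns, and again \<open>k\<close> when all unit vectors are
among the columns, hence constant.\<close>

lemma dim_left_kernel_plus_rank: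
  assumes C: "finite C" "C \<subseteq> coord_space k"
  shows "cfun.dim (left_kernel k C) + cfun.dim C = k"
proof -
  let ?g = "\<lambda>C. cfun.dim (left_kernel k C) + cfun.dim C"
  have step: "?g C \<le> ?g (insert c C)" if "C \<subseteq> coord_space k" for c C
  proof (cases "c \<in> cfun.span C")
    case True
    have "\<not> (\<exists>y\<in>left_kernel k C. (\<Sum>j<k. y j * c j) \<noteq> 0)" using left_kernel_span[OF True] by blast
    then show ?thesis
      using dim_left_kernel_insert[of k C c] True
        dim_insert_finitely_spanned[OF finitely_spanned_mono[OF finitely_spanned_coord_space that]]
      by simp
  next
    case False
    then show ?thesis
      using dim_left_kernel_insert[of k C c]
        dim_insert_finitely_spanned[OF finitely_spanned_mono[OF finitely_spanned_coord_space that]]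
      by auto
  qed
  have mono: "?g C \<le> ?g (C \<union> D)" if "finite D" "C \<union> D \<subseteq> coord_space k" for C D
    using that
  proof induction
    case (insert d D)
    then show ?case using step[of "C \<union> D" d] by (simp add: order_trans)
  qed simp
  let ?E = "unit_fun ` {..<k}"
  have E: "?E \<subseteq> coord_space k" by (auto simp: coord_space_def unit_fun_def)
  have spE: "coord_space k \<subseteq> cfun.span ?E"
  proof
    fix x assume "x \<in> coord_space k"
    then have "x = (\<Sum>i<k. fscale (x i) (unit_fun i))" by (rule coord_space_expansion)
    also have "\<dots> \<in> cfun.span ?E" by (intro cfun.span_sum cfun.span_scale cfun.span_base) auto
    finally show "x \<in> cfun.span ?E" .
  qed
  have "?g {} = k"
    by (simp add: left_kernel_def dim_coord_space)
       (metis cfun.dim_eq_card_independent cfun.independent_empty card.empty)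
  moreover have "?g {} \<le> ?g C" using mono[of C "{}"] C by simp
  moreover have "?g C \<le> ?g (C \<union> ?E)" using mono[of ?E C] C E by simp
  moreover have "left_kernel k (C \<union> ?E) = {0}"
  proof -
    have "y = 0" if y: "y \<in> left_kernel k (C \<union> ?E)" for y
    proof
      fix t
      show "y t = 0 t"
      proof (cases "t < k")
        case True
        then have "(\<Sum>j<k. y j * unit_fun t j) = 0" using y unfolding left_kernel_def by blast
        moreover have "(\<Sum>j<k. y j * unit_fun t j) = (\<Sum>j<k. if j = t then y j else 0)"
          by (rule sum.cong) (auto simp: unit_fun_def)
        ultimately show ?thesis using True by simp
      next
        case False
        then show ?thesis using y unfolding left_kernel_def coord_space_def by simp
      qed
    qed
    moreover have "0 \<in> left_kernel k (C \<union> ?E)"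
      using coord_subspace_left_kernel cfun.subspace_0 unfolding coord_subspace_def by blast
    ultimately show ?thesis by blast
  qed
  moreover have "cfun.dim (C \<union> ?E) \<le> k"
    using dim_mono_finitely_spanned[OF finitely_spanned_coord_space, of "C \<union> ?E" k] C E
    by (simp add: dim_coord_space)
  ultimately show ?thesis by (simp add: dim_zero_space)
qed

section \<open>Row spaces of matrices, positroid varieties and charts\<close>

text \<open>Transport from vectors of a fixed length to functions, continued by zero.\<close>

definition vec_fun :: "complex vec \<Rightarrow> nat \<Rightarrow> complex" where
  "vec_fun v = (\<lambda>i. if i < dim_vec v then v $ i else 0)"

lemma vec_fun_in_coord_space: "v \<in> carrier_vec k \<Longrightarrow> vec_fun v \<in> coord_space k"
  unfolding vec_fun_def coord_space_def by auto

lemma inj_on_vec_fun: "inj_on vec_fun (carrier_vec k)"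
proof (rule inj_onI)
  fix v w :: "complex vec"
  assume vw: "v \<in> carrier_vec k" "w \<in> carrier_vec k" "vec_fun v = vec_fun w"
  show "v = w"
  proof (rule eq_vecI)
    fix i assume "i < dim_vec w"
    then show "v $ i = w $ i" using fun_cong[OF vw(3), of i] vw(1,2) unfolding vec_fun_def by simp
  qed (use vw in simp)
qed

lemma lin_dep_iff_dependent_vec_fun:
  assumes B: "finite B" "B \<subseteq> carrier_vec k"
  shows "module.lin_dep class_ring (module_vec TYPE(complex) k) B \<longleftrightarrow> cfun.dependent (vec_fun ` B)"
proof -
  interpret V: vec_space "TYPE(complex)" k .
  have inj: "inj_on vec_fun B" using inj_on_vec_fun B(2) by (rule inj_on_subset)
  have comb: "(\<Sum>v\<in>B. fscale (a v) (vec_fun v)) t = (if t < k then V.lincomb a B $ t else 0)" for a t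
  proof (cases "t < k")
    case True
    then have "V.lincomb a B $ t = (\<Sum>v\<in>B. a v * v $ t)"
      using B V.lincomb_index by blast
    also have "\<dots> = (\<Sum>v\<in>B. fscale (a v) (vec_fun v) t)"
      using True B(2) by (intro sum.cong) (auto simp: fscale_def vec_fun_def)
    finally show ?thesis using True by (simp add: sum_fun_apply)
  next
    case False
    have "fscale (a v) (vec_fun v) t = 0" if "v \<in> B" for v
      using False B(2) that by (auto simp: fscale_def vec_fun_def)
    then show ?thesis using False by (simp add: sum_fun_apply)
  qed
  have zero: "(\<Sum>v\<in>B. fscale (a v) (vec_fun v)) = 0 \<longleftrightarrow> V.lincomb a B = 0\<^sub>v k" for a
  proof
    assume A: "(\<Sum>v\<in>B. fscale (a v) (vec_fun v)) = 0"
    show "V.lincomb a B = 0\<^sub>v k"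
    proof (rule eq_vecI)
      fix t assume "t < dim_vec (0\<^sub>v k :: complex vec)"
      then show "V.lincomb a B $ t = 0\<^sub>v k $ t" using comb[of a t] A by simp
    qed (use V.lincomb_closed[OF B(2), of a] in simp)
  next
    assume "V.lincomb a B = 0\<^sub>v k"
    then show "(\<Sum>v\<in>B. fscale (a v) (vec_fun v)) = 0" by (intro ext) (simp add: comb)
  qed
  show ?thesis
  proof
    assume "V.lin_dep B"
    then obtain a v where av: "V.lincomb a B = 0\<^sub>v k" "v \<in> B" "a v \<noteq> 0"
    proof -
      have "\<not> V.lin_indpt B" using \<open>V.lin_dep B\<close> by simp
      then show ?thesis
        using V.finite_lin_indpt2[OF B(1) B(2)] that by blast
    qed
    let ?u = "\<lambda>x. a (the_inv_into B vec_fun x)"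
    have "(\<Sum>x\<in>vec_fun ` B. fscale (?u x) x) = (\<Sum>v\<in>B. fscale (a v) (vec_fun v))"
      by (simp add: sum.reindex[OF inj] the_inv_into_f_f[OF inj] cong: sum.cong)
    also have "\<dots> = 0" using zero av(1) by simp
    finally have "(\<Sum>x\<in>vec_fun ` B. fscale (?u x) x) = 0" .
    moreover have "?u (vec_fun v) \<noteq> 0" using av the_inv_into_f_f[OF inj] by simp
    moreover have "vec_fun v \<in> vec_fun ` B" using av(2) by simp
    ultimately show "cfun.dependent (vec_fun ` B)"
      unfolding cfun.dependent_finite[OF finite_imageI[OF B(1)]]
      by (intro exI[of _ ?u] conjI bexI[of _ "vec_fun v"])
  next
    assume "cfun.dependent (vec_fun ` B)"
    then obtain u x where u: "(\<Sum>x\<in>vec_fun ` B. fscale (u x) x) = 0" "x \<in> vec_fun ` B" "u x \<noteq> 0"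
      unfolding cfun.dependent_finite[OF finite_imageI[OF B(1)]] by blast
    then obtain v where v: "v \<in> B" "u (vec_fun v) \<noteq> 0" by blast
    have "(\<Sum>v\<in>B. fscale (u (vec_fun v)) (vec_fun v)) = 0"
      using u(1) by (simp add: sum.reindex[OF inj])
    then have "V.lincomb (\<lambda>v. u (vec_fun v)) B = 0\<^sub>v k" using zero by simp
    then show "V.lin_dep B"
      unfolding V.lin_dep_def
      using B(1) v by (intro exI[of _ B] exI[of _ "\<lambda>v. u (vec_fun v)"] exI[of _ v]) simp
  qed
qed

lemma rank_eq_dim:
  assumes A: "A \<in> carrier_mat k m"
  shows "vec_space.rank k A = cfun.dim (vec_fun ` set (cols A))"
proof -
  interpret V: vec_space "TYPE(complex)" k .
  let ?C = "set (cols A)"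
  have C: "?C \<subseteq> carrier_vec k" using A cols_dim by blast
  \<comment> \<open>Both sides are the size of a maximal independent set of columns.\<close>
  obtain B where B: "finite B" "maximal B (\<lambda>T. T \<subseteq> ?C \<and> V.lin_indpt T)"
    using maximal_exists_superset[of ?C "\<lambda>T. T \<subseteq> ?C \<and> V.lin_indpt T" "{}"]
      V.lin_dep_def by (metis (no_types, lifting) List.finite_set empty_iff empty_subsetI
          subset_empty)
  have BC: "B \<subseteq> ?C" and Bi: "V.lin_indpt B" using B(2) unfolding maximal_def by auto
  have Bk: "B \<subseteq> carrier_vec k" using BC C by blast
  have ind: "cfun.independent (vec_fun ` B)"
    using lin_dep_iff_dependent_vec_fun[OF B(1) Bk] Bi by simp
  have sp: "vec_fun ` ?C \<subseteq> cfun.span (vec_fun ` B)"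
  proof
    fix x assume "x \<in> vec_fun ` ?C"
    then obtain c where c: "c \<in> ?C" "x = vec_fun c" by blast
    show "x \<in> cfun.span (vec_fun ` B)"
    proof (cases "c \<in> B")
      case True
      then show ?thesis using c cfun.span_base by blast
    next
      case False
      then have "\<not> V.lin_indpt (insert c B)"
        using B(2) c(1) BC unfolding maximal_def by blast
      then have "cfun.dependent (vec_fun ` insert c B)"
        using lin_dep_iff_dependent_vec_fun[of "insert c B" k] B(1) Bk c(1) C by auto
      then have "cfun.dependent (insert x (vec_fun ` B))" using c(2) by simp
      then show ?thesis using ind cfun.independent_insertI by blast
    qed
  qed
  have "cfun.dim (vec_fun ` ?C) = card (vec_fun ` B)"
    by (rule cfun.dim_unique[OF _ sp ind]) (use BC in auto)
  also have "\<dots> = card B" by (rule card_image) (rule inj_on_subset[OF inj_on_vec_fun Bk])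
  also have "\<dots> = V.rank A" using V.rank_card_indpt[OF A B(2)] by simp
  finally show ?thesis by simp
qed

definition row_combination :: "nat \<Rightarrow> complex mat \<Rightarrow> (nat \<Rightarrow> complex) \<Rightarrow> nat \<Rightarrow> complex" where
  "row_combination n M y = (\<lambda>i. if i < n then \<Sum>j<dim_row M. y j * M $$ (j, i) else 0)"

definition row_space_fun :: "nat \<Rightarrow> complex mat \<Rightarrow> (nat \<Rightarrow> complex) set" where
  "row_space_fun n M = row_combination n M ` coord_space (dim_row M)"

lemma row_combination_add: "row_combination n M (x + y)
    = row_combination n M x + row_combination n M y"
  by (rule ext) (simp add: row_combination_def sum.distrib algebra_simps)

lemma row_combination_scale: "row_combination n M (fscale c x) = fscale c (row_combination n M x)"
  by (rule ext) (simp add: row_combination_def fscale_def sum_distrib_left algebra_simps)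

lemma coord_subspace_row_space_fun: "coord_subspace n (row_space_fun n M)"
proof -
  have "cfun.subspace (row_space_fun n M)"
  proof (rule cfun.subspaceI)
    have "0 = row_combination n M 0" by (rule ext) (simp add: row_combination_def)
    then show "0 \<in> row_space_fun n M"
      unfolding row_space_fun_def using cfun.subspace_0[OF subspace_coord_space] by blast
  next
    fix x y assume "x \<in> row_space_fun n M" "y \<in> row_space_fun n M"
    then show "x + y \<in> row_space_fun n M"
      unfolding row_space_fun_def
      using cfun.subspace_add[OF subspace_coord_space] row_combination_add by (smt (verit)
          image_iff)
  next
    fix x c assume "x \<in> row_space_fun n M"
    then show "fscale c x \<in> row_space_fun n M"
      unfolding row_space_fun_def
      using cfun.subspace_scale[OF subspace_coord_space] row_combination_scale by (smt (verit)
          image_iff)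
  qed
  then show ?thesis
    unfolding coord_subspace_def row_space_fun_def row_combination_def coord_space_def by auto
qed

lemma row_span_eq:
  assumes M: "M \<in> carrier_mat k n"
  shows "row_span n M = vec n ` row_space_fun n M"
proof -
  interpret V: vec_space "TYPE(complex)" n .
  have mv: "(M\<^sup>T *\<^sub>v y) = vec n (row_combination n M (vec_fun y))" if "y \<in> carrier_vec k" for y
  proof (rule eq_vecI)
    fix i assume "i < dim_vec (vec n (row_combination n M (vec_fun y)))"
    then have i: "i < n" by simp
    have "(M\<^sup>T *\<^sub>v y) $ i = (\<Sum>j<k. M $$ (j, i) * y $ j)"
      using M that i by (simp add: scalar_prod_def atLeast0LessThan)
    also have "\<dots> = (\<Sum>j<k. vec_fun y j * M $$ (j, i))"
      using that by (intro sum.cong) (auto simp: vec_fun_def)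
    finally show "(M\<^sup>T *\<^sub>v y) $ i = vec n (row_combination n M (vec_fun y)) $ i"
      using i M by (simp add: row_combination_def)
  qed (use M in simp)
  have surj: "coord_space k = vec_fun ` carrier_vec k"
  proof
    show "coord_space k \<subseteq> vec_fun ` carrier_vec k"
    proof
      fix x assume "x \<in> coord_space k"
      then have "x = vec_fun (vec k x)" by (auto simp: vec_fun_def coord_space_def fun_eq_iff)
      then show "x \<in> vec_fun ` carrier_vec k" by (metis image_eqI vec_carrier)
    qed
  qed (use vec_fun_in_coord_space in blast)
  have "row_span n M = {w \<in> carrier_vec n. \<exists>y\<in>carrier_vec k. M\<^sup>T *\<^sub>v y = w}"
    unfolding row_span_def V.row_space_eq[OF M] using M by simp
  also have "\<dots> = (\<lambda>y. M\<^sup>T *\<^sub>v y) ` carrier_vec k" using M by auto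
  also have "\<dots> = (\<lambda>y. vec n (row_combination n M (vec_fun y))) ` carrier_vec k"
    using mv by (intro image_cong) auto
  also have "\<dots> = vec n ` row_space_fun n M"
    unfolding row_space_fun_def using M surj by (simp add: image_image)
  finally show ?thesis .
qed

text \<open>Coefficient vectors \<open>y\<close> whose combination of rows vanishes on \<open>S\<close> form the left kernel of the
columns in \<open>S\<close>.  Passing to the combination itself loses the left kernel of the whole matrix, for
every \<open>S\<close> the same amount, so differences of dimensions agree.\<close>

lemma column_rank_row_space_fun:
  assumes M: "M \<in> carrier_mat k n" and S: "S \<subseteq> {..<n}"
  shows "column_rank (row_space_fun n M) S = cfun.dim (vec_fun ` col M ` S)"
proof -
  let ?W = "row_space_fun n M" and ?\<psi> = "row_combination n M"
  let ?N = "\<lambda>S. left_kernel k (vec_fun ` col M ` S)"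
  have W: "coord_subspace n ?W" by (rule coord_subspace_row_space_fun)
  have dot: "(\<Sum>j<k. y j * vec_fun (col M t) j) = ?\<psi> y t" if "t < n" for y t
  proof -
    have "(\<Sum>j<k. y j * vec_fun (col M t) j) = (\<Sum>j<k. y j * M $$ (j, t))"
      using M that by (intro sum.cong) (auto simp: vec_fun_def)
    then show ?thesis using M that by (simp add: row_combination_def)
  qed
  have N: "y \<in> ?N S \<longleftrightarrow> y \<in> coord_space k \<and> (\<forall>t\<in>S. ?\<psi> y t = 0)" if "S \<subseteq> {..<n}" for y S
  proof -
    have "(\<Sum>j<k. y j * vec_fun (col M t) j) = ?\<psi> y t" if "t \<in> S" for t
      using dot[of t y] that \<open>S \<subseteq> {..<n}\<close> by blast
    then show ?thesis unfolding left_kernel_def by simp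
  qed
  have Z: "zeros_on ?W S = ?\<psi> ` ?N S" if "S \<subseteq> {..<n}" for S
    using N[OF that] M unfolding zeros_on_def row_space_fun_def by auto
  \<comment> \<open>Downward induction on \<open>S\<close>: adding a column to \<open>S\<close> lowers both dimensions at the same time.\<close>
  have ker: "cfun.dim (?N S) = cfun.dim (zeros_on ?W S) + cfun.dim (?N {..<n})" if "S \<subseteq> {..<n}"
      for S
    using that
  proof (induction "card ({..<n} - S)" arbitrary: S)
    case 0
    then have "S = {..<n}" by auto
    then show ?case using zeros_on_all[OF W] dim_zero_space by simp
  next
    case (Suc m)
    then obtain t where t: "t < n" "t \<notin> S"
      by (metis card.empty lessThan_iff DiffE equals0I nat.distinct(1))
    have "{..<n} - insert t S = ({..<n} - S) - {t}" by blast
    then have m: "m = card ({..<n} - insert t S)" using Suc(2) t by simp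
    have "insert t S \<subseteq> {..<n}" using Suc(3) t by simp
    with m
    have IH: "cfun.dim (?N (insert t S))
        = cfun.dim (zeros_on ?W (insert t S)) + cfun.dim (?N {..<n})"
      by (rule Suc(1))
    have "(\<exists>y\<in>?N S. (\<Sum>j<k. y j * vec_fun (col M t) j) \<noteq> 0) \<longleftrightarrow> (\<exists>x\<in>zeros_on ?W S. x t \<noteq> 0)"
      unfolding Z[OF Suc(3)] dot[OF t(1)] by blast
    then show ?case
      using IH dim_left_kernel_insert[of k "vec_fun ` col M ` S" "vec_fun (col M t)"]
        dim_zeros_on_insert[OF W, of S t] by simp
  qed
  have C: "vec_fun ` col M ` S \<subseteq> coord_space k"
    using M by (auto intro!: vec_fun_in_coord_space)
  have "finite (vec_fun ` col M ` S)" using S finite_subset by blast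
  from dim_left_kernel_plus_rank[OF this C]
  have "cfun.dim (?N S) + cfun.dim (vec_fun ` col M ` S) = k" .
  moreover have "cfun.dim (?N {}) = k" by (simp add: left_kernel_def dim_coord_space)
  ultimately show ?thesis
    using ker[OF S] ker[of "{}"] column_rank_plus_dim[OF W, of S] by simp
qed

definition cyclic_interval :: "nat \<Rightarrow> int \<Rightarrow> int \<Rightarrow> nat set" where
  "cyclic_interval n a b = (\<lambda>t. nat (t mod int n)) ` {a..b}"

text \<open>The positroid variety as a set of subspaces, with rank conditions that no longer mention a matrix.\<close>

definition positroid_subspaces :: "nat \<Rightarrow> nat \<Rightarrow> (int \<Rightarrow> int) \<Rightarrow> (nat \<Rightarrow> complex) set set" where
  "positroid_subspaces k n f = {W. coord_subspace n W \<and> cfun.dim W = k \<and>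
     (\<forall>a b. a \<le> b \<longrightarrow> b \<le> a + int n \<longrightarrow>
        int (column_rank W (cyclic_interval n a b)) \<le> b - a + 1 - int (card (dots f a b)))}"

lemma row_space_fun_rank:
  assumes M: "M \<in> carrier_mat k n"
  shows "vec_space.rank k M = cfun.dim (row_space_fun n M)"
proof -
  have "set (cols M) = col M ` {..<n}" using M unfolding cols_def by auto
  then show ?thesis
    using rank_eq_dim[OF M] column_rank_row_space_fun[OF M order_refl]
      column_rank_all[OF coord_subspace_row_space_fun, of n M] by simp
qed

text \<open>The rows of the matrix are a basis of \<open>W\<close>.\<close>

lemma row_space_fun_surj:
  assumes W: "coord_subspace n W" and k: "cfun.dim W = k"
  obtains M where "M \<in> carrier_mat k n" "row_space_fun n M = W"
proof -
  obtain B where B: "finite B" "B \<subseteq> W" "cfun.independent B" "W \<subseteq> cfun.span B" "card B = cfun.dim W"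
    using finite_basis[OF coord_subspace_finitely_spanned[OF W]] by metis
  have sp: "cfun.span B = W" using B W unfolding coord_subspace_def
    by (metis cfun.span_minimal subset_antisym)
  obtain h where h: "bij_betw h {..<k} B"
    using B k by (metis ex_bij_betw_nat_finite atLeast0LessThan)
  then have inj: "inj_on h {..<k}" and im: "h ` {..<k} = B" unfolding bij_betw_def by auto
  define M where "M = mat k n (\<lambda>(j, i). h j i)"
  have M: "M \<in> carrier_mat k n" unfolding M_def by simp
  have rc: "row_combination n M y = (\<Sum>j<k. fscale (y j) (h j))" for y
  proof
    fix t
    have "h j t = 0" if "j < k" "\<not> t < n" for j
      using that im B(2) W unfolding coord_subspace_def coord_space_def by force
    then show "row_combination n M y t = (\<Sum>j<k. fscale (y j) (h j)) t"
      unfolding row_combination_def M_def sum_fun_apply by (auto simp: fscale_def)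
  qed
  have "row_space_fun n M = W"
  proof
    show "row_space_fun n M \<subseteq> W"
    proof
      fix x assume "x \<in> row_space_fun n M"
      then obtain y where "x = (\<Sum>j<k. fscale (y j) (h j))" unfolding row_space_fun_def rc by blast
      also have "\<dots> \<in> cfun.span B"
        using im by (intro cfun.span_sum cfun.span_scale cfun.span_base) auto
      finally show "x \<in> W" using sp by simp
    qed
    show "W \<subseteq> row_space_fun n M"
    proof
      fix x assume "x \<in> W"
      then have "x \<in> range (\<lambda>u. \<Sum>v\<in>B. fscale (u v) v)"
        using cfun.span_finite[OF B(1)] sp by simp
      then obtain u where u: "x = (\<Sum>v\<in>B. fscale (u v) v)" by blast
      let ?y = "\<lambda>j. if j < k then u (h j) else 0"
      have "x = (\<Sum>j<k. fscale (u (h j)) (h j))"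
        unfolding u im[symmetric] by (simp add: sum.reindex[OF inj])
      also have "\<dots> = (\<Sum>j<k. fscale (?y j) (h j))" by (rule sum.cong) auto
      finally have "x = row_combination n M ?y" using rc by simp
      moreover have "?y \<in> coord_space (dim_row M)" using M unfolding coord_space_def by simp
      ultimately show "x \<in> row_space_fun n M" unfolding row_space_fun_def by blast
    qed
  qed
  then show ?thesis using that M by blast
qed

lemma positroid_variety_eq:
  assumes n0: "0 < n"
  shows "positroid_variety k n f = (\<lambda>W. vec n ` W) ` positroid_subspaces k n f"
proof -
  have per: "vec_space.rank k (periodic_columns k n M i j)
      = column_rank (row_space_fun n M) (cyclic_interval n i j)"
    if M: "M \<in> carrier_mat k n" for M i j
  proof -
    have P: "periodic_columns k n M i j \<in> carrier_mat k (length (map (\<lambda>a. col M (nat (a mod int n))) [i..j]))"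
      unfolding periodic_columns_def by (rule mat_of_cols_carrier)
    have colM: "col M t \<in> carrier_vec k" for t using M by (intro carrier_vecI) simp
    have S: "cyclic_interval n i j \<subseteq> {..<n}"
      unfolding cyclic_interval_def using n0 by (auto simp: nat_less_iff)
    have "cols (periodic_columns k n M i j) = map (\<lambda>a. col M (nat (a mod int n))) [i..j]"
      unfolding periodic_columns_def by (rule cols_mat_of_cols) (use colM in auto)
    then have "set (cols (periodic_columns k n M i j)) = col M ` cyclic_interval n i j"
      unfolding cyclic_interval_def by (simp add: image_image)
    then show ?thesis using rank_eq_dim[OF P] column_rank_row_space_fun[OF M S] by simp
  qed
  have iff: "(vec_space.rank k M = k \<and> (\<forall>i j. i \<le> j \<and> j \<le> i + int n \<longrightarrow>
         int (vec_space.rank k (periodic_columns k n M i j))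
           \<le> (j - i + 1) - int (card {a. i \<le> a \<and> f a \<le> j}))) \<longleftrightarrow> row_space_fun n M \<in>
               positroid_subspaces k n f"
    if M: "M \<in> carrier_mat k n" for M
    unfolding positroid_subspaces_def dots_def imp_conjL
    by (simp add: per[OF M] row_space_fun_rank[OF M] coord_subspace_row_space_fun)
  have "positroid_variety k n f = row_span n
      ` {M \<in> carrier_mat k n. row_space_fun n M \<in> positroid_subspaces k n f}"
    unfolding positroid_variety_def
  proof (rule arg_cong[where f = "image (row_span n)"], rule Set.set_eqI)
    fix M :: "complex mat"
    show "M \<in> {M \<in> full_rank_mats k n. \<forall>i j. i \<le> j \<and> j \<le> i + int n \<longrightarrow>
         int (vec_space.rank k (periodic_columns k n M i j))
           \<le> (j - i + 1) - int (card {a. i \<le> a \<and> f a \<le> j})} \<longleftrightarrow>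
       M \<in> {M \<in> carrier_mat k n. row_space_fun n M \<in> positroid_subspaces k n f}"
    proof (cases "M \<in> carrier_mat k n")
      case True
      from iff[OF True] True show ?thesis
        unfolding full_rank_mats_def mem_Collect_eq by blast
    qed (simp add: full_rank_mats_def)
  qed
  also have "\<dots> = (\<lambda>M. vec n ` row_space_fun n M)
      ` {M \<in> carrier_mat k n. row_space_fun n M \<in> positroid_subspaces k n f}"
    by (rule image_cong[OF refl]) (use row_span_eq in blast)
  also have "\<dots> = (\<lambda>W. vec n ` W) ` positroid_subspaces k n f"
  proof
    show "(\<lambda>W. vec n ` W) ` positroid_subspaces k n f \<subseteq>
        (\<lambda>M. vec n ` row_space_fun n M) ` {M \<in> carrier_mat k n. row_space_fun n M \<in>
            positroid_subspaces k n f}"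
    proof
      fix V assume "V \<in> (\<lambda>W. vec n ` W) ` positroid_subspaces k n f"
      then obtain W where W: "W \<in> positroid_subspaces k n f" "V = vec n ` W" by blast
      then obtain M where "M \<in> carrier_mat k n" "row_space_fun n M = W"
        using row_space_fun_surj[of n W k] unfolding positroid_subspaces_def by blast
      then show "V \<in> (\<lambda>M. vec n ` row_space_fun n M)
          ` {M \<in> carrier_mat k n. row_space_fun n M \<in> positroid_subspaces k n f}"
        using W by blast
    qed
  qed blast
  finally show ?thesis .
qed

lemma vec_image_inj:
  assumes "W \<subseteq> coord_space n" "W' \<subseteq> coord_space n" "vec n ` W = vec n ` W'"
  shows "W = W'"
proof -
  have recover: "W = (\<lambda>v. vec_fun v) ` vec n ` W" if "W \<subseteq> coord_space n" for W
  proof -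
    have "vec_fun (vec n x) = x" if "x \<in> W" for x
      using that \<open>W \<subseteq> coord_space n\<close> by (auto simp: vec_fun_def coord_space_def fun_eq_iff)
    then show ?thesis by (simp add: image_image)
  qed
  show ?thesis using recover[OF assms(1)] recover[OF assms(2)] assms(3) by simp
qed

text \<open>The row space of the matrix with an identity block in the columns \<open>L\<close> and entries \<open>z\<close> elsewhere, as
the graph of a linear map: coordinates in \<open>L\<close> are free and determine the others.\<close>

definition chart_subspace :: "nat \<Rightarrow> nat set \<Rightarrow> (nat \<times> nat \<Rightarrow> complex) \<Rightarrow> (nat \<Rightarrow> complex) set" where
  "chart_subspace n L z = {x \<in> coord_space n. \<forall>j<n. j \<notin> L \<longrightarrow> x j = (\<Sum>i\<in>L. x i * z (i, j))}"

lemma chart_point_eq: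
  assumes L: "L \<subseteq> {..<n}"
  shows "chart_point n L z = vec n ` chart_subspace n L z"
proof -
  have finL: "finite L" using L finite_subset by blast
  define R where "R i j = (if j \<in> L then (if j = i then 1 else 0) else z (i, j))" for i j
  define ls where "ls = sorted_list_of_set L"
  have ls: "set ls = L" "distinct ls" "length ls = card L" unfolding ls_def using finL by auto
  define M where "M = mat_of_rows n (map (\<lambda>i. vec n (R i)) ls)"
  have M: "M \<in> carrier_mat (card L) n"
    unfolding M_def using ls(3) mat_of_rows_carrier(1)[of n "map (\<lambda>i. vec n (R i)) ls"] by simp
  have bij: "bij_betw (\<lambda>p. ls ! p) {..<card L} L"
    using bij_betw_nth[OF ls(2), of "{..<card L}" L] ls(1,3) by metis
  have sumL: "(\<Sum>p<card L. F (ls ! p)) = (\<Sum>i\<in>L. F i)" for F :: "nat \<Rightarrow> complex"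
    by (rule sum.reindex_bij_betw[OF bij])
  have nth: "ls ! p \<in> L" if "p < card L" for p using that ls nth_mem by metis
  have entry: "M $$ (p, j) = R (ls ! p) j" if "p < card L" "j < n" for p j
    unfolding M_def using that ls(3) by (simp add: mat_of_rows_index)
  have dM: "dim_row M = card L" using M by (rule carrier_matD)
  have comb: "row_combination n M y j = (\<Sum>p<card L. y p * R (ls ! p) j)" if "j < n" for y j
    unfolding row_combination_def dM using that entry by simp
  have RL: "(\<Sum>i\<in>L. x i * R i j) = (if j \<in> L then x j else \<Sum>i\<in>L. x i * z (i, j))" for x j
  proof (cases "j \<in> L")
    case True
    have "(\<Sum>i\<in>L. x i * R i j) = (\<Sum>i\<in>L. if i = j then x i else 0)"
      unfolding R_def using True by (intro sum.cong) auto
    then show ?thesis using True finL by simp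
  next
    case False
    then show ?thesis unfolding R_def by simp
  qed
  have "row_space_fun n M = chart_subspace n L z"
  proof
    show "row_space_fun n M \<subseteq> chart_subspace n L z"
    proof
      fix x assume "x \<in> row_space_fun n M"
      then obtain y where x: "x = row_combination n M y" unfolding row_space_fun_def by blast
      define w where "w i = y (the_inv_into {..<card L} (\<lambda>p. ls ! p) i)" for i
      have w: "y p = w (ls ! p)" if "p < card L" for p
        unfolding w_def using bij that by (simp add: bij_betw_def the_inv_into_f_f)
      have xj: "x j = (\<Sum>i\<in>L. w i * R i j)" if "j < n" for j
      proof -
        have "x j = (\<Sum>p<card L. w (ls ! p) * R (ls ! p) j)"
          unfolding x comb[OF that] by (rule sum.cong) (simp_all add: w)
        then show ?thesis using sumL[of "\<lambda>i. w i * R i j"] by simp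
      qed
      have xL: "x i = w i" if "i \<in> L" for i
        using xj[of i] that L RL[of w i] by auto
      have "x j = (\<Sum>i\<in>L. x i * z (i, j))" if "j < n" "j \<notin> L" for j
        using xj[OF that(1)] RL[of w j] that(2) by (simp add: xL)
      moreover have "x \<in> coord_space n" unfolding x coord_space_def row_combination_def by simp
      ultimately show "x \<in> chart_subspace n L z" unfolding chart_subspace_def by blast
    qed
    show "chart_subspace n L z \<subseteq> row_space_fun n M"
    proof
      fix x assume x: "x \<in> chart_subspace n L z"
      define y where "y p = (if p < card L then x (ls ! p) else 0)" for p
      have "row_combination n M y j = x j" for j
      proof (cases "j < n")
        case True
        have "row_combination n M y j = (\<Sum>p<card L. x (ls ! p) * R (ls ! p) j)"
          unfolding comb[OF True] by (rule sum.cong) (simp_all add: y_def)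
        also have "\<dots> = (\<Sum>i\<in>L. x i * R i j)" by (rule sumL)
        also have "\<dots> = x j" using x True unfolding RL chart_subspace_def by simp
        finally show ?thesis .
      next
        case False
        then show ?thesis using x by (simp add: row_combination_def chart_subspace_def
            coord_space_def)
      qed
      then have "x = row_combination n M y" by (intro ext) (rule sym)
      moreover have "y \<in> coord_space (dim_row M)" unfolding dM coord_space_def y_def by simp
      ultimately show "x \<in> row_space_fun n M" unfolding row_space_fun_def by blast
    qed
  qed
  moreover have "chart_point n L z = row_span n M"
    unfolding chart_point_def M_def ls_def R_def ..
  ultimately show ?thesis using row_span_eq[OF M] by simp
qed

lemma coordinate_plane_eq_chart_point:
  assumes L: "L \<subseteq> {..<n}"
  shows "coordinate_plane n L = chart_point n L (\<lambda>_. 0)"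
proof -
  have "finite L" using L finite_subset by blast
  then have "map (unit_vec n) (sorted_list_of_set L) =
      map (\<lambda>i. vec n (\<lambda>j. if j \<in> L then (if j = i then 1 else 0)
          else (0::complex))) (sorted_list_of_set L)"
    by (intro map_cong) (auto simp: unit_vec_def intro!: eq_vecI)
  then show ?thesis unfolding coordinate_plane_def chart_point_def by (simp only:)
qed

lemma coord_subspace_chart_subspace: "coord_subspace n (chart_subspace n L z)"
proof -
  have "cfun.subspace (chart_subspace n L z)"
  proof (rule cfun.subspaceI)
    show "0 \<in> chart_subspace n L z"
      unfolding chart_subspace_def coord_space_def by simp
  next
    fix x y assume "x \<in> chart_subspace n L z" "y \<in> chart_subspace n L z"
    then show "x + y \<in> chart_subspace n L z"
      unfolding chart_subspace_def coord_space_def by (auto simp: sum.distrib distrib_right)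
  next
    fix x c assume "x \<in> chart_subspace n L z"
    then show "fscale c x \<in> chart_subspace n L z"
      unfolding chart_subspace_def coord_space_def
      by (auto simp: fscale_def sum_distrib_left mult.assoc)
  qed
  then show ?thesis unfolding coord_subspace_def chart_subspace_def by blast
qed

lemma dim_chart_subspace:
  assumes L: "L \<subseteq> {..<n}"
  shows "cfun.dim (chart_subspace n L z) = card L"
proof -
  let ?C = "chart_subspace n L z"
  have finL: "finite L" using L finite_subset by blast
  have C: "coord_subspace n ?C" by (rule coord_subspace_chart_subspace)
  have "cfun.dim (zeros_on ?C S) = card (L - S)" if "S \<subseteq> L" for S
    using that
  proof (induction "card (L - S)" arbitrary: S)
    case 0
    then have S: "S = L" using finL by auto
    have "x = 0" if x: "x \<in> zeros_on ?C S" for x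
    proof
      fix j
      have "x i = 0" if "i \<in> L" for i using x S that unfolding zeros_on_def by blast
      then show "x j = 0 j"
        using x unfolding zeros_on_def chart_subspace_def coord_space_def
        by (cases "j < n"; cases "j \<in> L") auto
    qed
    moreover have "0 \<in> zeros_on ?C S"
      using coord_subspace_zeros_on[OF C, of S] cfun.subspace_0 unfolding coord_subspace_def by
          blast
    ultimately have "zeros_on ?C S = {0}" by blast
    then show ?case using S dim_zero_space by simp
  next
    case (Suc m)
    then obtain t where t: "t \<in> L" "t \<notin> S"
      by (metis card.empty DiffE equals0I nat.distinct(1))
    have "L - insert t S = (L - S) - {t}" by blast
    then have m: "m = card (L - insert t S)" using Suc(2) t finL by simp
    have "insert t S \<subseteq> L" using Suc(3) t by simp
    with m have IH: "cfun.dim (zeros_on ?C (insert t S)) = card (L - insert t S)"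
      by (rule Suc(1))
    define x where "x j = (if j < n then if j \<in> L then if j
        = t then 1 else 0 else z (t, j) else 0)" for j
    have "(\<Sum>i\<in>L. x i * z (i, j)) = z (t, j)" for j
    proof -
      have "(\<Sum>i\<in>L. x i * z (i, j)) = (\<Sum>i\<in>L. if i = t then z (i, j) else 0)"
        unfolding x_def using L by (intro sum.cong) auto
      then show ?thesis using t finL by simp
    qed
    moreover have "x j = z (t, j)" if "j < n" "j \<notin> L" for j using that unfolding x_def by simp
    moreover have "x i = 0" if "i \<in> S" for i
    proof -
      have "i \<in> L" "i \<noteq> t" using that t Suc(3) by blast+
      then show ?thesis unfolding x_def by simp
    qed
    moreover have "x j = 0" if "j \<ge> n" for j using that unfolding x_def by simp
    ultimately have "x \<in> zeros_on ?C S"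
      unfolding zeros_on_def chart_subspace_def coord_space_def by simp
    moreover have "x t \<noteq> 0" using t L unfolding x_def by auto
    ultimately have "\<exists>x\<in>zeros_on ?C S. x t \<noteq> 0" by (intro bexI[of _ x])
    then show ?case using dim_zeros_on_insert[OF C, of S t] IH m Suc(2) by simp
  qed
  from this[of "{}"] show ?thesis by simp
qed

section \<open>Intersecting a positroid variety with a fixed component\<close>

lemma finite_cyclic_interval: "finite (cyclic_interval n a b)"
  unfolding cyclic_interval_def by simp

lemma cyclic_interval_empty: "b < a \<Longrightarrow> cyclic_interval n a b = {}"
  unfolding cyclic_interval_def by simp

lemma cyclic_interval_mono: "a \<le> a' \<Longrightarrow> b' \<le> b \<Longrightarrow> cyclic_interval n a' b' \<subseteq> cyclic_interval n a b"
  unfolding cyclic_interval_def by (intro image_mono) auto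

lemma mem_cyclic_interval: "t \<in> {a..b} \<Longrightarrow> nat (t mod int n) \<in> cyclic_interval n a b"
  unfolding cyclic_interval_def by blast

lemma mod_of_column:
  assumes "i < n" shows "nat ((int i + m * int n) mod int n) = i"
  using assms by simp

lemma mem_cyclic_interval_iff:
  assumes "i < n"
  shows "i \<in> cyclic_interval n a b \<longleftrightarrow> (\<exists>m. a \<le> int i + m * int n \<and> int i + m * int n \<le> b)"
proof
  assume "i \<in> cyclic_interval n a b"
  then obtain t where t: "a \<le> t" "t \<le> b"
      "i = nat (t mod int n)" unfolding cyclic_interval_def by auto
  have "0 \<le> t mod int n" using assms by simp
  then have "int i = t mod int n" using t(3) by simp
  then have "t = int i + (t div int n) * int n" by (simp add: mod_div_decomp)
  then show "\<exists>m. a \<le> int i + m * int n \<and> int i + m * int n \<le> b" using t by metis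
next
  assume "\<exists>m. a \<le> int i + m * int n \<and> int i + m * int n \<le> b"
  then obtain m where "int i + m * int n \<in> {a..b}" by auto
  then show "i \<in> cyclic_interval n a b" using mem_cyclic_interval mod_of_column[OF assms] by metis
qed

lemma cyclic_interval_full:
  assumes "0 < n" shows "{..<n} \<subseteq> cyclic_interval n a (a + int n - 1)"
proof
  fix i assume "i \<in> {..<n}"
  then have i: "i < n" by simp
  let ?m = "- ((int i - a) div int n)"
  have "int i - a = (int i - a) div int n * int n + (int i - a) mod int n" by simp
  moreover have "0 \<le> (int i - a) mod int n" "(int i - a) mod int n < int n" using assms by simp_all
  ultimately have "a \<le> int i + ?m * int n"
      "int i + ?m * int n \<le> a + int n - 1" by (simp_all only: mult_minus_left)
  then show "i \<in> cyclic_interval n a (a + int n - 1)" using mem_cyclic_interval_iff[OF i] by blast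
qed

lemma cyclic_interval_subset: "0 < n \<Longrightarrow> cyclic_interval n a b \<subseteq> {..<n}"
  unfolding cyclic_interval_def by (auto simp: nat_less_iff)

lemma cyclic_interval_split:
  assumes "a \<le> c" "c \<le> b"
  shows "cyclic_interval n a b =
    insert (nat (c mod int n)) (cyclic_interval n a (c - 1) \<union> cyclic_interval n (c + 1) b)"
proof -
  have "{a..b} = insert c ({a..c - 1} \<union> {c + 1..b})" using assms by auto
  then show ?thesis unfolding cyclic_interval_def by (simp add: image_Un)
qed

definition rank_bounded :: "nat \<Rightarrow> (int \<Rightarrow> int) \<Rightarrow> (nat \<Rightarrow> complex) set \<Rightarrow> int \<Rightarrow> int \<Rightarrow> bool" where
  "rank_bounded n f W a b \<longleftrightarrow>
     int (column_rank W (cyclic_interval n a b)) \<le> b - a + 1 - int (card (dots f a b))"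

lemma mem_positroid_subspaces:
  "W \<in> positroid_subspaces k n f \<longleftrightarrow> coord_subspace n W \<and> cfun.dim W = k \<and>
     (\<forall>a b. a \<le> b \<longrightarrow> b \<le> a + int n \<longrightarrow> rank_bounded n f W a b)"
  unfolding positroid_subspaces_def rank_bounded_def by simp

lemma rank_bounded_empty: "bounded_periodic n f \<Longrightarrow> rank_bounded n f W a (a - 1)"
  unfolding rank_bounded_def by (simp add: cyclic_interval_empty dots_empty)

text \<open>The case \<open>b = a - 1\<close> of an empty interval spares case distinctions when an interval is cut next to
its end.\<close>

lemma positroid_rank_bounded:
  assumes "bounded_periodic n f" "W \<in> positroid_subspaces k n f" "a \<le> b + 1" "b \<le> a + int n"
  shows "rank_bounded n f W a b"
proof (cases "a \<le> b")
  case True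
  then show ?thesis using assms(2,4) unfolding mem_positroid_subspaces by blast
next
  case False
  then have "b = a - 1" using assms(3) by simp
  then show ?thesis using rank_bounded_empty[OF assms(1)] by simp
qed

lemma column_rank_insert_vanishing:
  assumes "coord_subspace n W" "\<forall>x\<in>W. x i = 0"
  shows "column_rank W (insert i S) = column_rank W S"
  using column_rank_insert[OF assms(1), of i S] assms(2) unfolding zeros_on_def by simp

lemma column_rank_insert_unit:
  assumes W: "coord_subspace n W" and e: "unit_fun i \<in> W" and "i \<notin> S"
  shows "column_rank W (insert i S) = column_rank W S + 1"
proof -
  have "unit_fun i \<in> zeros_on W S" using e \<open>i \<notin> S\<close> unfolding zeros_on_def unit_fun_def by auto
  moreover have "unit_fun i i \<noteq> 0" unfolding unit_fun_def by simp
  ultimately have "\<exists>x\<in>zeros_on W S. x i \<noteq> 0" by (intro bexI[of _ "unit_fun i"])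
  then show ?thesis using column_rank_insert[OF W, of i S] by simp
qed

lemma positroid_swap_subset:
  assumes bp: "bounded_periodic n f" and pq: "p < q" "q < p + int n" "f p < f q"
    and W: "coord_subspace n W" "cfun.dim W = k"
  shows "W \<in> positroid_subspaces k n (f \<circ> periodic_swap n p q) \<longleftrightarrow>
    W \<in> positroid_subspaces k n f \<and>
    (\<forall>a b m. a \<le> b \<longrightarrow> b \<le> a + int n \<longrightarrow> p + m * int n < a \<longrightarrow> a \<le> q + m * int n \<longrightarrow>
       f p + m * int n \<le> b \<longrightarrow> b < f q + m * int n \<longrightarrow>
       int (column_rank W (cyclic_interval n a b)) \<le> b - a - int (card (dots f a b)))"
  (is "?G \<longleftrightarrow> ?F \<and> ?E")
proof -
  \<comment> \<open>The quadrants that gain a point.\<close>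
  define ex where "ex a b \<longleftrightarrow> (\<exists>m. p + m * int n < a \<and> a \<le> q + m * int n \<and>
    f p + m * int n \<le> b \<and> b < f q + m * int n)" for a b
  have c: "int (card (dots (f \<circ> periodic_swap n p q) a b)) =
      int (card (dots f a b)) + (if ex a b then 1 else 0)" for a b
    unfolding card_dots_swap[OF bp pq] ex_def[symmetric] by simp
  have r: "rank_bounded n (f \<circ> periodic_swap n p q) W a b \<longleftrightarrow>
      rank_bounded n f W a b \<and>
      (ex a b \<longrightarrow> int (column_rank W (cyclic_interval n a b)) \<le> b - a - int (card (dots f a
          b)))" for a b
    unfolding rank_bounded_def c by auto
  have e: "?E \<longleftrightarrow> (\<forall>a b. a \<le> b \<longrightarrow> b \<le> a + int n \<longrightarrow> ex a b \<longrightarrow>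
      int (column_rank W (cyclic_interval n a b)) \<le> b - a - int (card (dots f a b)))"
    unfolding ex_def by blast
  show ?thesis unfolding mem_positroid_subspaces r e using W by blast
qed

text \<open>A new condition concerns an interval from \<open>a\<close> to \<open>b\<close> around a translate \<open>c\<close> of \<open>i\<close>.  As column \<open>i\<close>
vanishes, the rank of the interval is at most the sum of the ranks of its parts left and right of
\<open>c\<close>.  By the choice of \<open>x\<close> every point counted for the interval is counted for one of the parts, and
the column \<open>c\<close>, which lies in neither part, gives the missing one.\<close>

lemma deletion_swap:
  assumes f: "bounded_affine_permutation k n f" and i: "i < n" and fi: "f (int i) \<noteq> int i"
      "f (int i) \<noteq> int i + int n"
  obtains g where "bounded_affine_permutation k n g" "g (int i) < f (int i)"
    "{W \<in> positroid_subspaces k n f. \<forall>x\<in>W. x i = 0} = {W \<in> positroid_subspaces k n g. \<forall>x\<in>W. x i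
        = 0}"
proof -
  have bp: "bounded_periodic n f" using f affine_permutation_iff_window_count by blast
  have n0: "0 < n" and bd: "\<And>u. u \<le> f u" using bp unfolding bounded_periodic_def by auto
  obtain x where x: "x < int i" "int i < x + int n" "int i \<le> f x" "f x < f (int i)"
      "f (int i) \<le> x + int n"
    and gap: "\<And>u. x < u \<Longrightarrow> u < int i \<Longrightarrow> int i \<le> f u \<Longrightarrow> f (int i) \<le> f u"
    using deletion_swap_exists[OF bp fi] by metis
  let ?g = "f \<circ> periodic_swap n x (int i)"
  have g: "bounded_affine_permutation k n ?g" by (rule affine_permutation_swap[OF f x(1,2,4,5,3)])
  have "?g (int i) = f x" using periodic_swap_snd[OF n0 x(1,2), of 0] by simp
  then have gi: "?g (int i) < f (int i)" using x by simp
  have region: "int (column_rank W (cyclic_interval n a b)) \<le> b - a - int (card (dots f a b))"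
    if W: "W \<in> positroid_subspaces k n f" "\<forall>x\<in>W. x i = 0"
      and ab: "a \<le> b" "b \<le> a + int n"
      and m: "x + m * int n < a" "a \<le> int i + m * int n" "f x + m * int n \<le> b"
          "b < f (int i) + m * int n"
    for W a b m
  proof -
    have cW: "coord_subspace n W" using W(1) unfolding mem_positroid_subspaces by blast
    define c where "c = int i + m * int n"
    have ac: "a \<le> c" "c \<le> b" using m x(3) unfolding c_def by simp_all
    have fc: "f c = f (int i) + m * int n" unfolding c_def by (rule bounded_periodic_shift[OF bp])
    have "cyclic_interval n a b
        = insert i (cyclic_interval n a (c - 1) \<union> cyclic_interval n (c + 1) b)"
      using cyclic_interval_split[OF ac] mod_of_column[OF i] unfolding c_def by metis
    then have "column_rank W (cyclic_interval n a b) =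
        column_rank W (cyclic_interval n a (c - 1) \<union> cyclic_interval n (c + 1) b)"
      using column_rank_insert_vanishing[OF cW W(2)] by simp
    also have "\<dots> \<le> column_rank W (cyclic_interval n a (c - 1)) + column_rank W (cyclic_interval n (c + 1) b)"
      by (rule column_rank_Un_le[OF cW finite_cyclic_interval])
    finally have R: "column_rank W (cyclic_interval n a b) \<le>
        column_rank W (cyclic_interval n a (c - 1)) + column_rank W (cyclic_interval n (c + 1) b)" .
    have D: "dots f a b = dots f a (c - 1) \<union> dots f (c + 1) b"
    proof
      show "dots f a (c - 1) \<union> dots f (c + 1) b \<subseteq> dots f a b"
        using ac unfolding dots_def by auto
      show "dots f a b \<subseteq> dots f a (c - 1) \<union> dots f (c + 1) b"
      proof
        fix u assume "u \<in> dots f a b"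
        then have u: "a \<le> u" "f u \<le> b" unfolding dots_def by auto
        consider "u > c" | "u = c" | "u < c" by linarith
        then show "u \<in> dots f a (c - 1) \<union> dots f (c + 1) b"
        proof cases
          case 1
          then show ?thesis using u unfolding dots_def by simp
        next
          case 2
          then show ?thesis using u fc m by simp
        next
          case 3
          have sh: "f (u - m * int n) = f u - m * int n"
            using bounded_periodic_shift[OF bp, of u "- m"] by simp
          have "f u < c"
          proof (rule ccontr)
            assume "\<not> f u < c"
            then have "f (int i) \<le> f (u - m * int n)"
              using gap[of "u - m * int n"] 3 u m unfolding sh c_def by simp
            then show False using u m unfolding sh by simp
          qed
          then show ?thesis using u unfolding dots_def by simp
        qed
      qed
    qed
    have "dots f a (c - 1) \<inter> dots f (c + 1) b = {}"
    proof -
      have False if "f u \<le> c - 1" "c + 1 \<le> u" for u using bd[of u] that by simp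
      then show ?thesis unfolding dots_def by blast
    qed
    then have C: "card (dots f a b) = card (dots f a (c - 1)) + card (dots f (c + 1) b)"
      unfolding D by (intro card_Un_disjoint finite_dots[OF bp])
    have "rank_bounded n f W a (c - 1)" "rank_bounded n f W (c + 1) b"
      by (rule positroid_rank_bounded[OF bp W(1)]; use ac ab in simp)+
    then show ?thesis using R C unfolding rank_bounded_def by simp
  qed
  have "W \<in> positroid_subspaces k n f \<longleftrightarrow> W \<in> positroid_subspaces k n ?g" if "\<forall>x\<in>W. x i = 0" for W
  proof (cases "coord_subspace n W \<and> cfun.dim W = k")
    case True
    then show ?thesis
      using positroid_swap_subset[OF bp x(1,2,4), of W k] region[OF _ that] by blast
  next
    case False
    then show ?thesis unfolding mem_positroid_subspaces by blast
  qed
  then have "{W \<in> positroid_subspaces k n f. \<forall>x\<in>W. x i = 0}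
      = {W \<in> positroid_subspaces k n ?g. \<forall>x\<in>W. x i = 0}"
    by blast
  then show ?thesis using that[OF g gi] by blast
qed

text \<open>A new condition concerns an interval from \<open>a\<close> to \<open>b\<close> strictly between the translates \<open>c\<close> and
\<open>c + n\<close> of \<open>i\<close>.  Extending the interval on either side up to the column \<open>i\<close> gives two intervals whose
union is everything, of rank \<open>k\<close>, and whose intersection has rank at least one more than the interval,
since \<open>W\<close> contains the \<open>i\<close>-th unit vector.  Submodularity bounds the rank of the interval by the old
conditions for the two extensions, and by the choice of \<open>x\<close> the points of the graph add up.\<close>

lemma contraction_swap:
  assumes f: "bounded_affine_permutation k n f" and i: "i < n" and fi: "f (int i) \<noteq> int i"
      "f (int i) \<noteq> int i + int n"
  obtains g where "bounded_affine_permutation k n g" "f (int i) < g (int i)"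
    "{W \<in> positroid_subspaces k n f. unit_fun i \<in> W}
        = {W \<in> positroid_subspaces k n g. unit_fun i \<in> W}"
proof -
  have bp: "bounded_periodic n f" using f affine_permutation_iff_window_count by blast
  have n0: "0 < n" and bd: "\<And>u. u \<le> f u"
      "\<And>u. f u \<le> u + int n" using bp unfolding bounded_periodic_def by auto
  obtain x where x: "int i < x" "x < int i + int n" "f (int i) < f x" "f x \<le> int i + int n"
      "x \<le> f (int i)"
    and gap: "\<And>u. int i < u \<Longrightarrow> u < x \<Longrightarrow> f u \<le> int i + int n \<Longrightarrow> f u \<le> f (int i)"
    using contraction_swap_exists[OF bp fi] by metis
  let ?g = "f \<circ> periodic_swap n (int i) x"
  have g: "bounded_affine_permutation k n ?g" by (rule affine_permutation_swap[OF f x])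
  have "?g (int i) = f x" using periodic_swap_fst[OF n0 x(1,2), of 0] by simp
  then have gi: "f (int i) < ?g (int i)" using x by simp
  have region: "int (column_rank W (cyclic_interval n a b)) \<le> b - a - int (card (dots f a b))"
    if W: "W \<in> positroid_subspaces k n f" "unit_fun i \<in> W"
      and ab: "a \<le> b" "b \<le> a + int n"
      and m: "int i + m * int n < a" "a \<le> x + m * int n" "f (int i) + m * int n \<le> b"
          "b < f x + m * int n"
    for W a b m
  proof -
    have cW: "coord_subspace n W" and dW: "cfun.dim W
        = k" using W(1) unfolding mem_positroid_subspaces by blast+
    define c where "c = int i + m * int n"
    have ca: "c < a" and bc: "b < c + int n" using m x(4) unfolding c_def by simp_all
    have fc: "f c = f (int i) + m * int n" unfolding c_def by (rule bounded_periodic_shift[OF bp])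
    have ci: "nat (c mod int n) = i" "nat ((c + int n) mod int n) = i"
      using mod_of_column[OF i, of m] mod_of_column[OF i, of "m + 1"] unfolding c_def by (simp_all
          add: algebra_simps)
    let ?S = "cyclic_interval n a (c + int n)" and ?T = "cyclic_interval n c b"
        and ?I = "cyclic_interval n a b"
    have "i \<notin> ?I"
    proof
      assume "i \<in> ?I"
      then obtain m' where m': "a \<le> int i + m' * int n" "int i + m' * int n \<le> b"
        using mem_cyclic_interval_iff[OF i] by blast
      have "m * int n < m' * int n" using m' ca unfolding c_def by linarith
      moreover have "m' * int n < (m + 1) * int n"
        using m' bc unfolding c_def distrib_right mult_1 by linarith
      ultimately have "m < m'" "m' < m + 1" using n0 by (simp_all only: mult_less_cancel_right_pos
          of_nat_0_less_iff)
      then show False by simp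
    qed
    then have "column_rank W (insert i ?I) = column_rank W ?I + 1"
      by (rule column_rank_insert_unit[OF cW W(2)])
    moreover have "insert i ?I \<subseteq> ?S \<inter> ?T"
    proof -
      have "i \<in> ?S" using mem_cyclic_interval[of "c + int n" a "c + int n" n] ci ab bc by simp
      moreover have "i \<in> ?T" using mem_cyclic_interval[of c c b n] ci ab ca by simp
      moreover have "?I \<subseteq> ?S" "?I \<subseteq> ?T" using ca bc by (intro cyclic_interval_mono; simp)+
      ultimately show ?thesis by blast
    qed
    ultimately have "column_rank W ?I + 1 \<le> column_rank W (?S \<inter> ?T)"
      using column_rank_mono[OF cW, of "insert i ?I" "?S \<inter> ?T"] by simp
    moreover have "column_rank W (?S \<union> ?T) = k"
    proof -
      have "cyclic_interval n c (c + int n - 1) \<subseteq> ?S \<union> ?T"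
        unfolding cyclic_interval_def image_Un[symmetric] using ab by (intro image_mono) auto
      then have "{..<n} \<subseteq> ?S \<union> ?T" using cyclic_interval_full[OF n0, of c] by blast
      then have "?S \<union> ?T = {..<n}" using cyclic_interval_subset[OF n0] by blast
      then show ?thesis using column_rank_all[OF cW] dW by simp
    qed
    ultimately have R: "k + column_rank W ?I + 1 \<le> column_rank W ?S + column_rank W ?T"
      using column_rank_submodular[OF cW finite_cyclic_interval, of ?S n c b] by simp
    \<comment> \<open>Inclusion and exclusion for the points counted by the two extended intervals.\<close>
    have D: "dots f a (c + int n) \<union> dots f c b = dots f c (c + int n)"
    proof
      show "dots f a (c + int n) \<union> dots f c b \<subseteq> dots f c (c + int n)"
        using ca bc unfolding dots_def by auto
      show "dots f c (c + int n) \<subseteq> dots f a (c + int n) \<union> dots f c b"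
      proof
        fix u assume "u \<in> dots f c (c + int n)"
        then have u: "c \<le> u" "f u \<le> c + int n" unfolding dots_def by auto
        consider "u \<ge> a" | "u = c" | "c < u" "u < a" using u by linarith
        then show "u \<in> dots f a (c + int n) \<union> dots f c b"
        proof cases
          case 1
          then show ?thesis using u unfolding dots_def by simp
        next
          case 2
          then show ?thesis using fc m unfolding dots_def by simp
        next
          case 3
          have sh: "f (u - m * int n) = f u - m * int n"
            using bounded_periodic_shift[OF bp, of u "- m"] by simp
          have "f (u - m * int n) \<le> f (int i)"
            using gap[of "u - m * int n"] 3 u m unfolding sh c_def by simp
          then have "f u \<le> b" using m unfolding sh by simp
          then show ?thesis using u unfolding dots_def by simp
        qed
      qed
    qed
    have I: "dots f a (c + int n) \<inter> dots f c b = dots f a b"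
      using ca bc unfolding dots_def by auto
    have "card (dots f a (c + int n)) + card (dots f c b)
        = card (dots f c (c + int n)) + card (dots f a b)"
      using card_Un_Int[OF finite_dots[OF bp] finite_dots[OF bp], of a "c + int n" c b]
          unfolding D I .
    moreover have "int (card (dots f c (c + int n))) = int n - int k + 1"
    proof -
      have "dots f c (c + int n) = insert c (dots f (c + 1) (c + int n))"
        using bd(2)[of c] unfolding dots_def by auto
      moreover have "c \<notin> dots f (c + 1) (c + int n)" unfolding dots_def by simp
      ultimately have "card (dots f c (c + int n))
          = Suc (card (dots f (c + 1) (c + 1 + int n - 1)))"
        using finite_dots[OF bp] by simp
      moreover have "int (card (dots f (c + 1) (c + 1 + int n - 1))) = int n - int k"
        using f affine_permutation_iff_window_count by blast
      ultimately show ?thesis by simp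
    qed
    moreover have "rank_bounded n f W a (c + int n)" "rank_bounded n f W c b"
      by (rule positroid_rank_bounded[OF bp W(1)]; use ca bc ab in simp)+
    ultimately show ?thesis using R unfolding rank_bounded_def by simp
  qed
  have "W \<in> positroid_subspaces k n f \<longleftrightarrow> W \<in> positroid_subspaces k n ?g" if "unit_fun i \<in> W" for W
  proof (cases "coord_subspace n W \<and> cfun.dim W = k")
    case True
    then show ?thesis
      using positroid_swap_subset[OF bp x(1,2,3), of W k] region[OF _ that] by blast
  next
    case False
    then show ?thesis unfolding mem_positroid_subspaces by blast
  qed
  then have "{W \<in> positroid_subspaces k n f. unit_fun i \<in> W}
      = {W \<in> positroid_subspaces k n ?g. unit_fun i \<in> W}"
    by blast
  then show ?thesis using that[OF g gi] by blast
qed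

lemma loop_at_deleted_column:
  assumes "bounded_affine_permutation k n f" "i < n" "f (int i) \<noteq> int i + int n"
  shows "\<exists>g. bounded_affine_permutation k n g \<and> g (int i) = int i \<and>
    {W \<in> positroid_subspaces k n f. \<forall>x\<in>W. x i = 0} = {W \<in> positroid_subspaces k n g. \<forall>x\<in>W. x i = 0}"
  using assms(1,3)
proof (induction "nat (f (int i) - int i)" arbitrary: f rule: less_induct)
  case less
  show ?case
  proof (cases "f (int i) = int i")
    case True
    then show ?thesis using less.prems(1) by blast
  next
    case False
    obtain g where g: "bounded_affine_permutation k n g" "g (int i) < f (int i)"
      "{W \<in> positroid_subspaces k n f. \<forall>x\<in>W. x i = 0} = {W \<in> positroid_subspaces k n g. \<forall>x\<in>W. x i
          = 0}"
      by (rule deletion_swap[OF less.prems(1) assms(2) False less.prems(2)])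
    have "f (int i) \<le> int i + int n" "int i \<le> g (int i)"
      using less.prems(1) g(1) unfolding bounded_affine_permutation_def by blast+
    then have "nat (g (int i) - int i) < nat (f (int i) - int i)" "g (int i) \<noteq> int i + int n"
      using g(2) by simp_all
    from less.hyps[OF this(1) g(1) this(2)] show ?thesis unfolding g(3) .
  qed
qed

lemma coloop_at_contracted_column:
  assumes "bounded_affine_permutation k n f" "i < n" "f (int i) \<noteq> int i"
  shows "\<exists>g. bounded_affine_permutation k n g \<and> g (int i) = int i + int n \<and>
    {W \<in> positroid_subspaces k n f. unit_fun i \<in> W} = {W \<in> positroid_subspaces k n g. unit_fun
        i \<in> W}"
  using assms(1,3)
proof (induction "nat (int i + int n - f (int i))" arbitrary: f rule: less_induct)
  case less
  show ?case
  proof (cases "f (int i) = int i + int n")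
    case True
    then show ?thesis using less.prems(1) by blast
  next
    case False
    obtain g where g: "bounded_affine_permutation k n g" "f (int i) < g (int i)"
      "{W \<in> positroid_subspaces k n f. unit_fun i \<in> W}
          = {W \<in> positroid_subspaces k n g. unit_fun i \<in> W}"
      by (rule contraction_swap[OF less.prems(1) assms(2) less.prems(2) False])
    have "int i \<le> f (int i)" "g (int i) \<le> int i + int n"
      using less.prems(1) g(1) unfolding bounded_affine_permutation_def by blast+
    then have "nat (int i + int n - g (int i)) < nat (int i + int n - f (int i))"
        "g (int i) \<noteq> int i"
      using g(2) by simp_all
    from less.hyps[OF this(1) g(1) this(2)] show ?thesis unfolding g(3) .
  qed
qed

text \<open>A coloop forces rank at most \<open>k - 1\<close> on the remaining columns, but these have rank \<open>k\<close> if column \<open>i\<close>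
vanishes.\<close>

lemma not_coloop_if_vanishing:
  assumes f: "bounded_affine_permutation k n f" and i: "i < n"
      and W: "W \<in> positroid_subspaces k n f" "\<forall>x\<in>W. x i = 0"
  shows "f (int i) \<noteq> int i + int n"
proof
  assume fi: "f (int i) = int i + int n"
  have bp: "bounded_periodic n f" and w: "int (card (dots f (int i) (int i + int n - 1)))
      = int n - int k"
    using f affine_permutation_iff_window_count by blast+
  have n0: "0 < n" using i by simp
  have cW: "coord_subspace n W" and dW: "cfun.dim W
      = k" using W(1) unfolding mem_positroid_subspaces by blast+
  let ?a = "int i" and ?b = "int i + int n - 1"
  have "dots f ?a ?b = dots f (?a + 1) ?b"
  proof (rule Set.set_eqI)
    fix u
    show "u \<in> dots f ?a ?b \<longleftrightarrow> u \<in> dots f (?a + 1) ?b"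
      using fi unfolding dots_def by (cases "u = int i") auto
  qed
  moreover have "rank_bounded n f W (?a + 1) ?b"
    by (rule positroid_rank_bounded[OF bp W(1)]) (use n0 in simp_all)
  moreover have "cyclic_interval n ?a ?b = insert i (cyclic_interval n (?a + 1) ?b)"
    using cyclic_interval_split[of ?a ?a ?b n] n0 i by (simp add: cyclic_interval_empty)
  then have "column_rank W (cyclic_interval n ?a ?b)
      = column_rank W (cyclic_interval n (?a + 1) ?b)"
    using column_rank_insert_vanishing[OF cW W(2)] by simp
  moreover have "cyclic_interval n ?a ?b = {..<n}"
    using cyclic_interval_full[OF n0] cyclic_interval_subset[OF n0] by blast
  then have "column_rank W (cyclic_interval n ?a ?b) = k" using column_rank_all[OF cW] dW by simp
  ultimately show False using w unfolding rank_bounded_def by simp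
qed

lemma not_loop_if_unit:
  assumes f: "bounded_affine_permutation k n f" and i: "i < n"
      and W: "W \<in> positroid_subspaces k n f" "unit_fun i \<in> W"
  shows "f (int i) \<noteq> int i"
proof
  assume fi: "f (int i) = int i"
  have bp: "bounded_periodic n f" using f affine_permutation_iff_window_count by blast
  have cW: "coord_subspace n W" using W(1) unfolding mem_positroid_subspaces by blast
  have "rank_bounded n f W (int i) (int i)"
    by (rule positroid_rank_bounded[OF bp W(1)]) simp_all
  moreover have "int i \<in> dots f (int i) (int i)" using fi unfolding dots_def by simp
  then have "0 < card (dots f (int i) (int i))" using finite_dots[OF bp] by (auto simp:
      card_gt_0_iff)
  moreover have "cyclic_interval n (int i) (int i) = insert i {}"
    using i unfolding cyclic_interval_def by simp
  ultimately show False using column_rank_insert_unit[OF cW W(2), of "{}"] unfolding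
      rank_bounded_def by simp
qed

section \<open>Forgetting a coordinate\<close>

definition drop_coord :: "nat \<Rightarrow> (nat \<Rightarrow> complex) set \<Rightarrow> (nat \<Rightarrow> complex) set" where
  "drop_coord i W = (\<lambda>x. x \<circ> insert_index i) ` W"

text \<open>\<open>lift_zero\<close> and \<open>lift_free\<close> are the inverses of \<open>drop_coord\<close> on subspaces with vanishing \<open>i\<close>-th
coordinate and on subspaces that contain the \<open>i\<close>-th unit vector.\<close>

definition lift_zero :: "nat \<Rightarrow> nat \<Rightarrow> (nat \<Rightarrow> complex) set \<Rightarrow> (nat \<Rightarrow> complex) set" where
  "lift_zero n i W = {x \<in> coord_space n. x i = 0 \<and> x \<circ> insert_index i \<in> W}"

definition lift_free :: "nat \<Rightarrow> nat \<Rightarrow> (nat \<Rightarrow> complex) set \<Rightarrow> (nat \<Rightarrow> complex) set" where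
  "lift_free n i W = {x \<in> coord_space n. x \<circ> insert_index i \<in> W}"

lemma comp_insert_index_add: "(x + y) \<circ> insert_index i
    = (x \<circ> insert_index i) + (y \<circ> insert_index i)"
  for x y :: "nat \<Rightarrow> complex"
  by (rule ext) simp

lemma comp_insert_index_scale: "fscale c x \<circ> insert_index i = fscale c (x \<circ> insert_index i)"
  by (rule ext) (simp add: fscale_def)

lemma comp_insert_index_inj:
  assumes "x \<circ> insert_index i = y \<circ> insert_index i" "x i = y i"
  shows "x = y"
proof
  fix j
  show "x j = y j"
  proof (cases "j = i")
    case False
    then have "insert_index i (delete_index i j) = j" by (rule insert_delete_index)
    then show ?thesis using fun_cong[OF assms(1), of "delete_index i j"] by simp
  qed (use assms in simp)
qed

lemma comp_insert_index_coord_space: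
  assumes "x \<in> coord_space n" "i < n"
  shows "x \<circ> insert_index i \<in> coord_space (n - 1)"
  using assms unfolding coord_space_def by (auto simp: insert_index_def)

lemma extend_by_zero:
  assumes "x \<in> coord_space (n - 1)" "i < n"
  obtains y where "y \<in> coord_space n" "y i = 0" "y \<circ> insert_index i = x"
proof
  let ?y = "\<lambda>j. if j = i then 0 else x (delete_index i j)"
  show "?y \<in> coord_space n" using assms unfolding coord_space_def by (auto simp: delete_index_def)
  show "?y \<circ> insert_index i = x"
  proof
    fix j
    have "insert_index i j \<noteq> i" by (simp add: insert_index_def)
    then show "(?y \<circ> insert_index i) j = x j" by simp
  qed
qed simp

lemma coord_subspace_drop_coord:
  assumes W: "coord_subspace n W" and i: "i < n"
  shows "coord_subspace (n - 1) (drop_coord i W)"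
proof -
  have sub: "cfun.subspace W" using W unfolding coord_subspace_def by simp
  have "cfun.subspace (drop_coord i W)"
  proof (rule cfun.subspaceI)
    have "0 = (0 :: nat \<Rightarrow> complex) \<circ> insert_index i" by (rule ext) simp
    then show "0 \<in> drop_coord i W" unfolding drop_coord_def using cfun.subspace_0[OF sub] by (rule
        image_eqI)
  next
    fix x y assume "x \<in> drop_coord i W" "y \<in> drop_coord i W"
    then obtain u v where "u \<in> W" "v \<in> W" "x = u \<circ> insert_index i" "y = v \<circ> insert_index i"
      unfolding drop_coord_def by blast
    then show "x + y \<in> drop_coord i W"
      unfolding drop_coord_def using cfun.subspace_add[OF sub, of u v]
      by (intro image_eqI[of _ _ "u + v"]) (simp_all only: comp_insert_index_add)
  next
    fix x c assume "x \<in> drop_coord i W"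
    then obtain u where "u \<in> W" "x = u \<circ> insert_index i"
      unfolding drop_coord_def by blast
    then show "fscale c x \<in> drop_coord i W"
      unfolding drop_coord_def using cfun.subspace_scale[OF sub, of u c]
      by (intro image_eqI[of _ _ "fscale c u"]) (simp_all only: comp_insert_index_scale)
  qed
  moreover have "drop_coord i W \<subseteq> coord_space (n - 1)"
    using W i comp_insert_index_coord_space unfolding drop_coord_def coord_subspace_def by blast
  ultimately show ?thesis unfolding coord_subspace_def by blast
qed

lemma dim_drop_coord_vanishing:
  assumes W: "coord_subspace n W" and van: "\<forall>x\<in>W. x i = 0"
  shows "cfun.dim (drop_coord i W) = cfun.dim W"
  unfolding drop_coord_def
proof (rule dim_image_inj_on[OF comp_insert_index_add comp_insert_index_scale])
  show "cfun.subspace W" using W unfolding coord_subspace_def by simp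
  show "finitely_spanned W" by (rule coord_subspace_finitely_spanned[OF W])
  show "inj_on (\<lambda>x. x \<circ> insert_index i) W"
  proof (rule inj_onI)
    fix x y assume x: "x \<in> W" and y: "y \<in> W" and eq: "x \<circ> insert_index i = y \<circ> insert_index i"
    have "x i = y i" using van[rule_format, OF x] van[rule_format, OF y] by simp
    with eq show "x = y" by (rule comp_insert_index_inj)
  qed
qed

lemma column_rank_drop_coord_vanishing:
  assumes W: "coord_subspace n W" and van: "\<forall>x\<in>W. x i = 0"
  shows "column_rank (drop_coord i W) S = column_rank W (insert_index i ` S)"
proof -
  have Z: "zeros_on (drop_coord i W) S = drop_coord i (zeros_on W (insert_index i ` S))"
    unfolding zeros_on_def drop_coord_def by auto
  have "cfun.dim (zeros_on (drop_coord i W) S) = cfun.dim (zeros_on W (insert_index i ` S))"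
    unfolding Z by (rule dim_drop_coord_vanishing[OF coord_subspace_zeros_on[OF W]])
      (use van in \<open>simp add: zeros_on_def\<close>)
  then show ?thesis unfolding column_rank_def using dim_drop_coord_vanishing[OF W van] by simp
qed

text \<open>Subtracting a multiple of the \<open>i\<close>-th unit vector does not change the other coordinates.  So facts for
subspaces that contain this vector reduce to those with vanishing \<open>i\<close>-th coordinate.\<close>

lemma drop_coord_unit:
  assumes W: "coord_subspace n W" and e: "unit_fun i \<in> W"
  shows "drop_coord i W = drop_coord i (zeros_on W {i})"
proof
  show "drop_coord i (zeros_on W {i}) \<subseteq> drop_coord i W"
    unfolding drop_coord_def zeros_on_def by blast
  show "drop_coord i W \<subseteq> drop_coord i (zeros_on W {i})"
  proof
    fix x assume "x \<in> drop_coord i W"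
    then obtain u where u: "u \<in> W" "x = u \<circ> insert_index i" unfolding drop_coord_def by blast
    let ?u = "u - fscale (u i) (unit_fun i)"
    have "?u \<in> W"
      using W u e unfolding coord_subspace_def by (blast intro: cfun.subspace_diff
          cfun.subspace_scale)
    moreover have "?u i = 0" by (simp add: fscale_def unit_fun_def)
    moreover have "x = ?u \<circ> insert_index i"
    proof
      fix j
      have "insert_index i j \<noteq> i" by (simp add: insert_index_def)
      then show "x j = (?u \<circ> insert_index i) j" using u(2) by (simp add: fscale_def unit_fun_def)
    qed
    ultimately show "x \<in> drop_coord i (zeros_on W {i})"
      unfolding drop_coord_def zeros_on_def by blast
  qed
qed

lemma dim_zeros_on_unit:
  assumes W: "coord_subspace n W" and e: "unit_fun i \<in> W"
  shows "cfun.dim W = cfun.dim (zeros_on W {i}) + 1"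
  using column_rank_insert_unit[OF assms, of "{}"] column_rank_plus_dim[OF W, of "{i}"] by simp

lemma dim_drop_coord_unit:
  assumes W: "coord_subspace n W" and e: "unit_fun i \<in> W"
  shows "cfun.dim W = cfun.dim (drop_coord i W) + 1"
proof -
  have "\<forall>x\<in>zeros_on W {i}. x i = 0" unfolding zeros_on_def by simp
  then show ?thesis
    unfolding drop_coord_unit[OF assms]
    using dim_zeros_on_unit[OF assms] dim_drop_coord_vanishing[OF coord_subspace_zeros_on[OF W]]
        by simp
qed

lemma column_rank_drop_coord_unit:
  assumes W: "coord_subspace n W" and e: "unit_fun i \<in> W"
  shows "column_rank W (insert i (insert_index i ` S)) = column_rank (drop_coord i W) S + 1"
proof -
  let ?W0 = "zeros_on W {i}"
  have W0: "coord_subspace n ?W0" by (rule coord_subspace_zeros_on[OF W])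
  have van: "\<forall>x\<in>?W0. x i = 0" unfolding zeros_on_def by simp
  have "zeros_on ?W0 (insert_index i ` S) = zeros_on W (insert i (insert_index i ` S))"
    unfolding zeros_on_def by auto
  then show ?thesis
    unfolding drop_coord_unit[OF assms] column_rank_drop_coord_vanishing[OF W0 van]
    using column_rank_plus_dim[OF W0, of "insert_index i ` S"]
      column_rank_plus_dim[OF W, of "insert i (insert_index i
          ` S)"] dim_zeros_on_unit[OF assms] by simp
qed

lemma coord_subspace_lift_free:
  assumes W: "coord_subspace (n - 1) W"
  shows "coord_subspace n (lift_free n i W)"
proof -
  have sub: "cfun.subspace W" using W unfolding coord_subspace_def by simp
  have z: "(0 :: nat \<Rightarrow> complex) \<circ> insert_index i = 0" by (rule ext) simp
  have "cfun.subspace (lift_free n i W)"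
    unfolding lift_free_def
    by (rule cfun.subspaceI)
       (use cfun.subspace_0[OF sub] cfun.subspace_add[OF sub] cfun.subspace_scale[OF sub]
          cfun.subspace_0[OF subspace_coord_space] cfun.subspace_add[OF subspace_coord_space]
          cfun.subspace_scale[OF subspace_coord_space] z
        in \<open>simp_all only: mem_Collect_eq comp_insert_index_add comp_insert_index_scale simp_thms\<close>)
  then show ?thesis unfolding coord_subspace_def lift_free_def by blast
qed

lemma lift_zero_eq: "lift_zero n i W = zeros_on (lift_free n i W) {i}"
  unfolding lift_zero_def lift_free_def zeros_on_def by auto

lemma coord_subspace_lift_zero:
  "coord_subspace (n - 1) W \<Longrightarrow> coord_subspace n (lift_zero n i W)"
  unfolding lift_zero_eq by (intro coord_subspace_zeros_on coord_subspace_lift_free)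

lemma unit_fun_in_lift_free:
  assumes W: "coord_subspace (n - 1) W" and i: "i < n"
  shows "unit_fun i \<in> lift_free n i W"
proof -
  have "unit_fun i \<circ> insert_index i = 0"
    by (rule ext) (simp add: unit_fun_def insert_index_def)
  moreover have "0 \<in> W" using W cfun.subspace_0 unfolding coord_subspace_def by blast
  moreover have "unit_fun i \<in> coord_space n" using i unfolding coord_space_def unit_fun_def by simp
  ultimately show ?thesis unfolding lift_free_def by simp
qed

lemma drop_coord_lift_zero:
  assumes W: "coord_subspace (n - 1) W" and i: "i < n"
  shows "drop_coord i (lift_zero n i W) = W"
proof
  show "W \<subseteq> drop_coord i (lift_zero n i W)"
  proof
    fix x assume x: "x \<in> W"
    then have "x \<in> coord_space (n - 1)" using W unfolding coord_subspace_def by blast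
    then obtain y where y: "y \<in> coord_space n" "y i = 0" "y \<circ> insert_index i = x"
      using extend_by_zero[OF _ i] by blast
    then have "y \<in> lift_zero n i W" using x unfolding lift_zero_def by simp
    then show "x \<in> drop_coord i (lift_zero n i W)" using y(3) unfolding drop_coord_def by blast
  qed
qed (auto simp: drop_coord_def lift_zero_def)

lemma drop_coord_lift_free:
  assumes W: "coord_subspace (n - 1) W" and i: "i < n"
  shows "drop_coord i (lift_free n i W) = W"
  using drop_coord_lift_zero[OF assms] drop_coord_unit[OF coord_subspace_lift_free[OF W]
      unit_fun_in_lift_free[OF assms]]
  unfolding lift_zero_eq by simp

lemma lift_zero_drop_coord:
  assumes W: "coord_subspace n W" and van: "\<forall>x\<in>W. x i = 0"
  shows "lift_zero n i (drop_coord i W) = W"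
proof
  show "W \<subseteq> lift_zero n i (drop_coord i W)"
    using W van unfolding lift_zero_def drop_coord_def coord_subspace_def by auto
  show "lift_zero n i (drop_coord i W) \<subseteq> W"
  proof
    fix x assume "x \<in> lift_zero n i (drop_coord i W)"
    then obtain u where "u \<in> W" "x i = 0" "x \<circ> insert_index i = u \<circ> insert_index i"
      unfolding lift_zero_def drop_coord_def by blast
    then show "x \<in> W" using comp_insert_index_inj[of x i u] van by simp
  qed
qed

lemma lift_free_drop_coord:
  assumes W: "coord_subspace n W" and e: "unit_fun i \<in> W"
  shows "lift_free n i (drop_coord i W) = W"
proof
  show "W \<subseteq> lift_free n i (drop_coord i W)"
    using W unfolding lift_free_def drop_coord_def coord_subspace_def by auto
  show "lift_free n i (drop_coord i W) \<subseteq> W"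
  proof
    fix x assume "x \<in> lift_free n i (drop_coord i W)"
    then obtain u where u: "u \<in> W" "x \<circ> insert_index i = u \<circ> insert_index i"
      unfolding lift_free_def drop_coord_def by blast
    let ?v = "u + fscale (x i - u i) (unit_fun i)"
    have "x = ?v"
    proof (rule comp_insert_index_inj[of _ i])
      have "unit_fun i \<circ> insert_index i = 0"
        by (rule ext) (simp add: unit_fun_def insert_index_def)
      then show "x \<circ> insert_index i = ?v \<circ> insert_index i"
        unfolding comp_insert_index_add comp_insert_index_scale u(2) by (simp add:
            cfun.scale_zero_right)
      show "x i = ?v i" by (simp add: fscale_def unit_fun_def)
    qed
    moreover have "?v \<in> W"
      using W u e unfolding coord_subspace_def by (blast intro: cfun.subspace_add
          cfun.subspace_scale)
    ultimately show "x \<in> W" by simp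
  qed
qed

lemma skip_column:
  assumes n2: "2 \<le> n" and i: "i < n"
  shows "nat (skip n (int i) v mod int n) = insert_index i (nat (v mod int (n - 1)))"
proof -
  define N where "N = int n - 1"
  have N: "int (n - 1) = N" "0 < N" "int n = N + 1"
      "int i \<le> N" unfolding N_def using n2 i by simp_all
  define q s where "q = v div N" and "s = v mod N"
  have v: "v = q * N + s" unfolding q_def s_def by simp
  have s: "0 \<le> s" "s < N" unfolding s_def using N by simp_all
  have "(v - int i) div N = q + (s - int i) div N"
  proof -
    have eq: "v - int i = (s - int i) + q * N" using v by simp
    show ?thesis unfolding eq by (rule div_mult_self1) (use N in simp)
  qed
  moreover have "(s - int i) div N = (if s < int i then -1 else 0)"
  proof (cases "s < int i")
    case True
    have "(s - int i) div N = -1"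
      by (rule int_div_pos_eq[of _ _ _ "s - int i + N"]) (use True s N in auto)
    then show ?thesis using True by simp
  next
    case False
    then show ?thesis using s by (auto intro: div_pos_pos_trivial)
  qed
  ultimately have "skip n (int i) v = q * int n + (if s < int i then s else s + 1)"
    unfolding skip_def N_def[symmetric] using v N(3) by (simp add: distrib_left)
  moreover have "0 \<le> (if s < int i then s else s + 1)" "(if s < int i then s else s + 1) < int n"
    using s N by auto
  ultimately have "skip n (int i) v mod int n = (if s < int i then s else s + 1)" by simp
  then show ?thesis unfolding N(1) s_def[symmetric] insert_index_def using s
    by (auto simp: nat_less_iff nat_add_distrib)
qed

lemma cyclic_interval_skip:
  assumes n2: "2 \<le> n" and i: "i < n"
  shows "cyclic_interval n (skip n (int i) a) (skip n (int i) b) =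
    insert_index i ` cyclic_interval (n - 1) a b \<union>
    (if \<exists>u\<in>{skip n (int i) a..skip n (int i) b}. int n dvd u - int i then {i} else {})"
proof -
  let ?F = "\<lambda>t. nat (t mod int n)"
  have "?F ` skip n (int i) ` {a..b} = insert_index i ` cyclic_interval (n - 1) a b"
    unfolding cyclic_interval_def image_image skip_column[OF assms] ..
  moreover have Fi: "?F u = i" if u: "int n dvd u - int i" for u
  proof -
    obtain m where "u = int i + m * int n" using u by (rule dvd_diffE)
    then show ?thesis using mod_of_column[OF i] by simp
  qed
  have "?F ` {u \<in> {skip n (int i) a..skip n (int i) b}. int n dvd u - int i} =
      (if \<exists>u\<in>{skip n (int i) a..skip n (int i) b}. int n dvd u - int i then {i} else {})"
    using Fi by auto
  ultimately show ?thesis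
    unfolding cyclic_interval_def[of n] by (subst skip_interval[OF n2]) (simp add: image_Un)
qed

lemma not_in_insert_index: "i \<notin> insert_index i ` S"
  by (auto simp: insert_index_def split: if_splits)


lemma dots_loop:
  assumes bp: "bounded_periodic n f" and fi: "f i = i"
  shows "{u \<in> dots f a b. int n dvd u - i} = {u \<in> {a..b}. int n dvd u - i}"
proof -
  have "f u = u" if u: "int n dvd u - i" for u
  proof -
    obtain m where "u = i + m * int n" using u by (rule dvd_diffE)
    then show ?thesis using bounded_periodic_shift[OF bp, of i m] fi by simp
  qed
  then show ?thesis unfolding dots_def by auto
qed

lemma rank_bounded_skip_loop:
  assumes n2: "2 \<le> n" and i: "i < n" and bp: "bounded_periodic n f" and fi: "f (int i) = int i"
    and W: "coord_subspace n W" "\<forall>x\<in>W. x i = 0" and ab: "a \<le> b"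
  shows "rank_bounded n f W (skip n (int i) a) (skip n (int i) b) \<longleftrightarrow>
    rank_bounded (n - 1) (remove_column n (int i) f) (drop_coord i W) a b"
proof -
  let ?A = "skip n (int i) a" and ?B = "skip n (int i) b"
  have rank: "column_rank W (cyclic_interval n ?A ?B)
      = column_rank (drop_coord i W) (cyclic_interval (n - 1) a b)"
    unfolding cyclic_interval_skip[OF n2 i] column_rank_drop_coord_vanishing[OF W]
    using column_rank_insert_vanishing[OF W] by simp
  have "card (dots f ?A ?B) = card (dots (remove_column n (int i) f) a b) +
      card {u \<in> {?A..?B}. int n dvd u - int i}"
    unfolding dots_loop[OF bp fi, symmetric]
    by (rule card_dots_remove_column[OF n2 bp]) (simp add: fi)
  moreover have "?B - ?A + 1 = (b - a + 1) + int (card {u \<in> {?A..?B}. int n dvd u - int i})"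
    by (rule skip_interval_card[OF n2 ab])
  ultimately have "?B - ?A + 1 - int (card (dots f ?A ?B)) =
      b - a + 1 - int (card (dots (remove_column n (int i) f) a b))" by linarith
  with rank show ?thesis unfolding rank_bounded_def by (simp only:)
qed

text \<open>The interval contains at most one column of the removed residue class, because its ends avoid the class
and it has at most \<open>n + 1\<close> elements.  If there is one, both the rank and the length drop by one, and
otherwise neither changes;
points of the graph are not lost, since a point \<open>(u, u + n)\<close> does not fit into the interval.\<close>

lemma rank_bounded_skip_coloop:
  assumes n2: "2 \<le> n" and i: "i < n" and bp: "bounded_periodic n f" and fi: "f (int i)
      = int i + int n"
    and W: "coord_subspace n W" "unit_fun i \<in> W" and ab: "a \<le> b" "b \<le> a + int (n - 1)"
  shows "rank_bounded n f W (skip n (int i) a) (skip n (int i) b) \<longleftrightarrow>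
    rank_bounded (n - 1) (remove_column n (int i) f) (drop_coord i W) a b"
proof -
  let ?A = "skip n (int i) a" and ?B = "skip n (int i) b"
  let ?U = "{u \<in> {?A..?B}. int n dvd u - int i}"
  have n0: "0 < n" using i by simp
  have BA: "?B \<le> ?A + int n"
  proof -
    have "?B \<le> skip n (int i) (a + (int n - 1))" using ab n2 by (simp add: skip_le_iff[OF n2])
    then show ?thesis unfolding skip_period[OF n2] .
  qed
  have avoid: "\<not> int n dvd ?A - int i" by (rule skip_avoids[OF n2])
  have gap: "u' < u + int n" if u: "u \<in> ?U" and u': "u' \<le> ?B" for u u'
  proof -
    have "u \<noteq> ?A" using u avoid by auto
    then show ?thesis using u u' BA by simp
  qed
  have E: "{u \<in> dots f ?A ?B. int n dvd u - int i} = {}"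
  proof -
    have False if u: "u \<in> dots f ?A ?B" and d: "int n dvd u - int i" for u
    proof -
      obtain m where m: "u = int i + m * int n" using d by (rule dvd_diffE)
      have fu: "f u = u + int n" using bounded_periodic_shift[OF bp, of "int i" m] fi m by simp
      then have "u \<in> ?U" using u d unfolding dots_def by simp
      then show False using gap[of u "f u"] fu u unfolding dots_def by simp
    qed
    then show ?thesis by blast
  qed
  have "int n dvd f (int i) - int i" using fi by simp
  then have D: "card (dots f ?A ?B) = card (dots (remove_column n (int i) f) a b)"
    using card_dots_remove_column[OF n2 bp, of "int i" a b] unfolding E by simp
  have L: "?B - ?A + 1 = (b - a + 1) + int (card ?U)"
    by (rule skip_interval_card[OF n2 ab(1)])
  let ?T = "insert_index i ` cyclic_interval (n - 1) a b"
  have rT: "column_rank W (insert i ?T)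
      = column_rank (drop_coord i W) (cyclic_interval (n - 1) a b) + 1"
    by (rule column_rank_drop_coord_unit[OF W])
  have rT': "column_rank W (insert i ?T) = column_rank W ?T + 1"
    by (rule column_rank_insert_unit[OF W not_in_insert_index])
  show ?thesis
  proof (cases "\<exists>u\<in>{?A..?B}. int n dvd u - int i")
    case True
    then obtain u where u: "u \<in> ?U" by blast
    have "?U = {u}"
    proof -
      have "u' = u" if u': "u' \<in> ?U" for u'
      proof -
        have "int n dvd u' - u" using u u' dvd_diff[of "int n" "u' - int i" "u - int i"] by simp
        moreover have "u' - u < int n" "u - u' < int n"
          using gap[OF u, of u'] gap[OF u', of u] u u' by simp_all
        ultimately show ?thesis
          using zdvd_not_zless[of "u' - u" "int n"] zdvd_not_zless[of "u - u'" "int n"]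
          by (metis diff_gt_0_iff_gt dvd_diff_commute linorder_neqE)
      qed
      then show ?thesis using u by blast
    qed
    then have U: "card ?U = 1" by simp
    have cyc: "cyclic_interval n ?A ?B = insert i ?T"
      unfolding cyclic_interval_skip[OF n2 i] using True by simp
    have bnd: "?B - ?A + 1 - int (card (dots f ?A ?B)) =
        b - a + 1 - int (card (dots (remove_column n (int i) f) a b)) + 1"
      using D L U by linarith
    show ?thesis unfolding rank_bounded_def cyc bnd rT of_nat_add of_nat_1 by (rule
        add_le_cancel_right)
  next
    case False
    then have "?U = {}" by blast
    then have U: "card ?U = 0" by (simp only: card.empty)
    have cyc: "cyclic_interval n ?A ?B = ?T"
      unfolding cyclic_interval_skip[OF n2 i] using False by simp
    have bnd: "?B - ?A + 1 - int (card (dots f ?A ?B)) =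
        b - a + 1 - int (card (dots (remove_column n (int i) f) a b))"
      using D L U by linarith
    have rk: "column_rank W ?T = column_rank (drop_coord i W) (cyclic_interval (n - 1) a b)"
      using rT rT' by linarith
    show ?thesis unfolding rank_bounded_def cyc bnd rk ..
  qed
qed

text \<open>An interval that begins or ends with a removed column is treated by cutting this column off
(\<open>left\<close>, \<open>right\<close>); all others are images of intervals under the enumeration.\<close>

lemma rank_bounded_trim:
  assumes n2: "2 \<le> n" and i: "i < n"
    and empty: "\<And>a. rank_bounded n f W a (a - 1)"
    and left: "\<And>a b. int n dvd a - int i \<Longrightarrow> a \<le> b \<Longrightarrow> b \<le> a + int n \<Longrightarrow>
      rank_bounded n f W (a + 1) b \<Longrightarrow> rank_bounded n f W a b"
    and right: "\<And>a b. int n dvd b - int i \<Longrightarrow> a \<le> b \<Longrightarrow> b < a + int n \<Longrightarrow>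
      rank_bounded n f W a (b - 1) \<Longrightarrow> rank_bounded n f W a b"
    and skip: "\<And>a b. a \<le> b \<Longrightarrow> b \<le> a + int (n - 1) \<Longrightarrow>
      rank_bounded n f W (skip n (int i) a) (skip n (int i) b)"
    and ab: "a \<le> b" "b \<le> a + int n"
  shows "rank_bounded n f W a b"
proof -
  have step: "\<not> int n dvd (u + 1) - int i" if u: "int n dvd u - int i" for u
  proof
    assume "int n dvd (u + 1) - int i"
    then have "int n dvd ((u + 1) - int i) - (u - int i)" using u by (rule dvd_diff)
    then show False using n2 by simp
  qed
  have inner: "rank_bounded n f W a b"
    if na: "\<not> int n dvd a - int i" and nb: "\<not> int n dvd b - int i" and le: "a \<le> b"
        "b \<le> a + int n" for a b
  proof -
    obtain a' where a': "skip n (int i) a' = a" using na by (rule skip_surj[OF n2])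
    obtain b' where b': "skip n (int i) b' = b" using nb by (rule skip_surj[OF n2])
    have "a' \<le> b'" using le(1) skip_le_iff[OF n2, of "int i" a' b'] unfolding a' b' by simp
    moreover have "skip n (int i) b' \<le> skip n (int i) (a' + (int n - 1))"
      unfolding skip_period[OF n2] a' b' by (rule le(2))
    then have "b' \<le> a' + int (n - 1)" using n2 by (simp add: skip_le_iff[OF n2])
    ultimately show ?thesis using skip[of a' b'] a' b' by simp
  qed
  have half: "rank_bounded n f W a b"
    if "\<not> int n dvd a - int i" "a \<le> b + 1" "b \<le> a + int n" for a b
  proof (cases "a \<le> b")
    case True
    show ?thesis
    proof (cases "int n dvd b - int i")
      case False
      then show ?thesis using inner that True by blast
    next
      case dvd: True
      have b1: "\<not> int n dvd (b - 1) - int i" using step[of "b - 1"] dvd by auto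
      have "b \<noteq> a + int n"
      proof
        assume "b = a + int n"
        then have "int n dvd ((a - int i) + int n)" using dvd by (simp add: algebra_simps)
        then show False using that(1) by simp
      qed
      then have lt: "b < a + int n" using that(3) by simp
      have "rank_bounded n f W a (b - 1)"
      proof (cases "a = b")
        case True
        then show ?thesis using empty[of a] by simp
      next
        case False
        then show ?thesis using inner[OF that(1) b1] True lt by simp
      qed
      then show ?thesis by (rule right[OF dvd True lt])
    qed
  next
    case False
    then have "b = a - 1" using that(2) by simp
    then show ?thesis using empty by simp
  qed
  show ?thesis
  proof (cases "int n dvd a - int i")
    case True
    show ?thesis
      by (rule left[OF True ab], rule half[OF step[OF True]]) (use ab in simp_all)
  next
    case False
    then show ?thesis using half ab by simp
  qed
qed

lemma rank_bounded_all_iff: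
  assumes n2: "2 \<le> n" and i: "i < n"
    and empty: "\<And>a. rank_bounded n f W a (a - 1)"
    and left: "\<And>a b. int n dvd a - int i \<Longrightarrow> a \<le> b \<Longrightarrow> b \<le> a + int n \<Longrightarrow>
      rank_bounded n f W (a + 1) b \<Longrightarrow> rank_bounded n f W a b"
    and right: "\<And>a b. int n dvd b - int i \<Longrightarrow> a \<le> b \<Longrightarrow> b < a + int n \<Longrightarrow>
      rank_bounded n f W a (b - 1) \<Longrightarrow> rank_bounded n f W a b"
    and skip: "\<And>a b. a \<le> b \<Longrightarrow> b \<le> a + int (n - 1) \<Longrightarrow>
      rank_bounded n f W (skip n (int i) a) (skip n (int i) b) \<longleftrightarrow> rank_bounded (n - 1) g V a b"
  shows "(\<forall>a b. a \<le> b \<longrightarrow> b \<le> a + int n \<longrightarrow> rank_bounded n f W a b) \<longleftrightarrow>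
    (\<forall>a b. a \<le> b \<longrightarrow> b \<le> a + int (n - 1) \<longrightarrow> rank_bounded (n - 1) g V a b)" (is "?l \<longleftrightarrow> ?r")
proof
  assume l: ?l
  show ?r
  proof (intro allI impI)
    fix a b :: int assume ab: "a \<le> b" "b \<le> a + int (n - 1)"
    have "skip n (int i) b \<le> skip n (int i) (a + (int n - 1))" using ab n2 by (simp add:
        skip_le_iff[OF n2])
    then have "skip n (int i) b \<le> skip n (int i) a + int n" unfolding skip_period[OF n2] .
    moreover have "skip n (int i) a \<le> skip n (int i) b" using ab(1) by (simp add: skip_le_iff[OF
        n2])
    ultimately have "rank_bounded n f W (skip n (int i) a) (skip n (int i) b)" using l by blast
    then show "rank_bounded (n - 1) g V a b" using skip ab by blast
  qed
next
  assume r: ?r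
  show ?l
  proof (intro allI impI)
    fix a b :: int assume ab: "a \<le> b" "b \<le> a + int n"
    show "rank_bounded n f W a b"
    proof (rule rank_bounded_trim[OF n2 i empty _ _ _ ab])
      show "rank_bounded n f W (skip n (int i) a) (skip n (int i) b)"
        if "a \<le> b" "b \<le> a + int (n - 1)" for a b
        using r skip that by blast
    qed (fact left, fact right)
  qed
qed

lemma column_of_dvd:
  assumes i: "i < n" and u: "int n dvd u - int i"
  shows "nat (u mod int n) = i"
proof -
  obtain m where "u = int i + m * int n" using u by (rule dvd_diffE)
  then show ?thesis using mod_of_column[OF i] by simp
qed

lemma cyclic_interval_left:
  assumes "i < n" "int n dvd a - int i" "a \<le> b"
  shows "cyclic_interval n a b = insert i (cyclic_interval n (a + 1) b)"
  using cyclic_interval_split[of a a b n] column_of_dvd[OF assms(1,2)] assms(3)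
  by (simp add: cyclic_interval_empty)

lemma cyclic_interval_right:
  assumes "i < n" "int n dvd b - int i" "a \<le> b"
  shows "cyclic_interval n a b = insert i (cyclic_interval n a (b - 1))"
  using cyclic_interval_split[of a b b n] column_of_dvd[OF assms(1,2)] assms(3)
  by (simp add: cyclic_interval_empty)

lemma positroid_remove_loop:
  assumes n2: "2 \<le> n" and i: "i < n" and bp: "bounded_periodic n f" and fi: "f (int i) = int i"
    and W: "coord_subspace n W" "\<forall>x\<in>W. x i = 0"
  shows "W \<in> positroid_subspaces k n f \<longleftrightarrow>
    drop_coord i W \<in> positroid_subspaces k (n - 1) (remove_column n (int i) f)"
proof -
  have fu: "f u = u" if u: "int n dvd u - int i" for u
  proof -
    obtain m where "u = int i + m * int n" using u by (rule dvd_diffE)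
    then show ?thesis using bounded_periodic_shift[OF bp, of "int i" m] fi by simp
  qed
  have bij: "bij f" and bd: "\<And>u. u \<le> f u" using bp unfolding bounded_periodic_def by auto
  have skip: "rank_bounded n f W (skip n (int i) a) (skip n (int i) b) \<longleftrightarrow>
      rank_bounded (n - 1) (remove_column n (int i) f) (drop_coord i W) a b" if "a \<le> b" for a b
    by (rule rank_bounded_skip_loop[OF n2 i bp fi W that])
  have "(\<forall>a b. a \<le> b \<longrightarrow> b \<le> a + int n \<longrightarrow> rank_bounded n f W a b) \<longleftrightarrow>
    (\<forall>a b. a \<le> b \<longrightarrow> b \<le> a + int (n - 1) \<longrightarrow>
       rank_bounded (n - 1) (remove_column n (int i) f) (drop_coord i W) a b)"
  proof (rule rank_bounded_all_iff[OF n2 i rank_bounded_empty[OF bp] _ _ skip])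
    show "rank_bounded n f W a b"
      if d: "int n dvd a - int i" and ab: "a \<le> b" "b \<le> a + int n"
        and IH: "rank_bounded n f W (a + 1) b" for a b
    proof -
      have "dots f a b = insert a (dots f (a + 1) b)" using fu[OF d] ab unfolding dots_def by auto
      moreover have "a \<notin> dots f (a + 1) b" unfolding dots_def by simp
      ultimately have "card (dots f a b)
          = Suc (card (dots f (a + 1) b))" using finite_dots[OF bp] by simp
      then show ?thesis
        using IH column_rank_insert_vanishing[OF W]
        unfolding rank_bounded_def cyclic_interval_left[OF i d ab(1)] by simp
    qed
    show "rank_bounded n f W a b"
      if d: "int n dvd b - int i" and ab: "a \<le> b" "b < a + int n"
        and IH: "rank_bounded n f W a (b - 1)" for a b
    proof -
      have inv: "f u = b \<Longrightarrow> u = b" for u using fu[OF d] bij by (metis bij_is_inj injD)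
      have "dots f a b = insert b (dots f a (b - 1))"
      proof (rule Set.set_eqI)
        fix u show "u \<in> dots f a b \<longleftrightarrow> u \<in> insert b (dots f a (b - 1))"
        proof (cases "u = b")
          case False
          then have "f u \<noteq> b" using inv by blast
          then show ?thesis using False unfolding dots_def by auto
        qed (use fu[OF d] ab in \<open>simp add: dots_def\<close>)
      qed
      moreover have "b \<notin> dots f a (b - 1)" using fu[OF d] unfolding dots_def by simp
      ultimately have "card (dots f a b)
          = Suc (card (dots f a (b - 1)))" using finite_dots[OF bp] by simp
      then show ?thesis
        using IH column_rank_insert_vanishing[OF W]
        unfolding rank_bounded_def cyclic_interval_right[OF i d ab(1)] by simp
    qed
  qed
  then show ?thesis
    unfolding mem_positroid_subspaces
    using W dim_drop_coord_vanishing[OF W] coord_subspace_drop_coord[OF W(1) i] by simp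
qed


text \<open>Cutting a column \<open>i\<close> off an interval lowers the rank by at most one and the count not at all, except
for intervals with \<open>n + 1\<close> elements and both ends congruent to \<open>i\<close>.  For these the bound is \<open>k\<close>, which
is no condition.\<close>

lemma positroid_remove_coloop:
  assumes n2: "2 \<le> n" and i: "i < n" and f: "bounded_affine_permutation k n f" and fi: "f (int i)
      = int i + int n"
    and W: "coord_subspace n W" "unit_fun i \<in> W"
  shows "W \<in> positroid_subspaces k n f \<longleftrightarrow>
    drop_coord i W \<in> positroid_subspaces (k - 1) (n - 1) (remove_column n (int i) f)"
proof -
  have bp: "bounded_periodic n f" using f affine_permutation_iff_window_count by blast
  have fu: "f u = u + int n" if u: "int n dvd u - int i" for u
  proof -
    obtain m where "u = int i + m * int n" using u by (rule dvd_diffE)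
    then show ?thesis using bounded_periodic_shift[OF bp, of "int i" m] fi by simp
  qed
  have bij: "bij f" and bd: "\<And>u. u \<le> f u" using bp unfolding bounded_periodic_def by auto
  have k0: "0 < k" by (rule affine_permutation_remove_coloop(2)[OF n2 f fi])
  have skip: "rank_bounded n f W (skip n (int i) a) (skip n (int i) b) \<longleftrightarrow>
      rank_bounded (n - 1) (remove_column n (int i) f) (drop_coord i W) a b"
      if "a \<le> b" "b \<le> a + int (n - 1)" for a b
    by (rule rank_bounded_skip_coloop[OF n2 i bp fi W that])
  have insert_le: "column_rank W (insert i S) \<le> column_rank W S + 1" for S
    using column_rank_insert[OF W(1), of i S] by simp
  have "(\<forall>a b. a \<le> b \<longrightarrow> b \<le> a + int n \<longrightarrow> rank_bounded n f W a b) \<longleftrightarrow>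
    (\<forall>a b. a \<le> b \<longrightarrow> b \<le> a + int (n - 1) \<longrightarrow>
       rank_bounded (n - 1) (remove_column n (int i) f) (drop_coord i W) a b)"
    if dW: "cfun.dim W = k"
  proof (rule rank_bounded_all_iff[OF n2 i rank_bounded_empty[OF bp] _ _ skip])
    show "rank_bounded n f W a b"
      if d: "int n dvd a - int i" and ab: "a \<le> b" "b \<le> a + int n"
        and IH: "rank_bounded n f W (a + 1) b" for a b
    proof (cases "b < a + int n")
      case True
      have "dots f a b = dots f (a + 1) b"
      proof (rule Set.set_eqI)
        fix u show "u \<in> dots f a b \<longleftrightarrow> u \<in> dots f (a + 1) b"
          using fu[OF d] True unfolding dots_def by (cases "u = a") auto
      qed
      then show ?thesis
        using IH insert_le[of "cyclic_interval n (a + 1) b"]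
        unfolding rank_bounded_def cyclic_interval_left[OF i d ab(1)] by simp
    next
      case False
      then have b: "b = a + int n" using ab by simp
      have "dots f a b = insert a (dots f (a + 1) b)" using fu[OF d] unfolding b dots_def by auto
      moreover have "a \<notin> dots f (a + 1) b" unfolding dots_def by simp
      ultimately have "card (dots f a b) = Suc (card (dots f (a + 1) (a + 1 + int n - 1)))"
        using finite_dots[OF bp] unfolding b by simp
      moreover have "int (card (dots f (a + 1) (a + 1 + int n - 1))) = int n - int k"
        using f affine_permutation_iff_window_count by blast
      ultimately show ?thesis
        unfolding rank_bounded_def b using
            column_rank_le_dim[of W "cyclic_interval n a (a + int n)"] dW by simp
    qed
    show "rank_bounded n f W a b"
      if d: "int n dvd b - int i" and ab: "a \<le> b" "b < a + int n"
        and IH: "rank_bounded n f W a (b - 1)" for a b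
    proof -
      have d': "int n dvd (b - int n) - int i"
      proof -
        have "int n dvd (b - int i) - int n" using d by (rule dvd_diff) simp
        then show ?thesis by (simp add: algebra_simps)
      qed
      have inv: "f u = b \<Longrightarrow> u = b - int n" for u
        using injD[OF bij_is_inj[OF bij], of u "b - int n"] fu[OF d'] by simp
      have "dots f a b = dots f a (b - 1)"
      proof (rule Set.set_eqI)
        fix u
        have "f u \<noteq> b" if "a \<le> u" using inv[of u] that ab by auto
        then show "u \<in> dots f a b \<longleftrightarrow> u \<in> dots f a (b - 1)" unfolding dots_def by auto
      qed
      then show ?thesis
        using IH insert_le[of "cyclic_interval n a (b - 1)"]
        unfolding rank_bounded_def cyclic_interval_right[OF i d ab(1)] by simp
    qed
  qed
  moreover have "cfun.dim W = k \<longleftrightarrow> cfun.dim (drop_coord i W) = k - 1"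
    using dim_drop_coord_unit[OF W] k0 by linarith
  ultimately show ?thesis
    unfolding mem_positroid_subspaces
    using W coord_subspace_drop_coord[OF W(1) i] by blast
qed

lemma drop_coord_image_positroid:
  assumes "\<And>W. coord_subspace n W \<Longrightarrow> Q W \<Longrightarrow>
      W \<in> positroid_subspaces k n h \<longleftrightarrow> drop_coord i W \<in> positroid_subspaces k' (n - 1) g"
    and lift: "\<And>V. coord_subspace (n - 1) V \<Longrightarrow>
      coord_subspace n (lift V) \<and> Q (lift V) \<and> drop_coord i (lift V) = V"
  shows "drop_coord i ` {W \<in> positroid_subspaces k n h. Q W} = positroid_subspaces k' (n - 1) g"
proof
  show "drop_coord i ` {W \<in> positroid_subspaces k n h. Q W} \<subseteq> positroid_subspaces k' (n - 1) g"
  proof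
    fix V assume "V \<in> drop_coord i ` {W \<in> positroid_subspaces k n h. Q W}"
    then obtain W where W: "W \<in> positroid_subspaces k n h" "Q W" "V = drop_coord i W" by blast
    then have "coord_subspace n W" unfolding mem_positroid_subspaces by blast
    then show "V \<in> positroid_subspaces k' (n - 1) g" using assms(1)[of W] W by simp
  qed
  show "positroid_subspaces k' (n - 1) g \<subseteq> drop_coord i ` {W \<in> positroid_subspaces k n h. Q W}"
  proof
    fix V assume V: "V \<in> positroid_subspaces k' (n - 1) g"
    then have "coord_subspace (n - 1) V" unfolding mem_positroid_subspaces by blast
    from lift[OF this] have W: "coord_subspace n (lift V)" "Q (lift V)"
        "drop_coord i (lift V) = V" by auto
    then have "lift V \<in> positroid_subspaces k n h" using assms(1)[OF W(1,2)] V by simp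
    then show "V \<in> drop_coord i ` {W \<in> positroid_subspaces k n h. Q W}"
      using W by (intro image_eqI[of _ _ "lift V"]) simp_all
  qed
qed

lemma deletion_of_positroid_subspaces:
  assumes n2: "2 \<le> n" and i: "i < n" and f: "bounded_affine_permutation k n f"
    and ex: "\<exists>W\<in>positroid_subspaces k n f. \<forall>x\<in>W. x i = 0"
  shows "\<exists>g. bounded_affine_permutation k (n - 1) g \<and>
    drop_coord i ` {W \<in> positroid_subspaces k n f. \<forall>x\<in>W. x i = 0} = positroid_subspaces k (n - 1) g"
proof -
  have "f (int i) \<noteq> int i + int n" using not_coloop_if_vanishing[OF f i] ex by blast
  then obtain h where h: "bounded_affine_permutation k n h" "h (int i) = int i" and eq:
    "{W \<in> positroid_subspaces k n f. \<forall>x\<in>W. x i = 0} = {W \<in> positroid_subspaces k n h. \<forall>x\<in>W. x i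
        = 0}"
    using loop_at_deleted_column[OF f i] by blast
  have bp: "bounded_periodic n h" using h affine_permutation_iff_window_count by blast
  have "drop_coord i ` {W \<in> positroid_subspaces k n h. \<forall>x\<in>W. x i = 0} =
      positroid_subspaces k (n - 1) (remove_column n (int i) h)"
  proof (rule drop_coord_image_positroid[where lift = "lift_zero n i"])
    show "coord_subspace n (lift_zero n i V) \<and> (\<forall>x\<in>lift_zero n i V. x i = 0) \<and>
        drop_coord i (lift_zero n i V) = V" if "coord_subspace (n - 1) V" for V
      using coord_subspace_lift_zero[OF that] drop_coord_lift_zero[OF that i] by (simp add:
          lift_zero_def)
  qed (rule positroid_remove_loop[OF n2 i bp h(2)])
  then show ?thesis using affine_permutation_remove_loop[OF n2 h] unfolding eq by blast
qed

lemma contraction_of_positroid_subspaces: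
  assumes n2: "2 \<le> n" and i: "i < n" and f: "bounded_affine_permutation k n f"
    and ex: "\<exists>W\<in>positroid_subspaces k n f. unit_fun i \<in> W"
  shows "\<exists>g. bounded_affine_permutation (k - 1) (n - 1) g \<and>
    drop_coord i ` {W \<in> positroid_subspaces k n f. unit_fun i \<in> W} =
        positroid_subspaces (k - 1) (n - 1) g"
proof -
  have "f (int i) \<noteq> int i" using not_loop_if_unit[OF f i] ex by blast
  then obtain h where h: "bounded_affine_permutation k n h" "h (int i) = int i + int n" and eq:
    "{W \<in> positroid_subspaces k n f. unit_fun i \<in> W}
        = {W \<in> positroid_subspaces k n h. unit_fun i \<in> W}"
    using coloop_at_contracted_column[OF f i] by blast
  have "drop_coord i ` {W \<in> positroid_subspaces k n h. unit_fun i \<in> W} =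
      positroid_subspaces (k - 1) (n - 1) (remove_column n (int i) h)"
  proof (rule drop_coord_image_positroid[where lift = "lift_free n i"])
    show "coord_subspace n (lift_free n i V) \<and> unit_fun i \<in> lift_free n i V \<and>
        drop_coord i (lift_free n i V) = V" if "coord_subspace (n - 1) V" for V
      using coord_subspace_lift_free[OF that] unit_fun_in_lift_free[OF that i]
        drop_coord_lift_free[OF that i] by blast
  qed (rule positroid_remove_coloop[OF n2 i h])
  then show ?thesis using affine_permutation_remove_coloop(1)[OF n2 h] unfolding eq by blast
qed

section \<open>Smoothness of coordinate retracts\<close>

lemma polynomial_functions_cmult:
  assumes "p \<in> polynomial_functions I"
  shows "(\<lambda>z. c * p z) \<in> polynomial_functions I"
  using polynomial_functions.mult[OF polynomial_functions.const[of c] assms] .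

lemma polynomial_functions_diff:
  assumes "p \<in> polynomial_functions I" "q \<in> polynomial_functions I"
  shows "(\<lambda>z. p z - q z) \<in> polynomial_functions I"
  using polynomial_functions.add[OF assms(1) polynomial_functions_cmult[OF assms(2), of "-1"]] by
      simp

lemma polynomial_functions_sum:
  assumes "\<And>a. a \<in> A \<Longrightarrow> p a \<in> polynomial_functions I"
  shows "(\<lambda>z. \<Sum>a\<in>A. p a z) \<in> polynomial_functions I"
  using assms
proof (induction A rule: infinite_finite_induct)
  case (insert a A)
  then show ?case by (simp add: polynomial_functions.add)
qed (simp_all add: polynomial_functions.const)

lemma polynomial_functions_compose:
  assumes "p \<in> polynomial_functions I"
    and "\<And>i. i \<in> I \<Longrightarrow> (\<lambda>w. s w i) \<in> polynomial_functions J"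
  shows "(\<lambda>w. p (s w)) \<in> polynomial_functions J"
  using assms(1)
  by induction (auto intro: polynomial_functions.intros assms(2))

lemma polynomial_functions_differentiable:
  assumes "p \<in> polynomial_functions I"
  shows "(\<lambda>t. p (z(i := t))) field_differentiable at x"
  using assms
proof induction
  case (coord j)
  then show ?case by (cases "i = j") (simp_all add: field_differentiable_ident)
qed (auto intro: field_differentiable_add field_differentiable_mult)

text \<open>The product rule at a common zero of the functions \<open>g a\<close>.\<close>

lemma partial_deriv_sum_mult:
  assumes "\<And>a. a \<in> A \<Longrightarrow> r a \<in> polynomial_functions I" "\<And>a. a \<in> A \<Longrightarrow> g a \<in> polynomial_functions I"
    and "\<And>a. a \<in> A \<Longrightarrow> g a z = 0" "finite A"
  shows "partial_deriv i (\<lambda>w. \<Sum>a\<in>A. r a w * g a w) z = (\<Sum>a\<in>A. r a z * partial_deriv i (g a) z)"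
proof -
  have "((\<lambda>t. \<Sum>a\<in>A. r a (z(i := t)) * g a (z(i := t))) has_field_derivative
      (\<Sum>a\<in>A. r a z * partial_deriv i (g a) z)) (at (z i))"
  proof (rule DERIV_sum)
    fix a assume a: "a \<in> A"
    have "((\<lambda>t. r a (z(i := t))) has_field_derivative partial_deriv i (r a) z) (at (z i))"
      "((\<lambda>t. g a (z(i := t))) has_field_derivative partial_deriv i (g a) z) (at (z i))"
      using polynomial_functions_differentiable[OF assms(1)[OF a]]
        polynomial_functions_differentiable[OF assms(2)[OF a]]
      unfolding partial_deriv_def by (simp_all add: DERIV_deriv_iff_field_differentiable)
    from DERIV_mult[OF this] show "((\<lambda>t. r a (z(i := t)) * g a (z(i := t))) has_field_derivative
      r a z * partial_deriv i (g a) z) (at (z i))"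
      using assms(3)[OF a] by (simp add: mult.commute)
  qed
  then show ?thesis unfolding partial_deriv_def by (rule DERIV_imp_deriv)
qed

lemma partial_deriv_lincomb:
  assumes "\<And>a. a \<in> A \<Longrightarrow> g a \<in> polynomial_functions I" "finite A"
  shows "partial_deriv i (\<lambda>w. \<Sum>a\<in>A. u a * g a w) z = (\<Sum>a\<in>A. u a * partial_deriv i (g a) z)"
proof -
  have "((\<lambda>t. \<Sum>a\<in>A. u a * g a (z(i := t))) has_field_derivative
      (\<Sum>a\<in>A. u a * partial_deriv i (g a) z)) (at (z i))"
  proof (rule DERIV_sum)
    fix a assume a: "a \<in> A"
    have "((\<lambda>t. g a (z(i := t))) has_field_derivative partial_deriv i (g a) z) (at (z i))"
      using polynomial_functions_differentiable[OF assms(1)[OF a]]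
      unfolding partial_deriv_def by (simp add: DERIV_deriv_iff_field_differentiable)
    from DERIV_cmult[OF this] show "((\<lambda>t. u a * g a (z(i := t))) has_field_derivative
      u a * partial_deriv i (g a) z) (at (z i))" .
  qed
  then show ?thesis unfolding partial_deriv_def by (rule DERIV_imp_deriv)
qed

text \<open>Membership in the ideal generated by \<open>g\<close> in the local ring at \<open>z0\<close>, with denominator \<open>h\<close>.\<close>

definition locally_generated where
  "locally_generated I z0 A g q \<longleftrightarrow> (\<exists>h r. h \<in> polynomial_functions I \<and> h z0 \<noteq> 0 \<and>
     (\<forall>a\<in>A. r a \<in> polynomial_functions I) \<and> (\<forall>w. h w * q w = (\<Sum>a\<in>A. r a w * g a w)))"

text \<open>Membership in the product of that ideal with the maximal ideal at \<open>z0\<close>.\<close>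

definition locally_generated_max where
  "locally_generated_max I z0 A g q \<longleftrightarrow> (\<exists>h r. h \<in> polynomial_functions I \<and> h z0 \<noteq> 0 \<and>
     (\<forall>a\<in>A. r a \<in> polynomial_functions I \<and> r a z0 = 0) \<and>
     (\<forall>w. h w * q w = (\<Sum>a\<in>A. r a w * g a w)))"

text \<open>Nakayama's lemma for one generator.  In the relation, \<open>g b\<close> has the coefficient \<open>u b * h - r b\<close>, which is
a unit at \<open>z0\<close> because \<open>r b\<close> vanishes there.\<close>

lemma drop_dependent_generator:
  fixes g :: "nat \<Rightarrow> ('i \<Rightarrow> complex) \<Rightarrow> complex"
  assumes fin: "finite A" and b: "b \<in> A" and ub: "u b \<noteq> 0"
    and rel: "locally_generated_max I z0 A g (\<lambda>w. \<Sum>a\<in>A. u a * g a w)"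
  obtains e s where "e \<in> polynomial_functions I" "e z0 \<noteq> 0"
    "\<And>a. a \<in> A - {b} \<Longrightarrow> s a \<in> polynomial_functions I"
    "\<And>w. e w * g b w = (\<Sum>a\<in>A - {b}. s a w * g a w)"
proof -
  obtain h r where h: "h \<in> polynomial_functions I" "h z0 \<noteq> 0"
    and r: "\<And>a. a \<in> A \<Longrightarrow> r a \<in> polynomial_functions I" "\<And>a. a \<in> A \<Longrightarrow> r a z0 = 0"
    and eq: "\<And>w. h w * (\<Sum>a\<in>A. u a * g a w) = (\<Sum>a\<in>A. r a w * g a w)"
    using rel unfolding locally_generated_max_def by blast
  show ?thesis
  proof (rule that[of "\<lambda>w. u b * h w - r b w" "\<lambda>a w. r a w - u a * h w"])
    show "(\<lambda>w. u b * h w - r b w) \<in> polynomial_functions I"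
      by (intro polynomial_functions_diff polynomial_functions_cmult h r b)
    show "u b * h z0 - r b z0 \<noteq> 0" using h ub r b by simp
    show "(\<lambda>w. r a w - u a * h w) \<in> polynomial_functions I" if "a \<in> A - {b}" for a
      using that by (intro polynomial_functions_diff polynomial_functions_cmult h r) auto
    show "(u b * h w - r b w) * g b w = (\<Sum>a\<in>A - {b}. (r a w - u a * h w) * g a w)" for w
    proof -
      have "(\<Sum>a\<in>A. (r a w - u a * h w) * g a w) = (\<Sum>a\<in>A. r a w * g a w) - h w * (\<Sum>a\<in>A. u a * g a w)"
        by (simp add: sum_distrib_left sum_subtractf[symmetric] algebra_simps)
      also have "\<dots> = 0" using eq by simp
      finally have "(\<Sum>a\<in>A. (r a w - u a * h w) * g a w) = 0" .
      then show ?thesis using sum.remove[OF fin b, of "\<lambda>a. (r a w - u a * h w) * g a w"]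
        by (simp add: algebra_simps)
    qed
  qed
qed

lemma substitute_generator:
  fixes g :: "nat \<Rightarrow> ('i \<Rightarrow> complex) \<Rightarrow> complex"
  assumes fin: "finite A" and b: "b \<in> A"
    and "\<And>w. e w * g b w = (\<Sum>a\<in>A - {b}. s a w * g a w)"
    and "\<And>w. h w * q w = (\<Sum>a\<in>A. r a w * g a w)"
  shows "e w * h w * q w = (\<Sum>a\<in>A - {b}. (e w * r a w + r b w * s a w) * g a w)"
proof -
  have "e w * h w * q w = e w * (r b w * g b w + (\<Sum>a\<in>A - {b}. r a w * g a w))"
    using assms(4) sum.remove[OF fin b, of "\<lambda>a. r a w * g a w"] by (simp add: mult.assoc)
  also have "\<dots> = r b w * (\<Sum>a\<in>A - {b}. s a w * g a w) + e w * (\<Sum>a\<in>A - {b}. r a w * g a w)"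
    using assms(3)[symmetric] by (simp add: algebra_simps)
  also have "\<dots> = (\<Sum>a\<in>A - {b}. (e w * r a w + r b w * s a w) * g a w)"
    unfolding sum_distrib_left sum.distrib[symmetric] by (rule sum.cong) (simp_all add:
        algebra_simps)
  finally show ?thesis .
qed

text \<open>If the differentials of the generators are dependent, the corresponding combination of generators has
vanishing differential, so it lies in the maximal ideal times the ideal, and one generator can be
dropped.  Both hypotheses survive this, so by induction the remaining generators become independent.\<close>

lemma smooth_point_if_generators:
  fixes g :: "nat \<Rightarrow> ('i \<Rightarrow> complex) \<Rightarrow> complex"
  assumes "finite A" and "\<And>a. a \<in> A \<Longrightarrow> g a \<in> vanishing_ideal I S"
    and "\<And>q. q \<in> vanishing_ideal I S \<Longrightarrow> locally_generated I z0 A g q"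
    and "\<And>q. q \<in> vanishing_ideal I S \<Longrightarrow> (\<And>i. i \<in> I \<Longrightarrow> partial_deriv i q z0 = 0) \<Longrightarrow>
      locally_generated_max I z0 A g q"
  shows "smooth_point I S z0"
  using assms
proof (induction "card A" arbitrary: A rule: less_induct)
  case less
  note fin = less.prems(1) and gS = less.prems(2) and gen = less.prems(3) and genm = less.prems(4)
  have gp: "g a \<in> polynomial_functions I" if "a \<in> A" for a
    using gS[OF that] unfolding vanishing_ideal_def by simp
  show ?case
  proof (cases "\<exists>u. (\<forall>i\<in>I. (\<Sum>a\<in>A. u a * partial_deriv i (g a) z0) = 0) \<and> (\<exists>b\<in>A. u b \<noteq> 0)")
    case True
    then obtain u b where u: "\<And>i. i \<in> I \<Longrightarrow> (\<Sum>a\<in>A. u a * partial_deriv i (g a) z0) = 0"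
      and b: "b \<in> A" "u b \<noteq> 0" by blast
    have "(\<lambda>w. \<Sum>a\<in>A. u a * g a w) \<in> vanishing_ideal I S"
      using gS unfolding vanishing_ideal_def
      by (auto intro!: polynomial_functions_sum polynomial_functions_cmult)
    moreover have "partial_deriv i (\<lambda>w. \<Sum>a\<in>A. u a * g a w) z0 = 0" if "i \<in> I" for i
      using partial_deriv_lincomb[OF gp fin] u[OF that] by simp
    ultimately have "locally_generated_max I z0 A g (\<lambda>w. \<Sum>a\<in>A. u a * g a w)" by (rule genm)
    from drop_dependent_generator[OF fin b(1) b(2) this]
    obtain e s where e: "e \<in> polynomial_functions I" "e z0 \<noteq> 0"
      and s: "\<And>a. a \<in> A - {b} \<Longrightarrow> s a \<in> polynomial_functions I"
      and es: "\<And>w. e w * g b w = (\<Sum>a\<in>A - {b}. s a w * g a w)" by metis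
    show ?thesis
    proof (rule less.hyps[of "A - {b}"])
      show "card (A - {b}) < card A" using fin b(1) by (rule card_Diff1_less)
      show "finite (A - {b})" using fin by simp
      show "g a \<in> vanishing_ideal I S" if "a \<in> A - {b}" for a using gS that by simp
      show "locally_generated I z0 (A - {b}) g q" if q: "q \<in> vanishing_ideal I S" for q
      proof -
        obtain h r where h: "h \<in> polynomial_functions I" "h z0 \<noteq> 0"
          and r: "\<And>a. a \<in> A \<Longrightarrow> r a \<in> polynomial_functions I"
          and eq: "\<And>w. h w * q w = (\<Sum>a\<in>A. r a w * g a w)"
          using gen[OF q] unfolding locally_generated_def by blast
        show ?thesis unfolding locally_generated_def
          by (rule exI[of _ "\<lambda>w. e w * h w"], rule exI[of _ "\<lambda>a w. e w * r a w + r b w * s a w"])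
             (use e h r s b substitute_generator[OF fin b(1) es eq] in
               \<open>auto intro!: polynomial_functions.add polynomial_functions.mult\<close>)
      qed
      show "locally_generated_max I z0 (A - {b}) g q"
        if q: "q \<in> vanishing_ideal I S" "\<And>i. i \<in> I \<Longrightarrow> partial_deriv i q z0 = 0" for q
      proof -
        obtain h r where h: "h \<in> polynomial_functions I" "h z0 \<noteq> 0"
          and r: "\<And>a. a \<in> A \<Longrightarrow> r a \<in> polynomial_functions I" "\<And>a. a \<in> A \<Longrightarrow> r a z0 = 0"
          and eq: "\<And>w. h w * q w = (\<Sum>a\<in>A. r a w * g a w)"
          using genm[OF q] unfolding locally_generated_max_def by blast
        show ?thesis unfolding locally_generated_max_def
          by (rule exI[of _ "\<lambda>w. e w * h w"], rule exI[of _ "\<lambda>a w. e w * r a w + r b w * s a w"])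
             (use e h r s b substitute_generator[OF fin b(1) es eq] in
               \<open>auto intro!: polynomial_functions.add polynomial_functions.mult\<close>)
      qed
    qed
  next
    case False
    \<comment> \<open>Smoothness is formulated with generators numbered from \<open>0\<close>.\<close>
    obtain t where t: "bij_betw t {..<card A} A"
      using fin by (metis ex_bij_betw_nat_finite atLeast0LessThan)
    then have tA: "t a \<in> A" if "a < card A" for a using that by (auto simp: bij_betw_def)
    have re: "(\<Sum>a<card A. F (t a)) = (\<Sum>a\<in>A. F a)" for F :: "nat \<Rightarrow> complex"
      by (rule sum.reindex_bij_betw[OF t])
    define t' where "t' = inv_into {..<card A} t"
    have t': "t' (t a) = a" if "a < card A" for a
      unfolding t'_def using t that by (simp add: bij_betw_def inv_into_f_f)
    show ?thesis
      unfolding smooth_point_def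
    proof (intro exI[of _ "card A"] exI[of _ "\<lambda>a. g (t a)"] conjI allI impI ballI)
      show "g (t a) \<in> vanishing_ideal I S" if "a < card A" for a using gS tA that by simp
    next
      fix u :: "nat \<Rightarrow> complex" and a
      assume 0: "\<forall>i\<in>I. (\<Sum>a<card A. u a * partial_deriv i (g (t a)) z0) = 0" and a: "a < card A"
      have "(\<Sum>a\<in>A. u (t' a) * partial_deriv i (g a) z0) = 0" if "i \<in> I" for i
      proof -
        have "(\<Sum>a\<in>A. u (t' a) * partial_deriv i (g a) z0) =
            (\<Sum>a<card A. u (t' (t a)) * partial_deriv i (g (t a)) z0)"
          by (rule re[symmetric])
        also have "\<dots> = (\<Sum>a<card A. u a * partial_deriv i (g (t a)) z0)"
          by (rule sum.cong) (auto simp: t')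
        finally show ?thesis using 0 that by simp
      qed
      then have "\<forall>i\<in>I. (\<Sum>a\<in>A. u (t' a) * partial_deriv i (g a) z0) = 0" by blast
      then have "\<forall>b\<in>A. u (t' b) = 0"
        using False[unfolded not_ex, THEN spec, of "\<lambda>a. u (t' a)"] by simp
      then have "u (t' (t a)) = 0" using tA[OF a] by blast
      then show "u a = 0" using t'[OF a] by simp
    next
      fix q assume q: "q \<in> vanishing_ideal I S"
      obtain h r where h: "h \<in> polynomial_functions I" "h z0 \<noteq> 0"
        and r: "\<And>a. a \<in> A \<Longrightarrow> r a \<in> polynomial_functions I"
        and eq: "\<And>w. h w * q w = (\<Sum>a\<in>A. r a w * g a w)"
        using gen[OF q] unfolding locally_generated_def by blast
      show "\<exists>h\<in>polynomial_functions I. \<exists>r. h z0 \<noteq> 0 \<and> (\<forall>a<card A. r a \<in> polynomial_functions I) \<and>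
          (\<forall>w. h w * q w = (\<Sum>a<card A. r a w * g (t a) w))"
      proof (rule bexI[OF _ h(1)], rule exI[of _ "\<lambda>a. r (t a)"], intro conjI allI impI)
        show "h w * q w = (\<Sum>a<card A. r (t a) w * g (t a) w)" for w
          using eq[of w] re[of "\<lambda>a. r a w * g a w"] by simp
      qed (use h r tA in auto)
    qed
  qed
qed

text \<open>\<open>\<sigma>\<close> embeds the coordinate subspace indexed by \<open>J\<close> and \<open>z \<mapsto> \<sigma> (z \<circ> \<phi>)\<close> is the projection onto it.
Given \<open>q\<close> in the ideal of the retract with vanishing differential, its pullback is a local combination
of the generators of the ideal of \<open>S\<close>; comparing differentials, independence makes all coefficients vanish
at the origin, and this persists after restriction.\<close>

lemma smooth_point_retract:
  fixes \<phi> :: "'j \<Rightarrow> 'i" and S :: "('i \<Rightarrow> complex) set"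
  assumes smooth: "smooth_point I S (\<lambda>_. 0)" and S0: "(\<lambda>_. 0) \<in> S"
    and inj: "inj_on \<phi> J" and JI: "\<phi> ` J \<subseteq> I"
    and \<sigma>: "\<And>w j. j \<in> J \<Longrightarrow> \<sigma> w (\<phi> j) = w j" "\<And>w i. i \<notin> \<phi> ` J \<Longrightarrow> \<sigma> w i = (0::complex)"
    and retract: "\<And>z. z \<in> S \<Longrightarrow> \<sigma> (z \<circ> \<phi>) \<in> S"
  shows "smooth_point J {w. \<sigma> w \<in> S} (\<lambda>_. 0)"
proof -
  obtain c :: nat and g where generators:
    "(\<forall>a<c. g a \<in> vanishing_ideal I S) \<and>
     (\<forall>u. (\<forall>i\<in>I. (\<Sum>a<c. u a * partial_deriv i (g a) (\<lambda>_. 0)) = 0) \<longrightarrow> (\<forall>a<c. u a = 0)) \<and>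
     (\<forall>q \<in> vanishing_ideal I S. \<exists>h \<in> polynomial_functions I. \<exists>r.
        h (\<lambda>_. 0) \<noteq> 0 \<and> (\<forall>a<c. r a \<in> polynomial_functions I) \<and>
        (\<forall>w. h w * q w = (\<Sum>a<c. r a w * g a w)))"
    using smooth unfolding smooth_point_def by (elim exE) (rule that)
  note gS = generators[THEN conjunct1, rule_format]
  note ind = generators[THEN conjunct2, THEN conjunct1, rule_format]
  note gen = generators[THEN conjunct2, THEN conjunct2, rule_format]
  have gp: "g a \<in> polynomial_functions I" if "a < c" for a
    using gS[OF that] unfolding vanishing_ideal_def by simp
  have g0: "g a (\<lambda>_. 0) = 0" if "a < c" for a
    using gS[OF that] S0 unfolding vanishing_ideal_def by simp
  have \<sigma>0: "\<sigma> (\<lambda>_. 0) = (\<lambda>_. 0)"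
    by (rule ext) (metis \<sigma> imageE)
  let ?S' = "{w. \<sigma> w \<in> S}"
  have down: "(\<lambda>w. p (\<sigma> w)) \<in> polynomial_functions J" if "p \<in> polynomial_functions I" for p
  proof (rule polynomial_functions_compose[OF that])
    fix i
    show "(\<lambda>w. \<sigma> w i) \<in> polynomial_functions J"
    proof (cases "i \<in> \<phi> ` J")
      case True
      then obtain j where "j \<in> J" "i = \<phi> j" by auto
      then show ?thesis by (simp add: \<sigma> polynomial_functions.coord)
    next
      case False
      then show ?thesis by (simp add: \<sigma> polynomial_functions.const)
    qed
  qed
  have down_ideal: "(\<lambda>w. p (\<sigma> w)) \<in> vanishing_ideal J ?S'" if "p \<in> vanishing_ideal I S" for p
    using that down unfolding vanishing_ideal_def by simp
  have cong: "p w = p w'" if "p \<in> polynomial_functions J" "\<And>j. j \<in> J \<Longrightarrow> w j = w' j" for p w w'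
    using that by induction auto
  have up_ideal: "(\<lambda>z. q (z \<circ> \<phi>)) \<in> vanishing_ideal I S" if "q \<in> vanishing_ideal J ?S'" for q
  proof -
    have q: "q \<in> polynomial_functions J" "\<And>w. \<sigma> w \<in> S \<Longrightarrow> q w = 0"
      using that unfolding vanishing_ideal_def by auto
    have "(\<lambda>z. q (z \<circ> \<phi>)) \<in> polynomial_functions I"
      by (rule polynomial_functions_compose[OF q(1)]) (use JI in \<open>auto intro:
          polynomial_functions.coord\<close>)
    then show ?thesis using q(2) retract unfolding vanishing_ideal_def by auto
  qed
  have updown: "q (\<sigma> w \<circ> \<phi>) = q w" if "q \<in> vanishing_ideal J ?S'" for q w
    using that cong[of q "\<sigma> w \<circ> \<phi>" w] \<sigma>(1) unfolding vanishing_ideal_def by simp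
  show ?thesis
  proof (rule smooth_point_if_generators[of "{..<c}" "\<lambda>a w. g a (\<sigma> w)"])
    show "(\<lambda>w. g a (\<sigma> w)) \<in> vanishing_ideal J ?S'" if "a \<in> {..<c}" for a
      using that by (intro down_ideal gS) simp
  next
    fix q assume q: "q \<in> vanishing_ideal J ?S'"
    obtain h r where h: "h \<in> polynomial_functions I" "h (\<lambda>_. 0) \<noteq> 0"
      and r: "\<And>a. a < c \<Longrightarrow> r a \<in> polynomial_functions I"
      and eq: "\<And>w. h w * q (w \<circ> \<phi>) = (\<Sum>a<c. r a w * g a w)"
      using gen[OF up_ideal[OF q]] by blast
    have eq': "h (\<sigma> w) * q w = (\<Sum>a<c. r a (\<sigma> w) * g a (\<sigma> w))" for w
      using eq[of "\<sigma> w"] updown[OF q] by simp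
    show "locally_generated J (\<lambda>_. 0) {..<c} (\<lambda>a w. g a (\<sigma> w)) q"
      unfolding locally_generated_def
      by (rule exI[of _ "\<lambda>w. h (\<sigma> w)"], rule exI[of _ "\<lambda>a w. r a (\<sigma> w)"])
         (use h r eq' down \<sigma>0 in auto)
    assume dq: "\<And>j. j \<in> J \<Longrightarrow> partial_deriv j q (\<lambda>_. 0) = 0"
    have qp: "q \<in> polynomial_functions J" using q unfolding vanishing_ideal_def by simp
    have hq0: "q (\<lambda>_. 0) = 0" using q S0 \<sigma>0 unfolding vanishing_ideal_def by simp
    have "(\<Sum>a<c. r a (\<lambda>_. 0) * partial_deriv i (g a) (\<lambda>_. 0)) = 0" if i: "i \<in> I" for i
    proof -
      let ?q = "\<lambda>z. q (z \<circ> \<phi>)"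
      have qI: "?q \<in> polynomial_functions I"
        using up_ideal[OF q] unfolding vanishing_ideal_def by simp
      have "partial_deriv i ?q (\<lambda>_. 0) = 0"
      proof (cases "i \<in> \<phi> ` J")
        case True
        then obtain j where j: "j \<in> J" "i = \<phi> j" by auto
        have "q ((\<lambda>_. 0)(i := t) \<circ> \<phi>) = q ((\<lambda>_. 0)(j := t))" for t
          by (rule cong[OF qp]) (use j inj in \<open>auto simp: inj_on_def\<close>)
        then show ?thesis using dq[OF j(1)] unfolding partial_deriv_def by simp
      next
        case False
        have "q ((\<lambda>_. 0)(i := t) \<circ> \<phi>) = q (\<lambda>_. 0)" for t
          by (rule cong[OF qp]) (use False in auto)
        then show ?thesis unfolding partial_deriv_def by simp
      qed
      then have "0 = (\<Sum>a\<in>{()}. h (\<lambda>_. 0) * partial_deriv i ?q (\<lambda>_. 0))" by simp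
      also have "\<dots> = partial_deriv i (\<lambda>w. \<Sum>a\<in>{()}. h w * ?q w) (\<lambda>_. 0)"
        by (rule partial_deriv_sum_mult[symmetric, where I = I]) (use h qI hq0 in \<open>auto simp:
            o_def\<close>)
      also have "\<dots> = partial_deriv i (\<lambda>w. \<Sum>a<c. r a w * g a w) (\<lambda>_. 0)"
        using eq by simp
      also have "\<dots> = (\<Sum>a<c. r a (\<lambda>_. 0) * partial_deriv i (g a) (\<lambda>_. 0))"
        by (rule partial_deriv_sum_mult[where I = I]) (use r gp g0 in auto)
      finally show ?thesis by simp
    qed
    then have r0: "r a (\<lambda>_. 0) = 0" if "a < c" for a
      using ind[of "\<lambda>a. r a (\<lambda>_. 0)", OF _ that] by blast
    show "locally_generated_max J (\<lambda>_. 0) {..<c} (\<lambda>a w. g a (\<sigma> w)) q"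
      unfolding locally_generated_max_def
      by (intro exI[of _ "\<lambda>w. h (\<sigma> w)"] exI[of _ "\<lambda>a w. r a (\<sigma> w)"])
         (use h r r0 eq' down \<sigma>0 in auto)
  qed simp
qed

section \<open>The retraction in the chart\<close>

text \<open>The limit of a chart point under the one-parameter group that scales the \<open>i\<close>-th coordinate.\<close>

definition zero_entries :: "nat \<Rightarrow> (nat \<times> nat \<Rightarrow> complex) \<Rightarrow> nat \<times> nat \<Rightarrow> complex" where
  "zero_entries i z = (\<lambda>(a, b). if a = i \<or> b = i then 0 else z (a, b))"

lemma mem_chart_subspace:
  "x \<in> chart_subspace n L z \<longleftrightarrow> x \<in> coord_space n \<and> (\<forall>j<n. j \<notin> L \<longrightarrow> x j = (\<Sum>a\<in>L. x a * z (a, j)))"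
  unfolding chart_subspace_def by simp

lemma chart_subspaceD:
  "x \<in> chart_subspace n L z \<Longrightarrow> j < n \<Longrightarrow> j \<notin> L \<Longrightarrow> x j = (\<Sum>a\<in>L. x a * z (a, j))"
  unfolding chart_subspace_def by blast

text \<open>If \<open>i \<notin> L\<close>, the new subspace is the image of the old one under setting the \<open>i\<close>-th coordinate to zero,
which is injective, and functions that vanish on \<open>S\<close> still do so.  If \<open>i \<in> L\<close>, the new subspace
consists of the functions in the old one with vanishing \<open>i\<close>-th coordinate and the multiples of the
\<open>i\<close>-th unit vector; for \<open>i \<notin> S\<close> this vector makes up for the dimension that may be lost.\<close>

lemma chart_zero_column_rank:
  assumes L: "L \<subseteq> {..<n}" and i: "i < n"
  shows "column_rank (chart_subspace n L (zero_entries i z)) S \<le> column_rank (chart_subspace n L z) S"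
proof -
  let ?W = "chart_subspace n L z" and ?Wz = "chart_subspace n L (zero_entries i z)"
  have W: "coord_subspace n ?W" and W0: "coord_subspace n ?Wz"
    by (rule coord_subspace_chart_subspace)+
  have "cfun.dim (zeros_on ?W S) \<le> cfun.dim (zeros_on ?Wz S)"
  proof (cases "i \<in> L")
    case False
    have nL: "a \<noteq> i" if "a \<in> L" for a using that False by blast
    define F where "F x j = (if j = i then 0 else x j)" for x :: "nat \<Rightarrow> complex" and j
    have F_add: "F (x + y) = F x + F y" for x y by (rule ext) (simp add: F_def)
    have F_scale: "F (fscale c x) = fscale c (F x)" for c x by (rule ext) (simp add: F_def
        fscale_def)
    have inj: "inj_on F (zeros_on ?W S)"
    proof (rule inj_onI)
      fix x y assume xy: "x \<in> zeros_on ?W S" "y \<in> zeros_on ?W S" "F x = F y"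
      have off: "x j = y j" if "j \<noteq> i" for j using fun_cong[OF xy(3), of j] that by (simp
          add: F_def)
      have "x i = (\<Sum>a\<in>L. x a * z (a, i))" "y i = (\<Sum>a\<in>L. y a * z (a, i))"
        using xy(1,2) unfolding zeros_on_def by (auto intro: chart_subspaceD[OF _ i False])
      moreover have "(\<Sum>a\<in>L. x a * z (a, i)) = (\<Sum>a\<in>L. y a * z (a, i))"
        by (rule sum.cong) (use off nL in auto)
      ultimately have "x i = y i" by simp
      then show "x = y" using off by (intro ext) metis
    qed
    have "F ` zeros_on ?W S \<subseteq> zeros_on ?Wz S"
    proof
      fix y assume "y \<in> F ` zeros_on ?W S"
      then obtain x where x: "x \<in> ?W" "\<forall>t\<in>S. x t = 0" "y = F x" unfolding zeros_on_def by blast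
      have "F x \<in> coord_space n" using x(1) unfolding mem_chart_subspace coord_space_def F_def by
          simp
      moreover have "F x j = (\<Sum>a\<in>L. F x a * zero_entries i z (a, j))" if "j < n" "j \<notin> L" for j
      proof (cases "j = i")
        case True
        then show ?thesis by (simp add: F_def zero_entries_def)
      next
        case j: False
        have "x j = (\<Sum>a\<in>L. x a * z (a, j))" by (rule chart_subspaceD[OF x(1) that])
        also have "\<dots> = (\<Sum>a\<in>L. F x a * zero_entries i z (a, j))"
          by (rule sum.cong) (use nL j in \<open>auto simp: F_def zero_entries_def\<close>)
        finally show ?thesis using j by (simp add: F_def)
      qed
      ultimately have "F x \<in> ?Wz" unfolding mem_chart_subspace by blast
      moreover have "\<forall>t\<in>S. F x t = 0" using x(2) by (simp add: F_def)
      ultimately show "y \<in> zeros_on ?Wz S" unfolding zeros_on_def x(3) by blast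
    qed
    moreover have Z: "coord_subspace n (zeros_on ?W S)" by (rule coord_subspace_zeros_on[OF W])
    then have "cfun.dim (F ` zeros_on ?W S) = cfun.dim (zeros_on ?W S)"
      using coord_subspace_finitely_spanned[OF Z] unfolding coord_subspace_def
      by (intro dim_image_inj_on F_add F_scale inj) blast+
    ultimately show ?thesis
      using dim_mono_finitely_spanned[OF coord_subspace_finitely_spanned[OF
          coord_subspace_zeros_on[OF W0]],
          of "F ` zeros_on ?W S" S] by simp
  next
    case True
    have sub: "zeros_on ?W (insert i S) \<subseteq> zeros_on ?Wz (insert i S)"
    proof
      fix x assume x: "x \<in> zeros_on ?W (insert i S)"
      then have xi: "x i = 0" and xW: "x \<in> ?W" unfolding zeros_on_def by auto
      have "x j = (\<Sum>a\<in>L. x a * zero_entries i z (a, j))" if "j < n" "j \<notin> L" for j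
      proof -
        have ji: "j \<noteq> i" using that True by blast
        have "x j = (\<Sum>a\<in>L. x a * z (a, j))" by (rule chart_subspaceD[OF xW that])
        also have "\<dots> = (\<Sum>a\<in>L. x a * zero_entries i z (a, j))"
          by (rule sum.cong) (use xi ji in \<open>auto simp: zero_entries_def\<close>)
        finally show ?thesis .
      qed
      then have "x \<in> ?Wz" using xW unfolding mem_chart_subspace by blast
      then show "x \<in> zeros_on ?Wz (insert i S)" using x unfolding zeros_on_def by blast
    qed
    have le: "cfun.dim (zeros_on ?W (insert i S)) \<le> cfun.dim (zeros_on ?Wz (insert i S))"
      by (rule dim_mono_finitely_spanned[OF coord_subspace_finitely_spanned[OF
          coord_subspace_zeros_on[OF W0]] sub])
    show ?thesis
    proof (cases "i \<in> S")
      case True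
      then show ?thesis using le by (simp add: insert_absorb)
    next
      case iS: False
      have "unit_fun i j = (\<Sum>a\<in>L. unit_fun i a * zero_entries i z (a, j))" if "j < n" "j \<notin> L" for j
      proof -
        have "j \<noteq> i" using that True by blast
        moreover have "(\<Sum>a\<in>L. unit_fun i a * zero_entries i z (a, j)) = 0"
          by (rule sum.neutral) (simp add: unit_fun_def zero_entries_def)
        ultimately show ?thesis by (simp add: unit_fun_def)
      qed
      moreover have "unit_fun i \<in> coord_space n" using i unfolding coord_space_def unit_fun_def by
          simp
      ultimately have "unit_fun i \<in> ?Wz" unfolding mem_chart_subspace by blast
      then have "unit_fun i \<in> zeros_on ?Wz S" using iS unfolding zeros_on_def unit_fun_def by auto
      moreover have "unit_fun i i \<noteq> 0" unfolding unit_fun_def by simp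
      ultimately have "\<exists>x\<in>zeros_on ?Wz S. x i \<noteq> 0" by (intro bexI[of _ "unit_fun i"])
      then have "cfun.dim (zeros_on ?Wz S) = cfun.dim (zeros_on ?Wz (insert i S)) + 1"
        using dim_zeros_on_insert[OF W0, of S i] by simp
      moreover have "cfun.dim (zeros_on ?W S) \<le> cfun.dim (zeros_on ?W (insert i S)) + 1"
        using dim_zeros_on_insert[OF W, of S i] by simp
      ultimately show ?thesis using le by simp
    qed
  qed
  then show ?thesis unfolding column_rank_def by (simp add: dim_chart_subspace[OF L] diff_le_mono2)
qed

lemma chart_zero_entries_positroid:
  assumes L: "L \<subseteq> {..<n}" and i: "i < n"
    and z: "chart_subspace n L z \<in> positroid_subspaces k n f"
  shows "chart_subspace n L (zero_entries i z) \<in> positroid_subspaces k n f"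
proof -
  let ?W = "chart_subspace n L z" and ?Wz = "chart_subspace n L (zero_entries i z)"
  have "rank_bounded n f ?Wz a b" if "rank_bounded n f ?W a b" for a b
    using that chart_zero_column_rank[OF L i, of z "cyclic_interval n a b"] unfolding
        rank_bounded_def by simp
  moreover have "cfun.dim ?Wz = cfun.dim ?W" by (simp add: dim_chart_subspace[OF L])
  moreover have "coord_subspace n ?Wz" by (rule coord_subspace_chart_subspace)
  ultimately show ?thesis using z unfolding mem_positroid_subspaces by metis
qed

definition reduced_index_set :: "nat \<Rightarrow> nat set \<Rightarrow> nat set" where
  "reduced_index_set i L = delete_index i ` (L - {i})"

lemma insert_index_reduced:
  "insert_index i ` reduced_index_set i L = L - {i}"
proof -
  have "(\<lambda>j. insert_index i (delete_index i j)) ` (L - {i}) = (\<lambda>j. j) ` (L - {i})"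
    by (rule image_cong) (simp_all add: insert_delete_index)
  then show ?thesis unfolding reduced_index_set_def image_image by simp
qed

lemma reduced_index_set_iff: "a \<in> reduced_index_set i L \<longleftrightarrow> insert_index i a \<in> L"
proof
  assume "a \<in> reduced_index_set i L"
  then show "insert_index i a \<in> L" using insert_index_reduced[of i L] by blast
next
  assume "insert_index i a \<in> L"
  moreover have "insert_index i a \<noteq> i" by (simp add: insert_index_def)
  ultimately have "delete_index i (insert_index i a) \<in> reduced_index_set i L"
    unfolding reduced_index_set_def by blast
  then show "a \<in> reduced_index_set i L" by simp
qed

lemma inj_insert_index: "inj_on (insert_index i) A"
  by (rule inj_onI) (metis delete_insert_index)

lemma insert_index_less_iff: "i < n \<Longrightarrow> insert_index i j < n \<longleftrightarrow> j < n - 1"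
  unfolding insert_index_def by auto

lemma card_reduced_index_set:
  assumes "finite L"
  shows "card (reduced_index_set i L) = (if i \<in> L then card L - 1 else card L)"
proof -
  have "card (reduced_index_set i L) = card (insert_index i ` reduced_index_set i L)"
    by (rule card_image[OF inj_insert_index, symmetric])
  then show ?thesis unfolding insert_index_reduced using assms by simp
qed

lemma reduced_index_set_subset: "L \<subseteq> {..<n} \<Longrightarrow> i < n \<Longrightarrow> reduced_index_set i L \<subseteq> {..<n - 1}"
  using insert_index_less_iff by (auto simp: reduced_index_set_iff)

text \<open>The embedding of the smaller chart as a coordinate subspace of the larger one.\<close>

definition extend_entries :: "nat \<Rightarrow> (nat \<times> nat \<Rightarrow> complex) \<Rightarrow> nat \<times> nat \<Rightarrow> complex" where
  "extend_entries i w = (\<lambda>(a, b). if a = i \<or> b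
      = i then 0 else w (delete_index i a, delete_index i b))"

lemma chart_sum_reindex:
  assumes finL: "finite L"
  shows "(\<Sum>a\<in>L. x a * extend_entries i w (a, insert_index i j)) =
    (\<Sum>a\<in>reduced_index_set i L. (x \<circ> insert_index i) a * w (a, j))"
proof -
  have ne: "insert_index i a \<noteq> i" for a by (simp add: insert_index_def)
  have "(\<Sum>a\<in>L. x a * extend_entries i w (a, insert_index i j)) =
      (\<Sum>a\<in>L - {i}. x a * extend_entries i w (a, insert_index i j))"
    by (rule sum.mono_neutral_right) (use finL in \<open>auto simp: extend_entries_def\<close>)
  also have "\<dots> = (\<Sum>a\<in>reduced_index_set i L.
      x (insert_index i a) * extend_entries i w (insert_index i a, insert_index i j))"
    unfolding insert_index_reduced[symmetric] by (subst sum.reindex[OF inj_insert_index]) simp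
  also have "\<dots> = (\<Sum>a\<in>reduced_index_set i L. (x \<circ> insert_index i) a * w (a, j))"
    by (simp add: extend_entries_def ne)
  finally show ?thesis .
qed

lemma chart_subspace_extend:
  assumes L: "L \<subseteq> {..<n}" and i: "i < n"
  shows "chart_subspace n L (extend_entries i w) =
    (if i \<in> L then lift_free n i (chart_subspace (n - 1) (reduced_index_set i L) w)
     else lift_zero n i (chart_subspace (n - 1) (reduced_index_set i L) w))"
proof -
  have finL: "finite L" using L finite_subset by blast
  let ?C = "chart_subspace (n - 1) (reduced_index_set i L) w"
  have ne: "insert_index i a \<noteq> i" for a by (simp add: insert_index_def)
  have off: "(\<forall>j<n. j \<noteq> i \<longrightarrow> j \<notin> L \<longrightarrow> x j = (\<Sum>a\<in>L. x a * extend_entries i w (a, j))) \<longleftrightarrow>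
      x \<circ> insert_index i \<in> ?C" if x: "x \<in> coord_space n" for x
  proof -
    have "(\<forall>j<n. j \<noteq> i \<longrightarrow> j \<notin> L \<longrightarrow> x j = (\<Sum>a\<in>L. x a * extend_entries i w (a, j))) \<longleftrightarrow>
      (\<forall>j<n - 1. insert_index i j \<notin> L \<longrightarrow>
         x (insert_index i j) = (\<Sum>a\<in>L. x a * extend_entries i w (a, insert_index i j)))"
      (is "?l \<longleftrightarrow> ?r")
    proof
      assume ?l
      then show ?r using ne insert_index_less_iff[OF i] by blast
    next
      assume r: ?r
      show ?l
      proof (intro allI impI)
        fix j assume j: "j < n" "j \<noteq> i" "j \<notin> L"
        have e: "insert_index i (delete_index i j) = j" by (rule insert_delete_index[OF j(2)])
        have "delete_index i j < n - 1" using insert_index_less_iff[OF i, of "delete_index i j"] e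
            j by simp
        with r j(3) e show "x j = (\<Sum>a\<in>L. x a * extend_entries i w (a, j))" by metis
      qed
    qed
    also have "\<dots> \<longleftrightarrow> x \<circ> insert_index i \<in> ?C"
      unfolding mem_chart_subspace chart_sum_reindex[OF finL] reduced_index_set_iff
      using comp_insert_index_coord_space[OF x i] by simp
    finally show ?thesis .
  qed
  have at: "(\<Sum>a\<in>L. x a * extend_entries i w (a, i)) = 0" for x
    by (rule sum.neutral) (simp add: extend_entries_def)
  show ?thesis
  proof (cases "i \<in> L")
    case True
    have "x \<in> chart_subspace n L (extend_entries i w) \<longleftrightarrow> x \<in> lift_free n i ?C" for x
    proof -
      have "x \<in> chart_subspace n L (extend_entries i w) \<longleftrightarrow> x \<in> coord_space n \<and>
          (\<forall>j<n. j \<noteq> i \<longrightarrow> j \<notin> L \<longrightarrow> x j = (\<Sum>a\<in>L. x a * extend_entries i w (a, j)))"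
        unfolding mem_chart_subspace using True by blast
      then show ?thesis unfolding lift_free_def using off by blast
    qed
    then show ?thesis using True by auto
  next
    case False
    have "x \<in> chart_subspace n L (extend_entries i w) \<longleftrightarrow> x \<in> lift_zero n i ?C" for x
    proof -
      have "x \<in> chart_subspace n L (extend_entries i w) \<longleftrightarrow> x \<in> coord_space n \<and> x i = 0 \<and>
          (\<forall>j<n. j \<noteq> i \<longrightarrow> j \<notin> L \<longrightarrow> x j = (\<Sum>a\<in>L. x a * extend_entries i w (a, j)))"
        unfolding mem_chart_subspace using False i at[of x] by metis
      then show ?thesis unfolding lift_zero_def using off by blast
    qed
    then show ?thesis using False by auto
  qed
qed

text \<open>The fixed component that the reduction at \<open>i\<close> selects.\<close>

definition reducible_at :: "nat \<Rightarrow> nat set \<Rightarrow> (nat \<Rightarrow> complex) set \<Rightarrow> bool" where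
  "reducible_at i L W \<longleftrightarrow> (if i \<in> L then unit_fun i \<in> W else \<forall>x\<in>W. x i = 0)"

lemma drop_coord_inj:
  assumes W: "coord_subspace n W" "reducible_at i L W" and W': "coord_subspace n W'"
      "reducible_at i L W'"
    and eq: "drop_coord i W = drop_coord i W'"
  shows "W = W'"
proof (cases "i \<in> L")
  case True
  then have e: "unit_fun i \<in> W"
      "unit_fun i \<in> W'" using W(2) W'(2) unfolding reducible_at_def by simp_all
  have "W = lift_free n i (drop_coord i W)" by (rule lift_free_drop_coord[OF W(1) e(1), symmetric])
  also have "\<dots> = W'" unfolding eq by (rule lift_free_drop_coord[OF W'(1) e(2)])
  finally show ?thesis .
next
  case False
  then have e: "\<forall>x\<in>W. x i = 0"
      "\<forall>x\<in>W'. x i = 0" using W(2) W'(2) unfolding reducible_at_def by simp_all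
  have "W = lift_zero n i (drop_coord i W)" by (rule lift_zero_drop_coord[OF W(1) e(1), symmetric])
  also have "\<dots> = W'" unfolding eq by (rule lift_zero_drop_coord[OF W'(1) e(2)])
  finally show ?thesis .
qed

lemma drop_coord_chart_subspace:
  assumes L: "L \<subseteq> {..<n}" and i: "i < n"
  shows "drop_coord i (chart_subspace n L (extend_entries i w))
      = chart_subspace (n - 1) (reduced_index_set i L) w"
    and "reducible_at i L (chart_subspace n L (extend_entries i w))"
proof -
  let ?C = "chart_subspace (n - 1) (reduced_index_set i L) w"
  have C: "coord_subspace (n - 1) ?C" by (rule coord_subspace_chart_subspace)
  show "drop_coord i (chart_subspace n L (extend_entries i w)) = ?C"
    unfolding chart_subspace_extend[OF assms]
    using drop_coord_lift_zero[OF C i] drop_coord_lift_free[OF C i] by simp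
  show "reducible_at i L (chart_subspace n L (extend_entries i w))"
    unfolding chart_subspace_extend[OF assms] reducible_at_def
    using unit_fun_in_lift_free[OF C i] by (simp add: lift_zero_def)
qed

definition subspace_variety :: "nat \<Rightarrow> (nat \<Rightarrow> complex) set set \<Rightarrow> complex vec set set" where
  "subspace_variety n P = (\<lambda>W. vec n ` W) ` P"

lemma mem_subspace_variety:
  assumes "\<forall>W\<in>P. coord_subspace n W" "coord_subspace n W"
  shows "vec n ` W \<in> subspace_variety n P \<longleftrightarrow> W \<in> P"
proof
  assume "vec n ` W \<in> subspace_variety n P"
  then obtain V where V: "V \<in> P" "vec n ` W = vec n ` V" unfolding subspace_variety_def by blast
  then have "W = V"
    using vec_image_inj[of W n V] assms unfolding coord_subspace_def by blast
  then show "W \<in> P" using V by simp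
qed (simp add: subspace_variety_def)

lemma chart_point_in_subspace_variety:
  assumes "L \<subseteq> {..<n}" "\<forall>W\<in>P. coord_subspace n W"
  shows "chart_point n L z \<in> subspace_variety n P \<longleftrightarrow> chart_subspace n L z \<in> P"
  unfolding chart_point_eq[OF assms(1)]
  by (rule mem_subspace_variety[OF assms(2) coord_subspace_chart_subspace])

lemma vec_image_forget:
  assumes "i < n"
  shows "forget_coord n i ` vec n ` W = vec (n - 1) ` drop_coord i W"
proof -
  have "forget_coord n i (vec n x) = vec (n - 1) (x \<circ> insert_index i)" for x
    unfolding forget_coord_def by (rule eq_vecI) (simp_all add: insert_index_less_iff[OF assms])
  then show ?thesis unfolding drop_coord_def by (simp add: image_image)
qed

lemma vec_image_vanishing:
  assumes "i < n"
  shows "(\<forall>v\<in>vec n ` W. v $ i = 0) \<longleftrightarrow> (\<forall>x\<in>W. x i = 0)"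
  using assms by simp

lemma vec_image_unit:
  assumes "i < n" "coord_subspace n W"
  shows "unit_vec n i \<in> vec n ` W \<longleftrightarrow> unit_fun i \<in> W"
proof
  have u: "unit_vec n i = vec n (unit_fun i)" unfolding unit_vec_def unit_fun_def ..
  show "unit_fun i \<in> W \<Longrightarrow> unit_vec n i \<in> vec n ` W" unfolding u by blast
  assume "unit_vec n i \<in> vec n ` W"
  then obtain x where "x \<in> W" "unit_vec n i = vec n x" by blast
  then have x: "x \<in> W" "vec n x = vec n (unit_fun i)" unfolding u by simp_all
  have "x j = unit_fun i j" for j
  proof (cases "j < n")
    case True
    then show ?thesis using arg_cong[OF x(2), of "\<lambda>v. v $ j"] by simp
  next
    case False
    then show ?thesis using x(1) assms unfolding coord_subspace_def coord_space_def unit_fun_def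
        by auto
  qed
  then have "x = unit_fun i" by (rule ext)
  then show "unit_fun i \<in> W" using x(1) by simp
qed

text \<open>The one of the two operations that a reduction step applies to column \<open>i\<close>.\<close>

fun reduction :: "nat \<Rightarrow> pointed_variety \<Rightarrow> pointed_variety" where
  "reduction i (k, n, X, L)
      = (if i \<in> L then contraction i (k, n, X, L) else deletion i (k, n, X, L))"

lemma forget_subspace_variety:
  assumes "i < n"
  shows "(\<lambda>V. forget_coord n i ` V) ` subspace_variety n P
      = subspace_variety (n - 1) (drop_coord i ` P)"
proof -
  have "(\<lambda>V. forget_coord n i ` V) ` subspace_variety n P = (\<lambda>W. forget_coord n i ` vec n ` W) ` P"
    unfolding subspace_variety_def by (rule image_image)
  also have "\<dots> = (\<lambda>W. vec (n - 1) ` drop_coord i W) ` P"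
    unfolding vec_image_forget[OF assms] ..
  also have "\<dots> = subspace_variety (n - 1) (drop_coord i ` P)"
    unfolding subspace_variety_def by (rule image_image[symmetric])
  finally show ?thesis .
qed

lemma deletion_subspace_variety:
  assumes i: "i < n"
  shows "deletion i (k, n, subspace_variety n P, L) =
    (k, n - 1, subspace_variety (n - 1) (drop_coord i ` {W \<in> P. \<forall>x\<in>W. x i = 0}), reduced_index_set
        i L)"
proof -
  have S: "{V \<in> subspace_variety n P. \<forall>v\<in>V. v $ i = 0} = subspace_variety n {W \<in> P. \<forall>x\<in>W. x i = 0}"
    unfolding subspace_variety_def using vec_image_vanishing[OF i] by blast
  show ?thesis unfolding deletion.simps S forget_subspace_variety[OF i] reduced_index_set_def ..
qed

lemma contraction_subspace_variety:
  assumes i: "i < n" and P: "\<forall>W\<in>P. coord_subspace n W"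
  shows "contraction i (k, n, subspace_variety n P, L) =
    (k - 1, n - 1, subspace_variety (n - 1) (drop_coord i ` {W \<in> P. unit_fun i \<in> W}),
        reduced_index_set i L)"
proof -
  have S: "{V \<in> subspace_variety n P. unit_vec n i \<in> V}
      = subspace_variety n {W \<in> P. unit_fun i \<in> W}"
    unfolding subspace_variety_def using vec_image_unit[OF i] P by blast
  show ?thesis unfolding contraction.simps S forget_subspace_variety[OF i] reduced_index_set_def ..
qed

lemma reduction_subspace_variety:
  assumes i: "i < n" and P: "\<forall>W\<in>P. coord_subspace n W"
  shows "reduction i (k, n, subspace_variety n P, L) =
    (if i \<in> L then k - 1 else k, n - 1,
     subspace_variety (n - 1) (drop_coord i ` {W \<in> P. reducible_at i L W}), reduced_index_set i L)"
proof (cases "i \<in> L")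
  case True
  then show ?thesis
    by (simp only: reduction.simps reducible_at_def if_True contraction_subspace_variety[OF i P])
next
  case False
  then show ?thesis
    by (simp only: reduction.simps reducible_at_def if_False deletion_subspace_variety[OF i])
qed

lemma reduced_chart_point:
  assumes L: "L \<subseteq> {..<n}" and i: "i < n" and P: "\<forall>W\<in>P. coord_subspace n W"
  shows "chart_point (n - 1) (reduced_index_set i L) w \<in>
      subspace_variety (n - 1) (drop_coord i ` {W \<in> P. reducible_at i L W}) \<longleftrightarrow>
    chart_point n L (extend_entries i w) \<in> subspace_variety n P"
proof -
  let ?C = "chart_subspace n L (extend_entries i w)"
  let ?Q = "drop_coord i ` {W \<in> P. reducible_at i L W}"
  have L': "reduced_index_set i L \<subseteq> {..<n - 1}" by (rule reduced_index_set_subset[OF L i])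
  have Q: "\<forall>V\<in>?Q. coord_subspace (n - 1) V"
    using coord_subspace_drop_coord[OF _ i] P by blast
  have C: "coord_subspace n ?C" by (rule coord_subspace_chart_subspace)
  have "drop_coord i ?C \<in> ?Q \<longleftrightarrow> ?C \<in> P"
  proof
    assume "drop_coord i ?C \<in> ?Q"
    then obtain W where W: "W \<in> P" "reducible_at i L W" "drop_coord i ?C = drop_coord i W" by blast
    have "coord_subspace n W" using P W(1) by blast
    then have "?C = W" using W(2,3) by (rule drop_coord_inj[OF C drop_coord_chart_subspace(2)[OF L
        i]])
    then show "?C \<in> P" using W by simp
  qed (use drop_coord_chart_subspace(2)[OF L i] in blast)
  then show ?thesis
    unfolding chart_point_in_subspace_variety[OF L' Q] chart_point_in_subspace_variety[OF L P]
      drop_coord_chart_subspace(1)[OF L i] .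
qed

section \<open>Atomic pairs\<close>

text \<open>The smaller chart is a coordinate subspace of the larger one and meets the variety in the reduced
variety (\<open>reduced_chart_point\<close>); by \<open>zero\<close> the projection onto it is a retraction of the variety.\<close>

lemma smooth_at_reduction:
  assumes L: "L \<subseteq> {..<n}" and i: "i < n" and P: "\<forall>W\<in>P. coord_subspace n W"
    and zero: "\<forall>z. chart_subspace n L z \<in> P \<longrightarrow> chart_subspace n L (zero_entries i z) \<in> P"
    and pt: "coordinate_plane n L \<in> subspace_variety n P"
    and smooth: "smooth_at n L (subspace_variety n P)"
  shows "smooth_at (n - 1) (reduced_index_set i L)
    (subspace_variety (n - 1) (drop_coord i ` {W \<in> P. reducible_at i L W}))"
proof -
  let ?S = "{z. chart_point n L z \<in> subspace_variety n P}"
  let ?J = "chart_coords (n - 1) (reduced_index_set i L)"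
  let ?\<phi> = "\<lambda>(a, b). (insert_index i a, insert_index i b)"
  \<comment> \<open>\<open>\<sigma> w\<close> agrees with \<open>extend_entries i w\<close> on the chart coordinates and is zero at all other indices,
    where the values have no meaning.\<close>
  define \<sigma> where "\<sigma> w p = (if p \<in> ?\<phi> ` ?J then extend_entries i w p else 0)" for w p
  have ne: "insert_index i a \<noteq> i" for a by (simp add: insert_index_def)
  have img: "?\<phi> ` ?J = {(a, b) \<in> chart_coords n L. a \<noteq> i \<and> b \<noteq> i}"
  proof
    show "?\<phi> ` ?J \<subseteq> {(a, b) \<in> chart_coords n L. a \<noteq> i \<and> b \<noteq> i}"
    proof
      fix p assume "p \<in> ?\<phi> ` ?J"
      then obtain a b where p: "p = (insert_index i a, insert_index i b)" "(a, b) \<in> ?J" by auto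
      then have "insert_index i a \<in> L" "insert_index i b < n" "insert_index i b \<notin> L"
        unfolding chart_coords_def by (simp_all add: reduced_index_set_iff
            insert_index_less_iff[OF i])
      then show "p \<in> {(a, b) \<in> chart_coords n L. a \<noteq> i \<and> b \<noteq> i}"
        unfolding p chart_coords_def using ne by simp
    qed
    show "{(a, b) \<in> chart_coords n L. a \<noteq> i \<and> b \<noteq> i} \<subseteq> ?\<phi> ` ?J"
    proof
      fix p assume "p \<in> {(a, b) \<in> chart_coords n L. a \<noteq> i \<and> b \<noteq> i}"
      then obtain a b where p: "p = (a, b)" "a \<in> L" "b < n" "b \<notin> L" "a \<noteq> i" "b \<noteq> i"
        unfolding chart_coords_def by auto
      have e: "insert_index i (delete_index i a) = a" "insert_index i (delete_index i b) = b"
        by (rule insert_delete_index[OF p(5)], rule insert_delete_index[OF p(6)])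
      have "(delete_index i a, delete_index i b) \<in> ?J"
        unfolding chart_coords_def using p e insert_index_less_iff[OF i, of "delete_index i b"]
        by (simp add: reduced_index_set_iff)
      moreover have "p = ?\<phi> (delete_index i a, delete_index i b)" using e p(1) by simp
      ultimately show "p \<in> ?\<phi> ` ?J" by (intro image_eqI)
    qed
  qed
  have chart_cong: "chart_point n L z = chart_point n L z'" if "\<And>p. p \<in> chart_coords n L \<Longrightarrow> z p
      = z' p" for z z'
  proof -
    have "chart_subspace n L z = chart_subspace n L z'"
    proof (rule Set.set_eqI)
      fix x
      have "(\<Sum>a\<in>L. x a * z (a, j)) = (\<Sum>a\<in>L. x a * z' (a, j))" if "j < n" "j \<notin> L" for j
        using \<open>\<And>p. p \<in> chart_coords n L \<Longrightarrow> z p = z' p\<close> that unfolding chart_coords_def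
        by (intro sum.cong) auto
      then show "x \<in> chart_subspace n L z \<longleftrightarrow> x \<in> chart_subspace n L z'"
        unfolding mem_chart_subspace by auto
    qed
    then show ?thesis unfolding chart_point_eq[OF L] by simp
  qed
  have \<sigma>_chart: "chart_point n L (\<sigma> w) = chart_point n L (extend_entries i w)" for w
  proof (rule chart_cong)
    fix p assume p: "p \<in> chart_coords n L"
    show "\<sigma> w p = extend_entries i w p"
      unfolding \<sigma>_def img using p by (auto simp: extend_entries_def)
  qed
  have "smooth_point ?J {w. \<sigma> w \<in> ?S} (\<lambda>_. 0)"
  proof (rule smooth_point_retract[where \<phi> = ?\<phi>])
    show "smooth_point (chart_coords n L) ?S (\<lambda>_. 0)" using smooth unfolding smooth_at_def .
    show "(\<lambda>_. 0) \<in> ?S" using pt coordinate_plane_eq_chart_point[OF L] by simp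
    show "inj_on ?\<phi> ?J"
    proof (rule inj_onI)
      fix p q assume "?\<phi> p = ?\<phi> q"
      moreover obtain a b c d where "p = (a, b)" "q = (c, d)" by (metis prod.exhaust)
      ultimately show "p = q"
        using inj_onD[OF inj_insert_index, of i a c UNIV] inj_onD[OF inj_insert_index, of i b
            d UNIV] by simp
    qed
    show "?\<phi> ` ?J \<subseteq> chart_coords n L" unfolding img by blast
    show "\<sigma> w (?\<phi> j) = w j" if "j \<in> ?J" for w j
    proof -
      have "?\<phi> j \<in> ?\<phi> ` ?J" using that by (rule imageI)
      then have "\<sigma> w (?\<phi> j) = extend_entries i w (?\<phi> j)" unfolding \<sigma>_def by (simp only: if_True)
      then show ?thesis by (cases j) (simp add: extend_entries_def ne)
    qed
    show "\<sigma> w p = 0" if "p \<notin> ?\<phi> ` ?J" for w p using that unfolding \<sigma>_def by (simp only: if_False)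
    show "\<sigma> (z \<circ> ?\<phi>) \<in> ?S" if z: "z \<in> ?S" for z
    proof -
      have "chart_point n L (\<sigma> (z \<circ> ?\<phi>)) = chart_point n L (zero_entries i z)"
        unfolding \<sigma>_chart
      proof (rule chart_cong)
        fix p show "extend_entries i (z \<circ> ?\<phi>) p = zero_entries i z p"
          by (cases p) (simp add: extend_entries_def zero_entries_def insert_delete_index)
      qed
      then show ?thesis
        using z zero unfolding mem_Collect_eq
        by (simp only: chart_point_in_subspace_variety[OF L P])
    qed
  qed
  moreover have "{w. \<sigma> w \<in> ?S} = {w. chart_point (n - 1) (reduced_index_set i L) w \<in>
      subspace_variety (n - 1) (drop_coord i ` {W \<in> P. reducible_at i L W})}"
    unfolding reduced_chart_point[OF L i P] mem_Collect_eq \<sigma>_chart ..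
  ultimately show ?thesis unfolding smooth_at_def by simp
qed

text \<open>Polynomials without variables are constant, so those that vanish at a point are zero and the empty
family generates.\<close>

lemma smooth_point_no_coordinates:
  assumes "z \<in> S"
  shows "smooth_point {} S z"
proof -
  have "q w = 0" if q: "q \<in> vanishing_ideal {} S" for q w
  proof -
    have "q \<in> polynomial_functions {}" using q unfolding vanishing_ideal_def by simp
    then have "q w = q z" by induction auto
    then show ?thesis using q assms unfolding vanishing_ideal_def by simp
  qed
  then show ?thesis
    unfolding smooth_point_def
    by (intro exI[of _ 0] exI[of _ "\<lambda>_ _. 0"])
       (auto intro!: bexI[of _ "\<lambda>_. 1"] polynomial_functions.const)
qed

lemma not_singular_without_columns: "\<not> singular_pair (k, 0, X, L)"
proof
  assume s: "singular_pair (k, 0, X, L)"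
  have "coordinate_plane 0 L = chart_point 0 L (\<lambda>_. 0)"
    unfolding coordinate_plane_def chart_point_def
    by (intro arg_cong[where f = "\<lambda>x. row_span 0 (mat_of_rows 0 x)"] map_cong) (auto intro!:
        eq_vecI)
  then have "smooth_point (chart_coords 0 L) {z. chart_point 0 L z \<in> X} (\<lambda>_. 0)"
    using s by (auto simp: chart_coords_def intro: smooth_point_no_coordinates)
  then show False using s by (simp add: smooth_at_def)
qed

lemma positroid_variety_subspaces:
  "0 < n \<Longrightarrow> positroid_variety k n f = subspace_variety n (positroid_subspaces k n f)"
  unfolding subspace_variety_def by (rule positroid_variety_eq)

lemma positroid_subspaces_coord: "\<forall>W\<in>positroid_subspaces k n f. coord_subspace n W"
  unfolding positroid_subspaces_def by simp

context
  fixes k n :: nat and X :: "complex vec set set" and L :: "nat set" and i :: nat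
  assumes pair: "positroid_pair (k, n, X, L)" and i: "i < n"
begin

lemma reduction_singular:
  assumes "singular_pair (reduction i (k, n, X, L))"
  shows "singular_pair (k, n, X, L)"
proof -
  obtain f where f: "bounded_affine_permutation k n f"
      "X = positroid_variety k n f" and L: "L \<subseteq> {..<n}"
    and pt: "coordinate_plane n L \<in> X" using pair by auto
  have X: "X = subspace_variety n (positroid_subspaces k n f)" unfolding f(2) using i by (intro
      positroid_variety_subspaces) simp
  note red = reduction_subspace_variety[OF i positroid_subspaces_coord, of k k f L, folded X]
  have "\<not> smooth_at n L X"
  proof
    assume "smooth_at n L X"
    then have "smooth_at (n - 1) (reduced_index_set i L)
        (subspace_variety (n - 1) (drop_coord i ` {W \<in> positroid_subspaces k n f. reducible_at
            i L W}))"
      using smooth_at_reduction[OF L i positroid_subspaces_coord, of k f]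
          chart_zero_entries_positroid[OF L i] pt
      unfolding X by blast
    then show False using assms unfolding red by simp
  qed
  then show ?thesis using pt by simp
qed

lemma reduction_positroid_pair:
  assumes n2: "2 \<le> n"
  shows "positroid_pair (reduction i (k, n, X, L))"
proof -
  obtain f where f: "bounded_affine_permutation k n f"
      "X = positroid_variety k n f" and L: "L \<subseteq> {..<n}" "card L = k"
    and pt: "coordinate_plane n L \<in> X" using pair by auto
  let ?P = "positroid_subspaces k n f"
  have finL: "finite L" using L finite_subset by blast
  have X: "X = subspace_variety n ?P" unfolding f(2) using i by (intro
      positroid_variety_subspaces) simp
  let ?k = "if i \<in> L then k - 1 else k"
  let ?Q = "drop_coord i ` {W \<in> ?P. reducible_at i L W}"
  have L': "reduced_index_set i L \<subseteq> {..<n - 1}" by (rule reduced_index_set_subset[OF L(1) i])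
  have ext0: "extend_entries i (\<lambda>_. 0) = (\<lambda>_. 0)" by (auto simp: extend_entries_def fun_eq_iff)
  have cp: "chart_point n L (\<lambda>_. 0) \<in> X" using pt coordinate_plane_eq_chart_point[OF L(1)] by simp
  have pt': "coordinate_plane (n - 1) (reduced_index_set i L) \<in> subspace_variety (n - 1) ?Q"
    unfolding coordinate_plane_eq_chart_point[OF L'] reduced_chart_point[OF L(1) i
        positroid_subspaces_coord]
      ext0 X[symmetric] by (rule cp)
  have "chart_subspace n L (\<lambda>_. 0) \<in> ?P"
    using cp unfolding X chart_point_in_subspace_variety[OF L(1) positroid_subspaces_coord] .
  moreover have "reducible_at i L (chart_subspace n L (\<lambda>_. 0))"
    using drop_coord_chart_subspace(2)[OF L(1) i, of "\<lambda>_. 0"] unfolding ext0 .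
  ultimately have ex: "\<exists>W\<in>?P. reducible_at i L W" by blast
  have "\<exists>g. bounded_affine_permutation ?k (n - 1) g \<and> ?Q = positroid_subspaces ?k (n - 1) g"
    using deletion_of_positroid_subspaces[OF n2 i f(1)] contraction_of_positroid_subspaces[OF n2 i
        f(1)] ex
    unfolding reducible_at_def by (cases "i \<in> L") simp_all
  then obtain g where g: "bounded_affine_permutation ?k (n - 1) g"
      "?Q = positroid_subspaces ?k (n - 1) g" by blast
  have "subspace_variety (n - 1) ?Q = positroid_variety ?k (n - 1) g"
    unfolding g(2) using n2 by (intro positroid_variety_subspaces[symmetric]) simp
  moreover have "card (reduced_index_set i L) = ?k" using card_reduced_index_set[OF finL] L by simp
  moreover have red: "reduction i (k, n, X, L)
      = (?k, n - 1, subspace_variety (n - 1) ?Q, reduced_index_set i L)"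
    unfolding X by (rule reduction_subspace_variety[OF i positroid_subspaces_coord])
  moreover note g(1)
  ultimately show ?thesis unfolding red positroid_pair.simps using L' pt' by blast
qed

text \<open>The new point is not on the new variety: their dimensions \<open>k\<close> and \<open>k - 1\<close> differ.\<close>

lemma wrong_reduction_not_singular:
  shows "i \<in> L \<Longrightarrow> \<not> singular_pair (deletion i (k, n, X, L))"
    and "i \<notin> L \<Longrightarrow> \<not> singular_pair (contraction i (k, n, X, L))"
proof -
  obtain f where f: "X = positroid_variety k n f" and L: "L \<subseteq> {..<n}" "card L = k"
    using pair by auto
  let ?P = "positroid_subspaces k n f"
  have finL: "finite L" using L finite_subset by blast
  have X: "X = subspace_variety n ?P" unfolding f using i by (intro positroid_variety_subspaces)
      simp
  have L': "reduced_index_set i L \<subseteq> {..<n - 1}" by (rule reduced_index_set_subset[OF L(1) i])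
  have card': "card (reduced_index_set i L) = (if i \<in> L then k - 1 else k)"
    using card_reduced_index_set[OF finL] L by simp
  have mem: "\<exists>W\<in>?P. R W \<and> cfun.dim (drop_coord i W) = card (reduced_index_set i L)"
    if pt: "coordinate_plane (n - 1) (reduced_index_set i L) \<in> subspace_variety (n - 1) (drop_coord i ` {W \<in> ?P. R W})" for R
  proof -
    let ?Q = "drop_coord i ` {W \<in> ?P. R W}"
    have Q: "\<forall>V\<in>?Q. coord_subspace (n - 1) V"
      using coord_subspace_drop_coord[OF _ i] positroid_subspaces_coord by blast
    have "chart_subspace (n - 1) (reduced_index_set i L) (\<lambda>_. 0) \<in> ?Q"
      using pt unfolding coordinate_plane_eq_chart_point[OF L']
          chart_point_in_subspace_variety[OF L' Q] .
    then obtain W where W: "W \<in> ?P" "R W"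
        "chart_subspace (n - 1) (reduced_index_set i L) (\<lambda>_. 0) = drop_coord i W" by blast
    then have "cfun.dim (drop_coord i W) = card (reduced_index_set i L)"
      using dim_chart_subspace[OF L'] by metis
    then show ?thesis using W by blast
  qed
  have P: "coord_subspace n W" "cfun.dim W = k" if "W \<in> ?P" for W
    using that unfolding mem_positroid_subspaces by blast+
  show "\<not> singular_pair (deletion i (k, n, X, L))" if iL: "i \<in> L"
  proof
    assume "singular_pair (deletion i (k, n, X, L))"
    then have "coordinate_plane (n - 1) (reduced_index_set i L) \<in>
        subspace_variety (n - 1) (drop_coord i ` {W \<in> ?P. \<forall>x\<in>W. x i = 0})"
      unfolding X deletion_subspace_variety[OF i] singular_pair.simps by (rule conjunct1)
    from mem[OF this] obtain W where W: "W \<in> ?P" "\<forall>x\<in>W. x i = 0"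
      "cfun.dim (drop_coord i W) = card (reduced_index_set i L)" by blast
    then have "k = k - 1" using dim_drop_coord_vanishing[OF P(1)[OF W(1)] W(2)] P(2)[OF W(1)]
        card' iL by simp
    moreover have "0 < k" using iL L finL card_gt_0_iff by blast
    ultimately show False by simp
  qed
  show "\<not> singular_pair (contraction i (k, n, X, L))" if iL: "i \<notin> L"
  proof
    assume "singular_pair (contraction i (k, n, X, L))"
    then have "coordinate_plane (n - 1) (reduced_index_set i L) \<in>
        subspace_variety (n - 1) (drop_coord i ` {W \<in> ?P. unit_fun i \<in> W})"
      unfolding X contraction_subspace_variety[OF i positroid_subspaces_coord] singular_pair.simps
          by (rule conjunct1)
    from mem[OF this] obtain W where W: "W \<in> ?P" "unit_fun i \<in> W"
      "cfun.dim (drop_coord i W) = card (reduced_index_set i L)" by blast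
    then show False using dim_drop_coord_unit[OF P(1)[OF W(1)] W(2)] P(2)[OF W(1)] card' iL by simp
  qed
qed

end

lemma reduction_step_iff:
  "reduction_step (k, n, X, L) Q \<longleftrightarrow> (\<exists>i<n. Q = reduction i (k, n, X, L))"
proof
  assume "reduction_step (k, n, X, L) Q"
  then show "\<exists>i<n. Q = reduction i (k, n, X, L)"
    by cases (auto intro: exI)
next
  assume "\<exists>i<n. Q = reduction i (k, n, X, L)"
  then obtain i where i: "i < n" "Q = reduction i (k, n, X, L)" by blast
  then show "reduction_step (k, n, X, L) Q"
    using reduction_step.delete[of i n L k X] reduction_step.contract[of i n L k X]
        by (cases "i \<in> L") simp_all
qed

lemma reduction_columns: "fst (snd (reduction i (k, n, X, L))) = n - 1"
  by simp

lemma atomic_pair_exists: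
  "positroid_pair (k, n, X, L) \<Longrightarrow> singular_pair (k, n, X, L) \<Longrightarrow>
    \<exists>Q. reduction_step\<^sup>*\<^sup>* (k, n, X, L) Q \<and> atomic_pair Q"
proof (induction n arbitrary: k X L rule: less_induct)
  case (less n)
  show ?case
  proof (cases "atomic_pair (k, n, X, L)")
    case False
    then obtain i where i: "i < n" and
      "singular_pair (deletion i (k, n, X, L)) \<or> singular_pair (contraction i (k, n, X, L))"
      using less.prems by auto
    then have s: "singular_pair (reduction i (k, n, X, L))"
      using wrong_reduction_not_singular[OF less.prems(1) i] by (cases "i \<in> L") auto
    obtain k' X' L' where Y: "reduction i (k, n, X, L) = (k', n - 1, X', L')"
      using reduction_columns[of i k n X L] by (metis prod.collapse)
    have "n - 1 \<noteq> 0" using s not_singular_without_columns unfolding Y by metis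
    then have n2: "2 \<le> n" by simp
    have "positroid_pair (k', n - 1, X', L')"
      using reduction_positroid_pair[OF less.prems(1) i n2] unfolding Y .
    moreover have "singular_pair (k', n - 1, X', L')" using s unfolding Y .
    ultimately obtain Q where Q: "reduction_step\<^sup>*\<^sup>* (k', n - 1, X', L') Q" "atomic_pair Q"
      using less.IH[of "n - 1"] i by (metis diff_less less_nat_zero_code linorder_not_less
          zero_less_one less_one gr0I)
    have "reduction_step (k, n, X, L) (k', n - 1, X', L')"
      unfolding reduction_step_iff using i Y by metis
    then show ?thesis using Q by (meson converse_rtranclp_into_rtranclp)
  qed blast
qed

lemma singular_if_reduces_to_atomic:
  assumes "reduction_step\<^sup>*\<^sup>* P Q" "atomic_pair Q" "positroid_pair P"
  shows "singular_pair P"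
  using assms(1,3)
proof (induction rule: converse_rtranclp_induct)
  case base
  obtain k n X L where "Q = (k, n, X, L)" by (rule prod_cases4)
  then show ?case using assms(2) by simp
next
  case (step P P')
  obtain k n X L where P: "P = (k, n, X, L)" by (rule prod_cases4)
  obtain i where i: "i < n" "P' = reduction i (k, n, X, L)"
    using step.hyps(1) unfolding P reduction_step_iff by blast
  obtain k' X' L' where Y: "P' = (k', n - 1, X', L')"
    using reduction_columns[of i k n X L] i(2) by (metis prod.collapse)
  have pair: "positroid_pair (k, n, X, L)" using step.prems P by simp
  \<comment> \<open>With one column, the step would lead to a pair without columns, where every chain ends and which
    is no positroid pair.\<close>
  have "2 \<le> n"
  proof (rule ccontr)
    assume "\<not> 2 \<le> n"
    then have "P' = (k', 0, X', L')" using Y by simp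
    moreover have "Q = P'"
      using step.hyps(2) by (cases rule: converse_rtranclpE) (auto simp: \<open>P' = (k', 0, X', L')\<close>
          reduction_step_iff)
    ultimately show False
      using assms(2) by (simp add: bounded_affine_permutation_def)
  qed
  then have "singular_pair P'"
    using step.IH reduction_positroid_pair[OF pair i(1)] i(2) by simp
  then show ?case using reduction_singular[OF pair i(1)] unfolding i(2) P by simp
qed

theorem proposition13:
  fixes k n :: nat and f :: "int \<Rightarrow> int" and L :: "nat set"
  assumes "bounded_affine_permutation k n f"
    and "L \<subseteq> {..<n}" and "card L = k"
    and "coordinate_plane n L \<in> positroid_variety k n f"
  shows "singular_pair (k, n, positroid_variety k n f, L) \<longleftrightarrow>
    (\<exists>Q. reduction_step\<^sup>*\<^sup>* (k, n, positroid_variety k n f, L) Q \<and> atomic_pair Q)"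
proof -
  have "positroid_pair (k, n, positroid_variety k n f, L)" using assms by auto
  then show ?thesis using atomic_pair_exists singular_if_reduces_to_atomic by blast
qed

end
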